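(* Let $H$ be a Hopf algebra with bijective antipode $S$, let $A$ be a right $H$-comodule transposed Poisson algebra, let $B=A^{AcoH}$, and let $M$ be a transposed Poisson $(A,H)$-Hopf module. Assume that there exists a homomorphism of right $H$-comodules $\phi:H\rightarrow A^A$ which is also an algebra map. Put $p_M:M\to M$, $p_M(m)=\phi(S^{-1}(m_{(1)}))\cdot m_{(0)}$, and $p_A:A\to A$, $p_A(a)=\phi(S^{-1}(a_{(1)}))a_{(0)}$. Assume that $$\{1_A,aa'\}\cdot p_M(m)=\phi(a'_{(1)})\diamond\big(a\cdot p_M(a'_{(0)}\cdot m)\big)\quad\text{for all } a,a'\in A,\ m\in M,$$ and $$\{1_A,aa'\}\, p_A(a'')=\{\phi(a'_{(1)}),\, a\,p_A(a'_{(0)} a'')\}\quad\text{for all } a,a',a''\in A.$$ Then the linear map $$\alpha:A\otimes_B M^{AcoH}\rightarrow M,\quad a\otimes_B m\mapsto a\cdot m$$ is an isomorphism of transposed Poisson $(A,H)$-Hopf modules.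
   Context: $\mathbf{k}$ is a field of characteristic $0$; all vector spaces, algebras and tensor products are over $\mathbf{k}$ unless indicated. $H$ has comultiplication $\Delta(h)=h_1\otimes h_2$, counit $\varepsilon$ and bijective antipode $S$; $H$ is a right $H$-comodule via $\Delta$. Right $H$-coactions are written $m\mapsto m_{(0)}\otimes m_{(1)}$ (implicit sums), and $M^{coH}=\{m\in M: m_{(0)}\otimes m_{(1)}=m\otimes 1_H\}$. Modules over algebras are left unital modules. A transposed Poisson algebra is a commutative associative unital algebra $A$ with a Lie bracket $\{\cdot,\cdot\}$ satisfying $2a\{b,c\}=\{ab,c\}+\{b,ac\}$ for all $a,b,c\in A$. Its transposed Poisson center is $A^A=\{b\in A: b\{a,a'\}=\{ba,a'\}\ \forall a,a'\in A\}$. A right $H$-comodule transposed Poisson algebra is a transposed Poisson algebra $A$ that is a right $H$-comodule algebra (the coaction is a unital algebra map $A\to A\otimes H$) with $\{a,a'\}_{(0)}\otimes\{a,a'\}_{(1)}=\{a_{(0)},a'_{(0)}\}\otimes a_{(1)}a'_{(1)}$ for all $a,a'\in A$. Put $A^{AcoH}=A^A\cap A^{coH}$. A transposed Poisson $A$-module is a vector space $M$ with an $A$-module structure $\cdot$ and a Lie $A$-module structure $\diamond$ (i.e. $\{a,b\}\diamond m=a\diamond(b\diamond m)-b\diamond(a\diamond m)$) such that $2\{a,b\}\cdot m=a\diamond(b\cdot m)-b\diamond(a\cdot m)$ and $2a\cdot(b\diamond m)=(ab)\diamond m+b\diamond(a\cdot m)$ for all $a,b\in A$, $m\in M$. Put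 $M^A=\{m\in M:\{a,a'\}\cdot m=a\diamond(a'\cdot m)\ \forall a,a'\in A\}$ and $M^{AcoH}=M^A\cap M^{coH}$; this is a $B$-submodule of $M$. A transposed Poisson $(A,H)$-Hopf module is a transposed Poisson $A$-module $M$ that is a right $H$-comodule with $(a\cdot m)_{(0)}\otimes(a\cdot m)_{(1)}=a_{(0)}\cdot m_{(0)}\otimes a_{(1)}m_{(1)}$ and $(a\diamond m)_{(0)}\otimes(a\diamond m)_{(1)}=a_{(0)}\diamond m_{(0)}\otimes a_{(1)}m_{(1)}$. Morphisms are the maps that are $A$-linear, Lie $A$-linear and $H$-colinear. $A\otimes_B M^{AcoH}$ is a transposed Poisson $(A,H)$-Hopf module via $a'\cdot(a\otimes_B m)=a'a\otimes_B m$, $a'\diamond(a\otimes_B m)=\{a',a\}\otimes_B m$ and coaction $a\otimes_B m\mapsto (a_{(0)}\otimes_B m)\otimes a_{(1)}$. $A^A$ is a subalgebra and $H$-subcomodule of $A$. *)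

theory Defs
  imports "HOL-Algebra.Module"
begin

section \<open>Tensor products over a commutative ring\<close>

text \<open>
  The tensor product of two \<open>R\<close>-modules is presented by generators and relations: a finite
  formal sum \<open>m\<^sub>1 \<otimes> n\<^sub>1 + \<dots> + m\<^sub>k \<otimes> n\<^sub>k\<close> is a list of pairs, and elements of the tensor product
  are classes of such lists modulo the least congruence that makes concatenation commutative and
  the symbol \<open>m \<otimes> n\<close> bilinear and balanced.  Negatives come from \<open>(\<ominus> m) \<otimes> n\<close>.
\<close>

inductive tensor_eq ::
  "('r, 'x) ring_scheme \<Rightarrow> ('r, 'm, 'y) module_scheme \<Rightarrow> ('r, 'n, 'z) module_scheme
    \<Rightarrow> ('m \<times> 'n) list \<Rightarrow> ('m \<times> 'n) list \<Rightarrow> bool"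
  for R M N where
  refl: "set xs \<subseteq> carrier M \<times> carrier N \<Longrightarrow> tensor_eq R M N xs xs"
| sym: "tensor_eq R M N xs ys \<Longrightarrow> tensor_eq R M N ys xs"
| trans: "tensor_eq R M N xs ys \<Longrightarrow> tensor_eq R M N ys zs \<Longrightarrow> tensor_eq R M N xs zs"
| append: "tensor_eq R M N xs xs' \<Longrightarrow> tensor_eq R M N ys ys'
    \<Longrightarrow> tensor_eq R M N (xs @ ys) (xs' @ ys')"
| commute: "set xs \<subseteq> carrier M \<times> carrier N \<Longrightarrow> set ys \<subseteq> carrier M \<times> carrier N
    \<Longrightarrow> tensor_eq R M N (xs @ ys) (ys @ xs)"
| zero: "n \<in> carrier N \<Longrightarrow> tensor_eq R M N [(\<zero>\<^bsub>M\<^esub>, n)] []"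
| add_left: "m \<in> carrier M \<Longrightarrow> m' \<in> carrier M \<Longrightarrow> n \<in> carrier N
    \<Longrightarrow> tensor_eq R M N [(m \<oplus>\<^bsub>M\<^esub> m', n)] [(m, n), (m', n)]"
| add_right: "m \<in> carrier M \<Longrightarrow> n \<in> carrier N \<Longrightarrow> n' \<in> carrier N
    \<Longrightarrow> tensor_eq R M N [(m, n \<oplus>\<^bsub>N\<^esub> n')] [(m, n), (m, n')]"
| balanced: "r \<in> carrier R \<Longrightarrow> m \<in> carrier M \<Longrightarrow> n \<in> carrier N
    \<Longrightarrow> tensor_eq R M N [(r \<odot>\<^bsub>M\<^esub> m, n)] [(m, r \<odot>\<^bsub>N\<^esub> n)]"

definition tensor_class ::
  "('r, 'x) ring_scheme \<Rightarrow> ('r, 'm, 'y) module_scheme \<Rightarrow> ('r, 'n, 'z) module_scheme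
    \<Rightarrow> ('m \<times> 'n) list \<Rightarrow> ('m \<times> 'n) list set" where
  "tensor_class R M N xs = {ys. tensor_eq R M N xs ys}"

definition pure_tensor ::
  "('r, 'x) ring_scheme \<Rightarrow> ('r, 'm, 'y) module_scheme \<Rightarrow> ('r, 'n, 'z) module_scheme
    \<Rightarrow> 'm \<Rightarrow> 'n \<Rightarrow> ('m \<times> 'n) list set" where
  "pure_tensor R M N m n = tensor_class R M N [(m, n)]"

definition tensor_rep :: "('m \<times> 'n) list set \<Rightarrow> ('m \<times> 'n) list" where
  "tensor_rep X = (SOME xs. xs \<in> X)"

definition tensor ::
  "('r, 'x) ring_scheme \<Rightarrow> ('r, 'm, 'y) module_scheme \<Rightarrow> ('r, 'n, 'z) module_scheme
    \<Rightarrow> ('r, ('m \<times> 'n) list set) module" where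
  "tensor R M N = \<lparr>
    carrier = tensor_class R M N ` {xs. set xs \<subseteq> carrier M \<times> carrier N},
    mult = undefined,
    one = undefined,
    zero = tensor_class R M N [],
    add = (\<lambda>X Y. tensor_class R M N (tensor_rep X @ tensor_rep Y)),
    smult = (\<lambda>r X. tensor_class R M N (map (\<lambda>(m, n). (r \<odot>\<^bsub>M\<^esub> m, n)) (tensor_rep X)))\<rparr>"

text \<open>
  \<open>tensor_lift P f\<close> is the additive map into \<open>P\<close> sending \<open>m \<otimes> n\<close> to \<open>f m n\<close>.  It depends on the
  chosen representative unless \<open>f\<close> is balanced, see \<open>tensor_lift_class\<close> below; it is only used for
  balanced \<open>f\<close>.  It also renders Sweedler notation: for a coaction
  \<open>\<rho>\<close>, the expression \<open>f (m\<^sub>(\<^sub>0\<^sub>)) (m\<^sub>(\<^sub>1\<^sub>))\<close> is \<open>tensor_lift P f (\<rho> m)\<close>.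
\<close>

definition tensor_sum ::
  "('p, 'z) ring_scheme \<Rightarrow> ('m \<Rightarrow> 'n \<Rightarrow> 'p) \<Rightarrow> ('m \<times> 'n) list \<Rightarrow> 'p" where
  "tensor_sum P f xs = foldr (\<lambda>(m, n) s. f m n \<oplus>\<^bsub>P\<^esub> s) xs \<zero>\<^bsub>P\<^esub>"

definition tensor_lift ::
  "('p, 'z) ring_scheme \<Rightarrow> ('m \<Rightarrow> 'n \<Rightarrow> 'p) \<Rightarrow> ('m \<times> 'n) list set \<Rightarrow> 'p" where
  "tensor_lift P f X = tensor_sum P f (tensor_rep X)"

locale balanced_map =
  fixes R :: "('r, 'x) ring_scheme" and M :: "('r, 'm, 'y) module_scheme"
    and N :: "('r, 'n, 'z) module_scheme" and P :: "('p, 'w) ring_scheme" and f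
  assumes P_group: "abelian_group P"
    and M_group: "abelian_group M" and N_group: "abelian_group N"
    and smult_M: "\<lbrakk>r \<in> carrier R; m \<in> carrier M\<rbrakk> \<Longrightarrow> r \<odot>\<^bsub>M\<^esub> m \<in> carrier M"
    and smult_N: "\<lbrakk>r \<in> carrier R; n \<in> carrier N\<rbrakk> \<Longrightarrow> r \<odot>\<^bsub>N\<^esub> n \<in> carrier N"
    and closed: "\<lbrakk>m \<in> carrier M; n \<in> carrier N\<rbrakk> \<Longrightarrow> f m n \<in> carrier P"
    and add_left: "\<lbrakk>m \<in> carrier M; m' \<in> carrier M; n \<in> carrier N\<rbrakk>
      \<Longrightarrow> f (m \<oplus>\<^bsub>M\<^esub> m') n = f m n \<oplus>\<^bsub>P\<^esub> f m' n"
    and add_right: "\<lbrakk>m \<in> carrier M; n \<in> carrier N; n' \<in> carrier N\<rbrakk>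
      \<Longrightarrow> f m (n \<oplus>\<^bsub>N\<^esub> n') = f m n \<oplus>\<^bsub>P\<^esub> f m n'"
    and balanced: "\<lbrakk>r \<in> carrier R; m \<in> carrier M; n \<in> carrier N\<rbrakk>
      \<Longrightarrow> f (r \<odot>\<^bsub>M\<^esub> m) n = f m (r \<odot>\<^bsub>N\<^esub> n)"
begin

interpretation P: abelian_group P by (rule P_group)
interpretation M: abelian_group M by (rule M_group)
interpretation N: abelian_group N by (rule N_group)

lemma tensor_eq_carrier:
  "tensor_eq R M N xs ys \<Longrightarrow>
    set xs \<subseteq> carrier M \<times> carrier N \<and> set ys \<subseteq> carrier M \<times> carrier N"
  by (induction rule: tensor_eq.induct) (auto simp: smult_M smult_N)

lemma tensor_sum_closed:
  "set xs \<subseteq> carrier M \<times> carrier N \<Longrightarrow> tensor_sum P f xs \<in> carrier P"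
  by (induction xs) (auto simp: tensor_sum_def closed)

lemma tensor_sum_append:
  "\<lbrakk>set xs \<subseteq> carrier M \<times> carrier N; set ys \<subseteq> carrier M \<times> carrier N\<rbrakk>
    \<Longrightarrow> tensor_sum P f (xs @ ys) = tensor_sum P f xs \<oplus>\<^bsub>P\<^esub> tensor_sum P f ys"
proof (induction xs)
  case Nil
  then show ?case using tensor_sum_closed[of ys] by (simp add: tensor_sum_def)
next
  case (Cons x xs)
  then show ?case using tensor_sum_closed[of xs] tensor_sum_closed[of ys]
    by (cases x) (auto simp: tensor_sum_def closed P.a_assoc)
qed

lemma zero_left: "n \<in> carrier N \<Longrightarrow> f \<zero>\<^bsub>M\<^esub> n = \<zero>\<^bsub>P\<^esub>"
  using add_left[of "\<zero>\<^bsub>M\<^esub>" "\<zero>\<^bsub>M\<^esub>" n] closed[of "\<zero>\<^bsub>M\<^esub>" n]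
  by (simp add: P.add.r_cancel_one')

lemma tensor_sum_cong: "tensor_eq R M N xs ys \<Longrightarrow> tensor_sum P f xs = tensor_sum P f ys"
proof (induction rule: tensor_eq.induct)
  case (append xs xs' ys ys')
  then show ?case
    using tensor_eq_carrier[OF append(1)] tensor_eq_carrier[OF append(2)]
    by (simp add: tensor_sum_append)
next
  case (commute xs ys)
  then show ?case by (simp add: tensor_sum_append tensor_sum_closed P.a_comm)
qed (auto simp: tensor_sum_def zero_left add_left add_right balanced closed)

lemma tensor_lift_class:
  assumes "set xs \<subseteq> carrier M \<times> carrier N"
  shows "tensor_lift P f (tensor_class R M N xs) = tensor_sum P f xs"
proof -
  have "xs \<in> tensor_class R M N xs"
    using assms by (simp add: tensor_class_def tensor_eq.refl)
  then have "tensor_rep (tensor_class R M N xs) \<in> tensor_class R M N xs"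
    unfolding tensor_rep_def by (rule someI)
  then show ?thesis
    by (simp add: tensor_lift_def tensor_class_def tensor_sum_cong)
qed

lemma tensor_lift_pure:
  "\<lbrakk>m \<in> carrier M; n \<in> carrier N\<rbrakk> \<Longrightarrow> tensor_lift P f (pure_tensor R M N m n) = f m n"
  by (simp add: pure_tensor_def tensor_lift_class) (simp add: tensor_sum_def closed)

end


section \<open>Linear maps and algebras over the base field\<close>

definition linear_maps ::
  "('k, 'x) ring_scheme \<Rightarrow> ('k, 'm, 'y) module_scheme \<Rightarrow> ('k, 'n, 'z) module_scheme
    \<Rightarrow> ('m \<Rightarrow> 'n) set" where
  "linear_maps K M N = {f. f \<in> carrier M \<rightarrow> carrier N
    \<and> (\<forall>x\<in>carrier M. \<forall>y\<in>carrier M. f (x \<oplus>\<^bsub>M\<^esub> y) = f x \<oplus>\<^bsub>N\<^esub> f y)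
    \<and> (\<forall>c\<in>carrier K. \<forall>x\<in>carrier M. f (c \<odot>\<^bsub>M\<^esub> x) = c \<odot>\<^bsub>N\<^esub> f x)}"

definition bilinear_maps ::
  "('k, 'x) ring_scheme \<Rightarrow> ('k, 'm, 'y) module_scheme \<Rightarrow> ('k, 'n, 'z) module_scheme
    \<Rightarrow> ('k, 'p, 'w) module_scheme \<Rightarrow> ('m \<Rightarrow> 'n \<Rightarrow> 'p) set" where
  "bilinear_maps K M N P = {f.
    (\<forall>m\<in>carrier M. (\<lambda>n. f m n) \<in> linear_maps K N P) \<and>
    (\<forall>n\<in>carrier N. (\<lambda>m. f m n) \<in> linear_maps K M P)}"

text \<open>The library's locale \<^locale>\<open>algebra\<close> is for commutative algebras only.\<close>

locale unital_algebra =
  fixes K :: "('k, 'x) ring_scheme" and A :: "('k, 'a, 'y) module_scheme"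
  assumes ring: "ring A" and module: "module K A"
    and mult_bilinear: "(\<lambda>a b. a \<otimes>\<^bsub>A\<^esub> b) \<in> bilinear_maps K A A A"

definition algebra_homs ::
  "('k, 'x) ring_scheme \<Rightarrow> ('k, 'a, 'y) module_scheme \<Rightarrow> ('k, 'b, 'z) module_scheme
    \<Rightarrow> ('a \<Rightarrow> 'b) set" where
  "algebra_homs K A B = ring_hom A B \<inter> linear_maps K A B"

definition tensor_algebra ::
  "('k, 'x) ring_scheme \<Rightarrow> ('k, 'a, 'y) module_scheme \<Rightarrow> ('k, 'b, 'z) module_scheme
    \<Rightarrow> ('k, ('a \<times> 'b) list set) module" where
  "tensor_algebra K A B = (tensor K A B)\<lparr>
    mult := (\<lambda>X Y.
      tensor_lift (tensor K A B) (\<lambda>a b.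
        tensor_lift (tensor K A B) (\<lambda>a' b'.
          pure_tensor K A B (a \<otimes>\<^bsub>A\<^esub> a') (b \<otimes>\<^bsub>B\<^esub> b')) Y) X),
    one := pure_tensor K A B \<one>\<^bsub>A\<^esub> \<one>\<^bsub>B\<^esub>\<rparr>"


section \<open>Hopf algebras and comodules\<close>

record ('k, 'h) hopf_algebra = "('k, 'h) module" +
  comult :: "'h \<Rightarrow> ('h \<times> 'h) list set"
  counit :: "'h \<Rightarrow> 'k"
  antipode :: "'h \<Rightarrow> 'h"

text \<open>Both sides of coassociativity are compared in \<open>H \<otimes> (H \<otimes> H)\<close>.\<close>

locale hopf_algebra =
  fixes K :: "('k, 'x) ring_scheme" and H :: "('k, 'h, 'y) hopf_algebra_scheme"
  assumes unital_algebra: "unital_algebra K H"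
    and comult_hom: "comult H \<in> algebra_homs K H (tensor_algebra K H H)"
    and counit_hom: "counit H \<in> ring_hom H K"
    and counit_smult: "\<lbrakk>c \<in> carrier K; h \<in> carrier H\<rbrakk>
      \<Longrightarrow> counit H (c \<odot>\<^bsub>H\<^esub> h) = c \<otimes>\<^bsub>K\<^esub> counit H h"
    and coassoc: "h \<in> carrier H \<Longrightarrow>
      tensor_lift (tensor K H (tensor K H H))
        (\<lambda>x y. pure_tensor K H (tensor K H H) x (comult H y)) (comult H h) =
      tensor_lift (tensor K H (tensor K H H))
        (\<lambda>x y. tensor_lift (tensor K H (tensor K H H))
          (\<lambda>x\<^sub>1 x\<^sub>2. pure_tensor K H (tensor K H H) x\<^sub>1 (pure_tensor K H H x\<^sub>2 y)) (comult H x))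
        (comult H h)"
    and counit_left: "h \<in> carrier H
      \<Longrightarrow> tensor_lift H (\<lambda>x y. counit H x \<odot>\<^bsub>H\<^esub> y) (comult H h) = h"
    and counit_right: "h \<in> carrier H
      \<Longrightarrow> tensor_lift H (\<lambda>x y. counit H y \<odot>\<^bsub>H\<^esub> x) (comult H h) = h"
    and antipode_linear: "antipode H \<in> linear_maps K H H"
    and antipode_left: "h \<in> carrier H
      \<Longrightarrow> tensor_lift H (\<lambda>x y. antipode H x \<otimes>\<^bsub>H\<^esub> y) (comult H h) = counit H h \<odot>\<^bsub>H\<^esub> \<one>\<^bsub>H\<^esub>"
    and antipode_right: "h \<in> carrier H
      \<Longrightarrow> tensor_lift H (\<lambda>x y. x \<otimes>\<^bsub>H\<^esub> antipode H y) (comult H h) = counit H h \<odot>\<^bsub>H\<^esub> \<one>\<^bsub>H\<^esub>"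

definition bijective_antipode :: "('k, 'h, 'y) hopf_algebra_scheme \<Rightarrow> bool" where
  "bijective_antipode H \<longleftrightarrow> bij_betw (antipode H) (carrier H) (carrier H)"

definition inv_antipode :: "('k, 'h, 'y) hopf_algebra_scheme \<Rightarrow> 'h \<Rightarrow> 'h" where
  "inv_antipode H = inv_into (carrier H) (antipode H)"

locale right_comodule =
  fixes K :: "('k, 'x) ring_scheme" and H :: "('k, 'h, 'y) hopf_algebra_scheme"
    and M :: "('k, 'm, 'z) module_scheme" and \<rho> :: "'m \<Rightarrow> ('m \<times> 'h) list set"
  assumes hopf_algebra: "hopf_algebra K H" and module: "module K M"
    and coaction_linear: "\<rho> \<in> linear_maps K M (tensor K M H)"
    and coaction_coassoc: "m \<in> carrier M \<Longrightarrow>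
      tensor_lift (tensor K M (tensor K H H))
        (\<lambda>x h. pure_tensor K M (tensor K H H) x (comult H h)) (\<rho> m) =
      tensor_lift (tensor K M (tensor K H H))
        (\<lambda>x h. tensor_lift (tensor K M (tensor K H H))
          (\<lambda>x' h'. pure_tensor K M (tensor K H H) x' (pure_tensor K H H h' h)) (\<rho> x))
        (\<rho> m)"
    and coaction_counit: "m \<in> carrier M
      \<Longrightarrow> tensor_lift M (\<lambda>x h. counit H h \<odot>\<^bsub>M\<^esub> x) (\<rho> m) = m"

definition colinear_maps ::
  "('k, 'x) ring_scheme \<Rightarrow> ('k, 'h, 'y) hopf_algebra_scheme
    \<Rightarrow> ('k, 'm, 'z) module_scheme \<Rightarrow> ('m \<Rightarrow> ('m \<times> 'h) list set)
    \<Rightarrow> ('k, 'n, 'w) module_scheme \<Rightarrow> ('n \<Rightarrow> ('n \<times> 'h) list set) \<Rightarrow> ('m \<Rightarrow> 'n) set" where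
  "colinear_maps K H M \<rho> N \<sigma> = {f \<in> linear_maps K M N. \<forall>m\<in>carrier M.
    \<sigma> (f m) = tensor_lift (tensor K N H) (\<lambda>x h. pure_tensor K N H (f x) h) (\<rho> m)}"

definition coinvariants ::
  "('k, 'x) ring_scheme \<Rightarrow> ('k, 'h, 'y) hopf_algebra_scheme
    \<Rightarrow> ('k, 'm, 'z) module_scheme \<Rightarrow> ('m \<Rightarrow> ('m \<times> 'h) list set) \<Rightarrow> 'm set" where
  "coinvariants K H M \<rho> = {m \<in> carrier M. \<rho> m = pure_tensor K M H m \<one>\<^bsub>H\<^esub>}"


section \<open>Transposed Poisson algebras\<close>

record ('k, 'a) tp_algebra = "('k, 'a) module" +
  bracket :: "'a \<Rightarrow> 'a \<Rightarrow> 'a"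

locale tp_algebra =
  fixes K :: "('k, 'x) ring_scheme" and A :: "('k, 'a, 'y) tp_algebra_scheme"
  assumes algebra: "algebra K A"
    and bracket_bilinear: "bracket A \<in> bilinear_maps K A A A"
    and bracket_alternating: "a \<in> carrier A \<Longrightarrow> bracket A a a = \<zero>\<^bsub>A\<^esub>"
    and jacobi: "\<lbrakk>a \<in> carrier A; b \<in> carrier A; c \<in> carrier A\<rbrakk> \<Longrightarrow>
      bracket A a (bracket A b c) \<oplus>\<^bsub>A\<^esub> bracket A b (bracket A c a) \<oplus>\<^bsub>A\<^esub>
        bracket A c (bracket A a b) = \<zero>\<^bsub>A\<^esub>"
    and transposed_leibniz: "\<lbrakk>a \<in> carrier A; b \<in> carrier A; c \<in> carrier A\<rbrakk> \<Longrightarrow>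
      [(2::nat)] \<cdot>\<^bsub>A\<^esub> (a \<otimes>\<^bsub>A\<^esub> bracket A b c) =
        bracket A (a \<otimes>\<^bsub>A\<^esub> b) c \<oplus>\<^bsub>A\<^esub> bracket A b (a \<otimes>\<^bsub>A\<^esub> c)"

definition tp_center :: "('k, 'a, 'y) tp_algebra_scheme \<Rightarrow> 'a set" where
  "tp_center A = {b \<in> carrier A. \<forall>a\<in>carrier A. \<forall>a'\<in>carrier A.
    b \<otimes>\<^bsub>A\<^esub> bracket A a a' = bracket A (b \<otimes>\<^bsub>A\<^esub> a) a'}"

record ('k, 'a, 'h) comodule_tp_algebra = "('k, 'a) tp_algebra" +
  coact :: "'a \<Rightarrow> ('a \<times> 'h) list set"

locale comodule_tp_algebra =
  fixes K :: "('k, 'x) ring_scheme" and H :: "('k, 'h, 'y) hopf_algebra_scheme"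
    and A :: "('k, 'a, 'h, 'z) comodule_tp_algebra_scheme"
  assumes tp_algebra: "tp_algebra K A"
    and comodule: "right_comodule K H A (coact A)"
    and coact_hom: "coact A \<in> algebra_homs K A (tensor_algebra K A H)"
    and coact_bracket: "\<lbrakk>a \<in> carrier A; a' \<in> carrier A\<rbrakk> \<Longrightarrow>
      coact A (bracket A a a') =
        tensor_lift (tensor K A H) (\<lambda>x h.
          tensor_lift (tensor K A H) (\<lambda>x' h'.
            pure_tensor K A H (bracket A x x') (h \<otimes>\<^bsub>H\<^esub> h')) (coact A a')) (coact A a)"

text \<open>The subalgebra \<open>A\<^sup>A \<inter> A\<^sup>c\<^sup>o\<^sup>H\<close>, as a ring.\<close>

definition coinv_center ::
  "('k, 'x) ring_scheme \<Rightarrow> ('k, 'h, 'y) hopf_algebra_scheme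
    \<Rightarrow> ('k, 'a, 'h, 'z) comodule_tp_algebra_scheme
    \<Rightarrow> ('k, 'a, 'h, 'z) comodule_tp_algebra_scheme" where
  "coinv_center K H A = A\<lparr>carrier := tp_center A \<inter> coinvariants K H A (coact A)\<rparr>"


section \<open>Transposed Poisson modules and Hopf modules\<close>

text \<open>
  The additive group of \<open>M\<close>, cut down to \<open>S\<close>, with scalars acting by \<open>act\<close>.  The type of scalars
  may change.
\<close>

definition module_via ::
  "('k, 'm, 'y) module_scheme \<Rightarrow> 'm set \<Rightarrow> ('r \<Rightarrow> 'm \<Rightarrow> 'm) \<Rightarrow> ('r, 'm) module" where
  "module_via M S act = \<lparr>carrier = S, mult = undefined, one = undefined,
    zero = \<zero>\<^bsub>M\<^esub>, add = add M, smult = act\<rparr>"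

record ('k, 'a, 'm) tp_module = "('k, 'm) module" +
  act :: "'a \<Rightarrow> 'm \<Rightarrow> 'm"
  lie_act :: "'a \<Rightarrow> 'm \<Rightarrow> 'm"

locale tp_module =
  fixes K :: "('k, 'x) ring_scheme" and A :: "('k, 'a, 'y) tp_algebra_scheme"
    and M :: "('k, 'a, 'm, 'z) tp_module_scheme"
  assumes tp_algebra: "tp_algebra K A" and vector_space: "module K M"
    and act_module: "module A (module_via M (carrier M) (act M))"
    and act_bilinear: "act M \<in> bilinear_maps K A M M"
    and lie_act_bilinear: "lie_act M \<in> bilinear_maps K A M M"
    and lie_module: "\<lbrakk>a \<in> carrier A; b \<in> carrier A; m \<in> carrier M\<rbrakk> \<Longrightarrow>
      lie_act M (bracket A a b) m =
        lie_act M a (lie_act M b m) \<ominus>\<^bsub>M\<^esub> lie_act M b (lie_act M a m)"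
    and bracket_act: "\<lbrakk>a \<in> carrier A; b \<in> carrier A; m \<in> carrier M\<rbrakk> \<Longrightarrow>
      [(2::nat)] \<cdot>\<^bsub>M\<^esub> act M (bracket A a b) m =
        lie_act M a (act M b m) \<ominus>\<^bsub>M\<^esub> lie_act M b (act M a m)"
    and act_lie_act: "\<lbrakk>a \<in> carrier A; b \<in> carrier A; m \<in> carrier M\<rbrakk> \<Longrightarrow>
      [(2::nat)] \<cdot>\<^bsub>M\<^esub> act M a (lie_act M b m) =
        lie_act M (a \<otimes>\<^bsub>A\<^esub> b) m \<oplus>\<^bsub>M\<^esub> lie_act M b (act M a m)"

definition tp_invariants ::
  "('k, 'a, 'y) tp_algebra_scheme \<Rightarrow> ('k, 'a, 'm, 'z) tp_module_scheme \<Rightarrow> 'm set" where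
  "tp_invariants A M = {m \<in> carrier M. \<forall>a\<in>carrier A. \<forall>a'\<in>carrier A.
    act M (bracket A a a') m = lie_act M a (act M a' m)}"

record ('k, 'a, 'm, 'h) tp_hopf_module = "('k, 'a, 'm) tp_module" +
  mcoact :: "'m \<Rightarrow> ('m \<times> 'h) list set"

locale tp_hopf_module =
  fixes K :: "('k, 'x) ring_scheme" and H :: "('k, 'h, 'y) hopf_algebra_scheme"
    and A :: "('k, 'a, 'h, 'z) comodule_tp_algebra_scheme"
    and M :: "('k, 'a, 'm, 'h, 'w) tp_hopf_module_scheme"
  assumes comodule_tp_algebra: "comodule_tp_algebra K H A"
    and tp_module: "tp_module K A M"
    and comodule: "right_comodule K H M (mcoact M)"
    and mcoact_act: "\<lbrakk>a \<in> carrier A; m \<in> carrier M\<rbrakk> \<Longrightarrow>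
      mcoact M (act M a m) =
        tensor_lift (tensor K M H) (\<lambda>x h.
          tensor_lift (tensor K M H) (\<lambda>y h'.
            pure_tensor K M H (act M x y) (h \<otimes>\<^bsub>H\<^esub> h')) (mcoact M m)) (coact A a)"
    and mcoact_lie_act: "\<lbrakk>a \<in> carrier A; m \<in> carrier M\<rbrakk> \<Longrightarrow>
      mcoact M (lie_act M a m) =
        tensor_lift (tensor K M H) (\<lambda>x h.
          tensor_lift (tensor K M H) (\<lambda>y h'.
            pure_tensor K M H (lie_act M x y) (h \<otimes>\<^bsub>H\<^esub> h')) (mcoact M m)) (coact A a)"

definition tp_hopf_homs ::
  "('k, 'x) ring_scheme \<Rightarrow> ('k, 'h, 'y) hopf_algebra_scheme
    \<Rightarrow> ('k, 'a, 'h, 'z) comodule_tp_algebra_scheme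
    \<Rightarrow> ('k, 'a, 'm, 'h, 'w) tp_hopf_module_scheme
    \<Rightarrow> ('k, 'a, 'n, 'h, 'v) tp_hopf_module_scheme \<Rightarrow> ('m \<Rightarrow> 'n) set" where
  "tp_hopf_homs K H A M N = {f \<in> colinear_maps K H M (mcoact M) N (mcoact N).
    (\<forall>a\<in>carrier A. \<forall>m\<in>carrier M. f (act M a m) = act N a (f m)) \<and>
    (\<forall>a\<in>carrier A. \<forall>m\<in>carrier M. f (lie_act M a m) = lie_act N a (f m))}"

definition tp_hopf_isos ::
  "('k, 'x) ring_scheme \<Rightarrow> ('k, 'h, 'y) hopf_algebra_scheme
    \<Rightarrow> ('k, 'a, 'h, 'z) comodule_tp_algebra_scheme
    \<Rightarrow> ('k, 'a, 'm, 'h, 'w) tp_hopf_module_scheme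
    \<Rightarrow> ('k, 'a, 'n, 'h, 'v) tp_hopf_module_scheme \<Rightarrow> ('m \<Rightarrow> 'n) set" where
  "tp_hopf_isos K H A M N = {f \<in> tp_hopf_homs K H A M N. bij_betw f (carrier M) (carrier N)}"


section \<open>The induced Hopf module\<close>

text \<open>\<open>M\<^sup>A \<inter> M\<^sup>c\<^sup>o\<^sup>H\<close> and \<open>A\<close>, as modules over \<open>B = coinv_center K H A\<close>.\<close>

definition coinv_invariants ::
  "('k, 'x) ring_scheme \<Rightarrow> ('k, 'h, 'y) hopf_algebra_scheme
    \<Rightarrow> ('k, 'a, 'h, 'z) comodule_tp_algebra_scheme
    \<Rightarrow> ('k, 'a, 'm, 'h, 'w) tp_hopf_module_scheme \<Rightarrow> ('a, 'm) module" where
  "coinv_invariants K H A M =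
    module_via M (tp_invariants A M \<inter> coinvariants K H M (mcoact M)) (act M)"

definition regular_module :: "('k, 'a, 'y) module_scheme \<Rightarrow> ('a, 'a) module" where
  "regular_module A = module_via A (carrier A) (mult A)"

definition induced_tensor ::
  "('k, 'x) ring_scheme \<Rightarrow> ('k, 'h, 'y) hopf_algebra_scheme
    \<Rightarrow> ('k, 'a, 'h, 'z) comodule_tp_algebra_scheme
    \<Rightarrow> ('k, 'a, 'm, 'h, 'w) tp_hopf_module_scheme \<Rightarrow> ('a, ('a \<times> 'm) list set) module" where
  "induced_tensor K H A M =
    tensor (coinv_center K H A) (regular_module A) (coinv_invariants K H A M)"

definition induced_pure ::
  "('k, 'x) ring_scheme \<Rightarrow> ('k, 'h, 'y) hopf_algebra_scheme
    \<Rightarrow> ('k, 'a, 'h, 'z) comodule_tp_algebra_scheme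
    \<Rightarrow> ('k, 'a, 'm, 'h, 'w) tp_hopf_module_scheme \<Rightarrow> 'a \<Rightarrow> 'm \<Rightarrow> ('a \<times> 'm) list set" where
  "induced_pure K H A M =
    pure_tensor (coinv_center K H A) (regular_module A) (coinv_invariants K H A M)"

definition induced_space ::
  "('k, 'x) ring_scheme \<Rightarrow> ('k, 'h, 'y) hopf_algebra_scheme
    \<Rightarrow> ('k, 'a, 'h, 'z) comodule_tp_algebra_scheme
    \<Rightarrow> ('k, 'a, 'm, 'h, 'w) tp_hopf_module_scheme \<Rightarrow> ('k, ('a \<times> 'm) list set) module" where
  "induced_space K H A M =
    module_via (induced_tensor K H A M) (carrier (induced_tensor K H A M))
      (\<lambda>c. tensor_lift (induced_tensor K H A M) (\<lambda>a m. induced_pure K H A M (c \<odot>\<^bsub>A\<^esub> a) m))"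

definition induced_hopf_module ::
  "('k, 'x) ring_scheme \<Rightarrow> ('k, 'h, 'y) hopf_algebra_scheme
    \<Rightarrow> ('k, 'a, 'h, 'z) comodule_tp_algebra_scheme
    \<Rightarrow> ('k, 'a, 'm, 'h, 'w) tp_hopf_module_scheme
    \<Rightarrow> ('k, 'a, ('a \<times> 'm) list set, 'h) tp_hopf_module" where
  "induced_hopf_module K H A M =
    (let T = induced_space K H A M; TH = tensor K T H; t = induced_pure K H A M in
     \<lparr>carrier = carrier T, mult = undefined, one = undefined, zero = \<zero>\<^bsub>T\<^esub>, add = add T,
      smult = smult T,
      act = (\<lambda>a'. tensor_lift T (\<lambda>a m. t (a' \<otimes>\<^bsub>A\<^esub> a) m)),
      lie_act = (\<lambda>a'. tensor_lift T (\<lambda>a m. t (bracket A a' a) m)),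
      mcoact = tensor_lift TH (\<lambda>a m.
        tensor_lift TH (\<lambda>x h. pure_tensor K T H (t x m) h) (coact A a))\<rparr>)"

definition induced_map :: "('k, 'a, 'm, 'w) tp_module_scheme \<Rightarrow> ('a \<times> 'm) list set \<Rightarrow> 'm" where
  "induced_map M = tensor_lift M (act M)"


section \<open>The maps \<open>p\<^sub>M\<close> and \<open>p\<^sub>A\<close>\<close>

definition proj_M ::
  "('k, 'h, 'y) hopf_algebra_scheme \<Rightarrow> ('h \<Rightarrow> 'a)
    \<Rightarrow> ('k, 'a, 'm, 'h, 'w) tp_hopf_module_scheme \<Rightarrow> 'm \<Rightarrow> 'm" where
  "proj_M H \<phi> M m = tensor_lift M (\<lambda>x h. act M (\<phi> (inv_antipode H h)) x) (mcoact M m)"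

definition proj_A ::
  "('k, 'h, 'y) hopf_algebra_scheme \<Rightarrow> ('h \<Rightarrow> 'a)
    \<Rightarrow> ('k, 'a, 'h, 'z) comodule_tp_algebra_scheme \<Rightarrow> 'a \<Rightarrow> 'a" where
  "proj_A H \<phi> A a = tensor_lift A (\<lambda>x h. \<phi> (inv_antipode H h) \<otimes>\<^bsub>A\<^esub> x) (coact A a)"

end

theory Submission
  imports Defs
begin

text \<open>
  Write \<open>T = S\<^sup>-\<^sup>1\<close>, \<open>B = A\<^sup>A\<^sup>c\<^sup>o\<^sup>H\<close> and \<open>N = M\<^sup>A\<^sup>c\<^sup>o\<^sup>H\<close>.  The inverse of \<open>\<alpha> : A \<otimes>\<^sub>B N \<rightarrow> M\<close> is
  \<open>\<beta>(m) = \<phi>(m\<^sub>1) \<otimes>\<^sub>B p\<^sub>M(m\<^sub>0)\<close>.  That \<open>\<beta>\<close> makes sense and inverts \<open>\<alpha>\<close> rests on four facts.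

  \<^item> \<open>\<phi>(m\<^sub>1) \<cdot> p\<^sub>M(m\<^sub>0) = m\<close> (\<open>sw_phi_p\<close>), because \<open>h\<^sub>2T(h\<^sub>1) = \<epsilon>(h)\<close>.  This is \<open>\<alpha>\<beta> = id\<close>.

  \<^item> \<open>p\<^sub>M(m)\<close> is \<open>H\<close>-coinvariant (\<open>p_coinvariant\<close>).  The operators
  \<open>V\<^sub>h = \<phi>(h\<^sub>1) \<otimes> h\<^sub>2\<close> and \<open>W\<^sub>h = \<phi>(T(h\<^sub>2)) \<otimes> T(h\<^sub>1)\<close> on \<open>M \<otimes> H\<close> satisfy \<open>W\<^sub>h\<^sub>2V\<^sub>h\<^sub>1 = \<epsilon>(h)\<close>, and
  \<open>\<rho>(\<phi>(h) \<cdot> m) = V\<^sub>h\<rho>(m)\<close> by colinearity of \<open>\<phi>\<close>.  So, with the first fact,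
  \<open>\<rho>(p\<^sub>M(m)) = W\<^sub>m\<^sub>2V\<^sub>m\<^sub>1\<rho>(p\<^sub>M(m\<^sub>0)) = W\<^sub>m\<^sub>1\<rho>(m\<^sub>0) = p\<^sub>M(m) \<otimes> 1\<close>.

  \<^item> \<open>p\<^sub>M(m) \<in> M\<^sup>A\<close> and \<open>p\<^sub>A(a) \<in> A\<^sup>A\<close>.  At \<open>a' = 1\<close> the two compatibility conditions say
  \<open>{1, a} \<cdot> p\<^sub>M(m) = 1 \<diamondop> (a \<cdot> p\<^sub>M(m))\<close> and \<open>{1, a} p\<^sub>A(x) = {1, a p\<^sub>A(x)}\<close>, and the transposed Leibniz
  rule reduces membership in \<open>M\<^sup>A\<close> and \<open>A\<^sup>A\<close> to these brackets with the unit
  (\<open>tp_invariantsI\<close>, \<open>centerI\<close>).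

  \<^item> \<open>p\<^sub>M(a \<cdot> n) = p\<^sub>A(a) \<cdot> n\<close> for coinvariant \<open>n\<close> (\<open>p_dot_coinvariant\<close>).  As \<open>p\<^sub>A(a\<^sub>0) \<in> B\<close>, this gives
  \<open>\<beta>(a \<cdot> n) = \<phi>(a\<^sub>1) \<otimes>\<^sub>B p\<^sub>A(a\<^sub>0) \<cdot> n = \<phi>(a\<^sub>1)p\<^sub>A(a\<^sub>0) \<otimes>\<^sub>B n = a \<otimes>\<^sub>B n\<close>, by the first fact for \<open>M = A\<close>.

  The identities \<open>h\<^sub>2T(h\<^sub>1) = \<epsilon>(h) = T(h\<^sub>2)h\<^sub>1\<close> come from the antipode axioms and the
  antimultiplicativity of \<open>S\<close> (\<open>antipode_mult\<close>).  Linear maps on \<open>A \<otimes>\<^sub>B N\<close> are compared on pure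
  tensors: this yields the Hopf module axioms for \<open>A \<otimes>\<^sub>B N\<close> (\<open>induced_is_hopf_module\<close>) and shows
  that \<open>\<alpha>\<close> is a morphism (\<open>induced_map_hom\<close>).

  Sweedler sums are the lifts \<open>tensor_lift P f (\<rho> m)\<close>.  Coassociativity is used in the form
  \<open>sw_coassoc\<close>: it exchanges two nested sums of a function that is linear in each variable.
\<close>

section \<open>Tensor products\<close>

text \<open>
  The hypotheses under which \<open>tensor R M N\<close> is an abelian group: the scalars only have to preserve
  the carriers, and \<open>R\<close> is not required to be a ring.
\<close>

locale tensor_factors =
  fixes R :: "('r, 'x) ring_scheme" and M :: "('r, 'm, 'y) module_scheme"
    and N :: "('r, 'n, 'z) module_scheme"
  assumes M_group: "abelian_group M" and N_group: "abelian_group N"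
    and smult_M: "\<lbrakk>r \<in> carrier R; m \<in> carrier M\<rbrakk> \<Longrightarrow> r \<odot>\<^bsub>M\<^esub> m \<in> carrier M"
    and smult_N: "\<lbrakk>r \<in> carrier R; n \<in> carrier N\<rbrakk> \<Longrightarrow> r \<odot>\<^bsub>N\<^esub> n \<in> carrier N"
begin

abbreviation T where "T \<equiv> tensor R M N"
abbreviation t where "t \<equiv> pure_tensor R M N"

lemma tensor_eq_carrier:
  "tensor_eq R M N xs ys \<Longrightarrow>
    set xs \<subseteq> carrier M \<times> carrier N \<and> set ys \<subseteq> carrier M \<times> carrier N"
  by (induction rule: tensor_eq.induct)
    (auto simp: smult_M smult_N abelian_groupE(1)[OF M_group] abelian_groupE(1)[OF N_group]
      abelian_groupE(2)[OF M_group])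

lemma class_eqI: "tensor_eq R M N xs ys \<Longrightarrow> tensor_class R M N xs = tensor_class R M N ys"
  by (auto simp: tensor_class_def intro: tensor_eq.trans tensor_eq.sym)

lemma class_closed: "set xs \<subseteq> carrier M \<times> carrier N \<Longrightarrow> tensor_class R M N xs \<in> carrier T"
  by (auto simp: tensor_def)

lemma rep:
  assumes "X \<in> carrier T"
  shows "set (tensor_rep X) \<subseteq> carrier M \<times> carrier N"
    and "tensor_class R M N (tensor_rep X) = X"
proof -
  obtain xs where xs: "set xs \<subseteq> carrier M \<times> carrier N" "X = tensor_class R M N xs"
    using assms by (auto simp: tensor_def)
  have "xs \<in> X"
    using xs by (simp add: tensor_class_def tensor_eq.refl)
  then have "tensor_rep X \<in> X"
    unfolding tensor_rep_def by (rule someI)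
  then have *: "tensor_eq R M N xs (tensor_rep X)"
    using xs by (simp add: tensor_class_def)
  show "set (tensor_rep X) \<subseteq> carrier M \<times> carrier N"
    using tensor_eq_carrier[OF *] by simp
  show "tensor_class R M N (tensor_rep X) = X"
    using class_eqI[OF *] xs by simp
qed

lemma class_add:
  assumes "set xs \<subseteq> carrier M \<times> carrier N" "set ys \<subseteq> carrier M \<times> carrier N"
  shows "tensor_class R M N xs \<oplus>\<^bsub>T\<^esub> tensor_class R M N ys = tensor_class R M N (xs @ ys)"
proof -
  have *: "tensor_eq R M N zs (tensor_rep (tensor_class R M N zs))"
    if "set zs \<subseteq> carrier M \<times> carrier N" for zs
  proof -
    have "zs \<in> tensor_class R M N zs"
      using that by (simp add: tensor_class_def tensor_eq.refl)
    then have "tensor_rep (tensor_class R M N zs) \<in> tensor_class R M N zs"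
      unfolding tensor_rep_def by (rule someI)
    then show ?thesis by (simp add: tensor_class_def)
  qed
  show ?thesis
    unfolding tensor_def
    using class_eqI[OF tensor_eq.append[OF *[OF assms(1)] *[OF assms(2)]]] by simp
qed

lemma class_Cons:
  assumes "m \<in> carrier M" "n \<in> carrier N" "set xs \<subseteq> carrier M \<times> carrier N"
  shows "tensor_class R M N ((m, n) # xs) = t m n \<oplus>\<^bsub>T\<^esub> tensor_class R M N xs"
  using class_add[of "[(m, n)]" xs] assms by (simp add: pure_tensor_def)

lemma class_Nil: "tensor_class R M N [] = \<zero>\<^bsub>T\<^esub>"
  by (simp add: tensor_def)

lemma pure_closed: "\<lbrakk>m \<in> carrier M; n \<in> carrier N\<rbrakk> \<Longrightarrow> t m n \<in> carrier T"
  by (simp add: pure_tensor_def class_closed)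

lemma pure_add_left:
  assumes "m \<in> carrier M" "m' \<in> carrier M" "n \<in> carrier N"
  shows "t (m \<oplus>\<^bsub>M\<^esub> m') n = t m n \<oplus>\<^bsub>T\<^esub> t m' n"
  using class_eqI[OF tensor_eq.add_left[OF assms]] class_add[of "[(m, n)]" "[(m', n)]"] assms
  by (simp add: pure_tensor_def)

lemma pure_add_right:
  assumes "m \<in> carrier M" "n \<in> carrier N" "n' \<in> carrier N"
  shows "t m (n \<oplus>\<^bsub>N\<^esub> n') = t m n \<oplus>\<^bsub>T\<^esub> t m n'"
  using class_eqI[OF tensor_eq.add_right[OF assms]] class_add[of "[(m, n)]" "[(m, n')]"] assms
  by (simp add: pure_tensor_def)

lemma pure_balanced:
  "\<lbrakk>r \<in> carrier R; m \<in> carrier M; n \<in> carrier N\<rbrakk> \<Longrightarrow> t (r \<odot>\<^bsub>M\<^esub> m) n = t m (r \<odot>\<^bsub>N\<^esub> n)"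
  by (simp add: pure_tensor_def class_eqI[OF tensor_eq.balanced])

lemma pure_zero_left: "n \<in> carrier N \<Longrightarrow> t \<zero>\<^bsub>M\<^esub> n = \<zero>\<^bsub>T\<^esub>"
  by (simp add: pure_tensor_def class_Nil[symmetric] class_eqI[OF tensor_eq.zero])

lemma tensor_abelian_group: "abelian_group T"
proof (rule abelian_groupI)
  fix X Y Z assume X: "X \<in> carrier T" and Y: "Y \<in> carrier T" and Z: "Z \<in> carrier T"
  note r = rep[OF X] rep[OF Y] rep[OF Z]
  have XY: "X \<oplus>\<^bsub>T\<^esub> Y = tensor_class R M N (tensor_rep X @ tensor_rep Y)"
    by (simp add: tensor_def)
  show "X \<oplus>\<^bsub>T\<^esub> Y \<in> carrier T" unfolding XY using r by (intro class_closed) auto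
  have "X \<oplus>\<^bsub>T\<^esub> Y \<oplus>\<^bsub>T\<^esub> Z = tensor_class R M N ((tensor_rep X @ tensor_rep Y) @ tensor_rep Z)"
    unfolding XY using r class_add[of "tensor_rep X @ tensor_rep Y" "tensor_rep Z"] by simp
  also have "\<dots> = X \<oplus>\<^bsub>T\<^esub> tensor_class R M N (tensor_rep Y @ tensor_rep Z)"
    using r class_add[of "tensor_rep X" "tensor_rep Y @ tensor_rep Z"] by simp
  finally show "X \<oplus>\<^bsub>T\<^esub> Y \<oplus>\<^bsub>T\<^esub> Z = X \<oplus>\<^bsub>T\<^esub> (Y \<oplus>\<^bsub>T\<^esub> Z)"
    by (simp add: tensor_def)
  show "X \<oplus>\<^bsub>T\<^esub> Y = Y \<oplus>\<^bsub>T\<^esub> X"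
    unfolding tensor_def using class_eqI[OF tensor_eq.commute] r by simp
next
  show "\<zero>\<^bsub>T\<^esub> \<in> carrier T" using class_closed[of "[]"] by (simp add: class_Nil)
next
  fix X assume X: "X \<in> carrier T"
  show "\<zero>\<^bsub>T\<^esub> \<oplus>\<^bsub>T\<^esub> X = X"
    using class_add[of "[]" "tensor_rep X"] rep[OF X] by (simp add: class_Nil)
  have "\<exists>ys. set ys \<subseteq> carrier M \<times> carrier N \<and> tensor_class R M N (ys @ xs) = \<zero>\<^bsub>T\<^esub>"
    if "set xs \<subseteq> carrier M \<times> carrier N" for xs
    using that
  proof (induction xs)
    case Nil
    then show ?case by (intro exI[of _ "[]"]) (simp add: class_Nil)
  next
    case (Cons x xs)
    interpret M: abelian_group M by (rule M_group)
    obtain m n where x: "x = (m, n)" by (cases x)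
    have mn: "m \<in> carrier M" "n \<in> carrier N" using Cons x by auto
    obtain ys where ys: "set ys \<subseteq> carrier M \<times> carrier N" "tensor_class R M N (ys @ xs) = \<zero>\<^bsub>T\<^esub>"
      using Cons by auto
    have 1: "tensor_class R M N ([(m, n)] @ [(\<ominus>\<^bsub>M\<^esub> m, n)]) = tensor_class R M N []"
      using pure_add_left[of m "\<ominus>\<^bsub>M\<^esub> m" n] class_add[of "[(m, n)]" "[(\<ominus>\<^bsub>M\<^esub> m, n)]"] mn
      by (simp add: M.r_neg pure_zero_left[unfolded pure_tensor_def] class_Nil pure_tensor_def)
    let ?ys = "(\<ominus>\<^bsub>M\<^esub> m, n) # ys"
    have "tensor_class R M N (?ys @ x # xs) = tensor_class R M N ((?ys @ [x]) @ xs)" by simp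
    also have "\<dots> = tensor_class R M N (?ys @ [x]) \<oplus>\<^bsub>T\<^esub> tensor_class R M N xs"
      using mn ys Cons x by (intro class_add[symmetric]) auto
    also have "tensor_class R M N (?ys @ [x]) = tensor_class R M N ([x] @ ?ys)"
      by (rule class_eqI, rule tensor_eq.commute) (use mn ys x in auto)
    also have "\<dots> = tensor_class R M N (([(m, n)] @ [(\<ominus>\<^bsub>M\<^esub> m, n)]) @ ys)" by (simp add: x)
    also have "\<dots> = tensor_class R M N ([(m, n)] @ [(\<ominus>\<^bsub>M\<^esub> m, n)]) \<oplus>\<^bsub>T\<^esub> tensor_class R M N ys"
      using mn ys x by (intro class_add[symmetric]) auto
    also have "\<dots> = tensor_class R M N ys"
      unfolding 1 using class_add[of "[]" ys] ys by simp
    also have "tensor_class R M N ys \<oplus>\<^bsub>T\<^esub> tensor_class R M N xs = \<zero>\<^bsub>T\<^esub>"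
      using class_add[of ys xs] ys Cons by simp
    finally show ?case using mn ys by (intro exI[of _ ?ys]) auto
  qed
  from this[OF rep(1)[OF X]] obtain ys where
    ys: "set ys \<subseteq> carrier M \<times> carrier N" "tensor_class R M N (ys @ tensor_rep X) = \<zero>\<^bsub>T\<^esub>"
    by auto
  then have "tensor_class R M N ys \<oplus>\<^bsub>T\<^esub> X = \<zero>\<^bsub>T\<^esub>"
    using class_add[OF ys(1) rep(1)[OF X]] rep(2)[OF X] by simp
  then show "\<exists>Y\<in>carrier T. Y \<oplus>\<^bsub>T\<^esub> X = \<zero>\<^bsub>T\<^esub>" using class_closed[OF ys(1)] by auto
qed

lemma class_induct:
  assumes "set xs \<subseteq> carrier M \<times> carrier N"
    and "\<And>m n. \<lbrakk>m \<in> carrier M; n \<in> carrier N\<rbrakk> \<Longrightarrow> P (t m n)"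
    and "\<And>X Y. \<lbrakk>X \<in> carrier T; Y \<in> carrier T; P X; P Y\<rbrakk> \<Longrightarrow> P (X \<oplus>\<^bsub>T\<^esub> Y)"
  shows "P (tensor_class R M N xs)"
  using assms(1)
proof (induction xs)
  case Nil
  have "\<zero>\<^bsub>M\<^esub> \<in> carrier M" "\<zero>\<^bsub>N\<^esub> \<in> carrier N"
    using abelian_groupE(2)[OF M_group] abelian_groupE(2)[OF N_group] by auto
  then show ?case using assms(2)[of "\<zero>\<^bsub>M\<^esub>" "\<zero>\<^bsub>N\<^esub>"] by (simp add: class_Nil pure_zero_left)
next
  case (Cons x xs)
  then show ?case
    by (cases x) (auto simp: class_Cons intro!: assms class_closed pure_closed)
qed

text \<open>The pure tensors generate additively; the zero tensor is itself pure.\<close>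

lemma tensor_induct [consumes 1, case_names pure add]:
  assumes "X \<in> carrier T"
    and "\<And>m n. \<lbrakk>m \<in> carrier M; n \<in> carrier N\<rbrakk> \<Longrightarrow> P (t m n)"
    and "\<And>X Y. \<lbrakk>X \<in> carrier T; Y \<in> carrier T; P X; P Y\<rbrakk> \<Longrightarrow> P (X \<oplus>\<^bsub>T\<^esub> Y)"
  shows "P X"
  using class_induct[OF rep(1)[OF assms(1)], of P] assms rep(2)[OF assms(1)] by simp

lemma sum_closed:
  assumes "abelian_group P" "set xs \<subseteq> carrier M \<times> carrier N"
    and "\<And>m n. \<lbrakk>m \<in> carrier M; n \<in> carrier N\<rbrakk> \<Longrightarrow> f m n \<in> carrier P"
  shows "tensor_sum P f xs \<in> carrier P"
proof -
  interpret P: abelian_group P by fact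
  show ?thesis using assms(2) by (induction xs) (auto simp: tensor_sum_def assms(3))
qed

lemma lift_closed:
  assumes "abelian_group P" "X \<in> carrier T"
    and "\<And>m n. \<lbrakk>m \<in> carrier M; n \<in> carrier N\<rbrakk> \<Longrightarrow> f m n \<in> carrier P"
  shows "tensor_lift P f X \<in> carrier P"
  unfolding tensor_lift_def by (intro sum_closed assms rep)

lemma lift_cong:
  assumes "X \<in> carrier T"
    and "\<And>m n. \<lbrakk>m \<in> carrier M; n \<in> carrier N\<rbrakk> \<Longrightarrow> f m n = g m n"
  shows "tensor_lift P f X = tensor_lift P g X"
proof -
  have "tensor_sum P f xs = tensor_sum P g xs" if "set xs \<subseteq> carrier M \<times> carrier N" for xs
    using that by (induction xs) (auto simp: tensor_sum_def assms(2))
  then show ?thesis using rep(1)[OF assms(1)] by (simp add: tensor_lift_def)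
qed

lemma lift_add_fun:
  assumes "abelian_group P" "X \<in> carrier T"
    and f: "\<And>m n. \<lbrakk>m \<in> carrier M; n \<in> carrier N\<rbrakk> \<Longrightarrow> f m n \<in> carrier P"
    and g: "\<And>m n. \<lbrakk>m \<in> carrier M; n \<in> carrier N\<rbrakk> \<Longrightarrow> g m n \<in> carrier P"
  shows "tensor_lift P (\<lambda>m n. f m n \<oplus>\<^bsub>P\<^esub> g m n) X = tensor_lift P f X \<oplus>\<^bsub>P\<^esub> tensor_lift P g X"
proof -
  interpret P: abelian_group P by fact
  have "tensor_sum P (\<lambda>m n. f m n \<oplus>\<^bsub>P\<^esub> g m n) xs = tensor_sum P f xs \<oplus>\<^bsub>P\<^esub> tensor_sum P g xs"
    if "set xs \<subseteq> carrier M \<times> carrier N" for xs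
    using that
  proof (induction xs)
    case (Cons x xs)
    have c: "tensor_sum P f xs \<in> carrier P" "tensor_sum P g xs \<in> carrier P"
      using Cons by (auto intro!: sum_closed assms)
    show ?case using Cons c
      by (cases x) (auto simp: tensor_sum_def f g P.a_ac)
  qed (simp add: tensor_sum_def)
  then show ?thesis using rep(1)[OF assms(2)] by (simp add: tensor_lift_def)
qed

text \<open>An additive map commutes with the finite sums that a lift stands for.\<close>

lemma lift_image:
  assumes P: "abelian_group P" and Q: "abelian_group Q" and X: "X \<in> carrier T"
    and f: "\<And>m n. \<lbrakk>m \<in> carrier M; n \<in> carrier N\<rbrakk> \<Longrightarrow> f m n \<in> carrier P"
    and g: "\<And>x. x \<in> carrier P \<Longrightarrow> g x \<in> carrier Q"
      "\<And>x y. \<lbrakk>x \<in> carrier P; y \<in> carrier P\<rbrakk> \<Longrightarrow> g (x \<oplus>\<^bsub>P\<^esub> y) = g x \<oplus>\<^bsub>Q\<^esub> g y"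
  shows "g (tensor_lift P f X) = tensor_lift Q (\<lambda>m n. g (f m n)) X"
proof -
  interpret P: abelian_group P by fact
  interpret Q: abelian_group Q by fact
  have g0: "g \<zero>\<^bsub>P\<^esub> = \<zero>\<^bsub>Q\<^esub>"
    using g(2)[of "\<zero>\<^bsub>P\<^esub>" "\<zero>\<^bsub>P\<^esub>"] g(1)[of "\<zero>\<^bsub>P\<^esub>"] by (simp add: Q.add.r_cancel_one')
  have "g (tensor_sum P f xs) = tensor_sum Q (\<lambda>m n. g (f m n)) xs"
    if "set xs \<subseteq> carrier M \<times> carrier N" for xs
    using that
  proof (induction xs)
    case (Cons x xs)
    have c: "tensor_sum P f xs \<in> carrier P"
      using Cons by (auto intro!: sum_closed assms)
    show ?case using Cons c by (cases x) (auto simp: tensor_sum_def f g)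
  qed (simp add: tensor_sum_def g0)
  then show ?thesis using rep(1)[OF X] by (simp add: tensor_lift_def)
qed

lemma lift_pure_self: "X \<in> carrier T \<Longrightarrow> tensor_lift T t X = X"
proof -
  interpret T: abelian_group T by (rule tensor_abelian_group)
  have "tensor_sum T t xs = tensor_class R M N xs" if "set xs \<subseteq> carrier M \<times> carrier N" for xs
    using that by (induction xs) (auto simp: tensor_sum_def class_Nil class_Cons)
  then show "X \<in> carrier T \<Longrightarrow> tensor_lift T t X = X"
    using rep by (simp add: tensor_lift_def)
qed

end

lemma tensor_sum_zero:
  assumes "abelian_group P"
  shows "tensor_sum P (\<lambda>m n. \<zero>\<^bsub>P\<^esub>) xs = \<zero>\<^bsub>P\<^esub>"
proof -
  interpret P: abelian_group P by fact
  show ?thesis by (induction xs) (auto simp: tensor_sum_def)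
qed

lemma lift_swap:
  assumes "tensor_factors R M N" "tensor_factors R' M' N'" and P: "abelian_group P"
    and X: "X \<in> carrier (tensor R M N)" and Y: "Y \<in> carrier (tensor R' M' N')"
    and f: "\<And>m n m' n'. \<lbrakk>m \<in> carrier M; n \<in> carrier N; m' \<in> carrier M'; n' \<in> carrier N'\<rbrakk>
      \<Longrightarrow> f m n m' n' \<in> carrier P"
  shows "tensor_lift P (\<lambda>m n. tensor_lift P (\<lambda>m' n'. f m n m' n') Y) X =
    tensor_lift P (\<lambda>m' n'. tensor_lift P (\<lambda>m n. f m n m' n') X) Y"
proof -
  interpret X: tensor_factors R M N by fact
  interpret Y: tensor_factors R' M' N' by fact
  interpret P: abelian_group P by fact
  have "tensor_sum P (\<lambda>m n. tensor_lift P (\<lambda>m' n'. f m n m' n') Y) xs =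
      tensor_lift P (\<lambda>m' n'. tensor_sum P (\<lambda>m n. f m n m' n') xs) Y"
    if "set xs \<subseteq> carrier M \<times> carrier N" for xs
    using that
  proof (induction xs)
    case Nil
    show ?case by (simp add: tensor_sum_def[of P _ "[]"] tensor_lift_def tensor_sum_zero[OF P])
  next
    case (Cons x xs)
    obtain m n where x: "x = (m, n)" by (cases x)
    have mn: "m \<in> carrier M" "n \<in> carrier N" using Cons x by auto
    have c: "tensor_sum P (\<lambda>m n. f m n m' n') xs \<in> carrier P"
      if "m' \<in> carrier M'" "n' \<in> carrier N'" for m' n'
      using Cons that by (intro X.sum_closed) (auto intro: P f)
    have "tensor_sum P (\<lambda>m n. tensor_lift P (\<lambda>m' n'. f m n m' n') Y) (x # xs) =
        tensor_lift P (\<lambda>m' n'. f m n m' n') Y \<oplus>\<^bsub>P\<^esub>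
        tensor_lift P (\<lambda>m' n'. tensor_sum P (\<lambda>m n. f m n m' n') xs) Y"
      using Cons by (simp add: x tensor_sum_def)
    also have "\<dots> = tensor_lift P (\<lambda>m' n'. f m n m' n' \<oplus>\<^bsub>P\<^esub> tensor_sum P (\<lambda>m n. f m n m' n') xs) Y"
      using mn c by (intro Y.lift_add_fun[symmetric] P Y f)
    finally show ?case by (simp add: x tensor_sum_def)
  qed
  then show ?thesis
    using X.rep(1)[OF X] by (simp add: tensor_lift_def[of P _ X])
qed

context balanced_map
begin

lemma factors: "tensor_factors R M N"
  by (rule tensor_factors.intro) (auto intro: M_group N_group smult_M smult_N)

lemma tensor_lift_add:
  assumes "X \<in> carrier (tensor R M N)" "Y \<in> carrier (tensor R M N)"
  shows "tensor_lift P f (X \<oplus>\<^bsub>tensor R M N\<^esub> Y) = tensor_lift P f X \<oplus>\<^bsub>P\<^esub> tensor_lift P f Y"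
proof -
  interpret tensor_factors R M N by (rule factors)
  have "tensor_lift P f (X \<oplus>\<^bsub>tensor R M N\<^esub> Y) =
      tensor_lift P f (tensor_class R M N (tensor_rep X @ tensor_rep Y))"
    by (simp add: tensor_def)
  also have "\<dots> = tensor_sum P f (tensor_rep X @ tensor_rep Y)"
    using rep[OF assms(1)] rep[OF assms(2)] by (intro tensor_lift_class) auto
  also have "\<dots> = tensor_lift P f X \<oplus>\<^bsub>P\<^esub> tensor_lift P f Y"
    unfolding tensor_lift_def using rep[OF assms(1)] rep[OF assms(2)] by (intro tensor_sum_append) auto
  finally show ?thesis .
qed

end

text \<open>
  The tensor product and its pure tensors depend only on the additive group and the scalars of the
  left factor, not on further record fields.
\<close>

lemma tensor_eq_mono:
  fixes M :: "('r, 'm, 'y) module_scheme" and M' :: "('r, 'm, 'v) module_scheme"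
  assumes "carrier M = carrier M'" "zero M = zero M'" "add M = add M'" "smult M = smult M'"
    and "tensor_eq R M N xs ys"
  shows "tensor_eq R M' N xs ys"
  using assms(5)
  by (induction rule: tensor_eq.induct) (use assms(1-4) in \<open>auto intro: tensor_eq.intros\<close>)

lemma tensor_cong:
  fixes M :: "('r, 'm, 'y) module_scheme" and M' :: "('r, 'm, 'v) module_scheme"
  assumes "carrier M = carrier M'" "zero M = zero M'" "add M = add M'" "smult M = smult M'"
  shows "tensor R M N = tensor R M' N" and "pure_tensor R M N = pure_tensor R M' N"
proof -
  have "tensor_eq R M N xs ys = tensor_eq R M' N xs ys" for xs ys
    using tensor_eq_mono[OF assms, of R N xs ys]
      tensor_eq_mono[OF assms[symmetric], of R N xs ys] by blast
  then have *: "tensor_class R M N = tensor_class R M' N"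
    by (simp add: fun_eq_iff tensor_class_def)
  show "tensor R M N = tensor R M' N"
    by (simp add: tensor_def * assms)
  show "pure_tensor R M N = pure_tensor R M' N"
    by (simp add: fun_eq_iff pure_tensor_def *)
qed

lemma abelian_group_cong:
  assumes "abelian_group G" "carrier G' = carrier G" "zero G' = zero G" "add G' = add G"
  shows "abelian_group G'"
proof -
  interpret G: abelian_group G by fact
  show ?thesis
    by (rule abelian_groupI) (auto simp: assms G.a_ac intro: G.l_neg)
qed

lemma (in abelian_monoid) add_pow_two:
  "x \<in> carrier G \<Longrightarrow> [(2::nat)] \<cdot>\<^bsub>G\<^esub> x = x \<oplus>\<^bsub>G\<^esub> x"
  by (simp add: numeral_2_eq_2)

section \<open>Linear algebra over the base ring\<close>

lemma linear_mapsI: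
  assumes "\<And>x. x \<in> carrier M \<Longrightarrow> f x \<in> carrier N"
    and "\<And>x y. \<lbrakk>x \<in> carrier M; y \<in> carrier M\<rbrakk> \<Longrightarrow> f (x \<oplus>\<^bsub>M\<^esub> y) = f x \<oplus>\<^bsub>N\<^esub> f y"
    and "\<And>c x. \<lbrakk>c \<in> carrier K; x \<in> carrier M\<rbrakk> \<Longrightarrow> f (c \<odot>\<^bsub>M\<^esub> x) = c \<odot>\<^bsub>N\<^esub> f x"
  shows "f \<in> linear_maps K M N"
  using assms by (auto simp: linear_maps_def)

lemma linear_mapsD:
  assumes "f \<in> linear_maps K M N"
  shows "x \<in> carrier M \<Longrightarrow> f x \<in> carrier N"
    and "\<lbrakk>x \<in> carrier M; y \<in> carrier M\<rbrakk> \<Longrightarrow> f (x \<oplus>\<^bsub>M\<^esub> y) = f x \<oplus>\<^bsub>N\<^esub> f y"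
    and "\<lbrakk>c \<in> carrier K; x \<in> carrier M\<rbrakk> \<Longrightarrow> f (c \<odot>\<^bsub>M\<^esub> x) = c \<odot>\<^bsub>N\<^esub> f x"
  using assms by (auto simp: linear_maps_def)

lemma linear_id: "(\<lambda>x. x) \<in> linear_maps K M M"
  by (rule linear_mapsI) simp_all

lemma linear_comp:
  "\<lbrakk>f \<in> linear_maps K N P; g \<in> linear_maps K M N\<rbrakk> \<Longrightarrow> (\<lambda>x. f (g x)) \<in> linear_maps K M P"
  by (rule linear_mapsI) (simp_all add: linear_mapsD)

lemma bilinear_mapsI:
  assumes "\<And>m. m \<in> carrier M \<Longrightarrow> (\<lambda>n. f m n) \<in> linear_maps K N P"
    and "\<And>n. n \<in> carrier N \<Longrightarrow> (\<lambda>m. f m n) \<in> linear_maps K M P"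
  shows "f \<in> bilinear_maps K M N P"
  using assms by (simp add: bilinear_maps_def)

lemma bilinear_mapsD:
  assumes "f \<in> bilinear_maps K M N P"
  shows "m \<in> carrier M \<Longrightarrow> (\<lambda>n. f m n) \<in> linear_maps K N P"
    and "n \<in> carrier N \<Longrightarrow> (\<lambda>m. f m n) \<in> linear_maps K M P"
  using assms by (auto simp: bilinear_maps_def)

lemma bilinear_closed:
  "\<lbrakk>f \<in> bilinear_maps K M N P; m \<in> carrier M; n \<in> carrier N\<rbrakk> \<Longrightarrow> f m n \<in> carrier P"
  using linear_mapsD(1) bilinear_mapsD(1) by fastforce

lemma bilinear_left:
  "\<lbrakk>f \<in> bilinear_maps K M N P; g \<in> linear_maps K Q M; n \<in> carrier N\<rbrakk>
    \<Longrightarrow> (\<lambda>x. f (g x) n) \<in> linear_maps K Q P"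
  using linear_comp[OF bilinear_mapsD(2)] .

lemma bilinear_right:
  "\<lbrakk>f \<in> bilinear_maps K M N P; m \<in> carrier M; g \<in> linear_maps K Q N\<rbrakk>
    \<Longrightarrow> (\<lambda>x. f m (g x)) \<in> linear_maps K Q P"
  using linear_comp[OF bilinear_mapsD(1)] .

lemma module_group: "module K M \<Longrightarrow> abelian_group M"
  by (rule module.axioms)

lemma smult_linear:
  assumes "module K M" "c \<in> carrier K"
  shows "(\<lambda>x. c \<odot>\<^bsub>M\<^esub> x) \<in> linear_maps K M M"
proof -
  interpret M: module K M by fact
  show ?thesis
    using assms(2) by (intro linear_mapsI) (auto simp: M.smult_r_distr M.smult_assoc1[symmetric] M.R.m_comm)
qed

lemma module_factors:
  assumes "module K M" "module K N"
  shows "tensor_factors K M N"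
  by (rule tensor_factors.intro)
    (auto simp: module_group[OF assms(1)] module_group[OF assms(2)]
      module.smult_closed[OF assms(1)] module.smult_closed[OF assms(2)])

lemma bilinear_balanced:
  assumes M: "module K M" and N: "module K N" and P: "module K P"
    and f: "f \<in> bilinear_maps K M N P"
  shows "balanced_map K M N P f"
  by (rule balanced_map.intro)
    (simp_all add: module_group[OF M] module_group[OF N] module_group[OF P]
      module.smult_closed[OF M] module.smult_closed[OF N] bilinear_closed[OF f]
      linear_mapsD[OF bilinear_mapsD(1)[OF f]] linear_mapsD[OF bilinear_mapsD(2)[OF f]])

text \<open>Two modules over the base ring; their tensor product is again a module.\<close>

locale module_pair =
  fixes K :: "('k, 'x) ring_scheme" and M :: "('k, 'm, 'y) module_scheme"
    and N :: "('k, 'n, 'z) module_scheme"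
  assumes M: "module K M" and N: "module K N"
begin

sublocale tensor_factors K M N
  by (rule module_factors[OF M N])

sublocale M: module K M by (rule M)
sublocale N: module K N by (rule N)
sublocale T: abelian_group T by (rule tensor_abelian_group)

lemma lift_pure:
  "\<lbrakk>module K P; f \<in> bilinear_maps K M N P; m \<in> carrier M; n \<in> carrier N\<rbrakk>
    \<Longrightarrow> tensor_lift P f (t m n) = f m n"
  by (rule balanced_map.tensor_lift_pure[OF bilinear_balanced[OF M N]])

lemma lift_add:
  "\<lbrakk>module K P; f \<in> bilinear_maps K M N P; X \<in> carrier T; Y \<in> carrier T\<rbrakk>
    \<Longrightarrow> tensor_lift P f (X \<oplus>\<^bsub>T\<^esub> Y) = tensor_lift P f X \<oplus>\<^bsub>P\<^esub> tensor_lift P f Y"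
  by (rule balanced_map.tensor_lift_add[OF bilinear_balanced[OF M N]])

lemma smult_eq: "c \<odot>\<^bsub>T\<^esub> X = tensor_lift T (\<lambda>m n. t (c \<odot>\<^bsub>M\<^esub> m) n) X"
  if X: "X \<in> carrier T" and c: "c \<in> carrier K"
proof -
  have "tensor_class K M N (map (\<lambda>(m, n). (c \<odot>\<^bsub>M\<^esub> m, n)) xs) =
      tensor_sum T (\<lambda>m n. t (c \<odot>\<^bsub>M\<^esub> m) n) xs" if "set xs \<subseteq> carrier M \<times> carrier N" for xs
    using that
  proof (induction xs)
    case (Cons x xs)
    have "set (map (\<lambda>(m, n). (c \<odot>\<^bsub>M\<^esub> m, n)) xs) \<subseteq> carrier M \<times> carrier N"
      using Cons c by auto
    then show ?case using Cons c by (cases x) (auto simp: tensor_sum_def class_Cons)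
  qed (simp add: tensor_sum_def class_Nil)
  then show ?thesis
    using rep(1)[OF X] by (simp add: tensor_def tensor_lift_def)
qed

lemma smult_balanced:
  assumes c: "c \<in> carrier K"
  shows "balanced_map K M N T (\<lambda>m n. t (c \<odot>\<^bsub>M\<^esub> m) n)"
  by (rule balanced_map.intro)
    (use c in \<open>simp_all add: tensor_abelian_group M_group N_group smult_M smult_N pure_closed
      M.smult_r_distr pure_add_left pure_add_right pure_balanced[symmetric]
      M.smult_assoc1[symmetric] M.R.m_comm\<close>)

lemma smult_pure:
  "\<lbrakk>c \<in> carrier K; m \<in> carrier M; n \<in> carrier N\<rbrakk> \<Longrightarrow> c \<odot>\<^bsub>T\<^esub> t m n = t (c \<odot>\<^bsub>M\<^esub> m) n"
  by (simp add: smult_eq pure_closed balanced_map.tensor_lift_pure[OF smult_balanced])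

lemma smult_add:
  "\<lbrakk>c \<in> carrier K; X \<in> carrier T; Y \<in> carrier T\<rbrakk>
    \<Longrightarrow> c \<odot>\<^bsub>T\<^esub> (X \<oplus>\<^bsub>T\<^esub> Y) = c \<odot>\<^bsub>T\<^esub> X \<oplus>\<^bsub>T\<^esub> c \<odot>\<^bsub>T\<^esub> Y"
  by (simp add: smult_eq balanced_map.tensor_lift_add[OF smult_balanced])

lemma smult_T_closed: "\<lbrakk>c \<in> carrier K; X \<in> carrier T\<rbrakk> \<Longrightarrow> c \<odot>\<^bsub>T\<^esub> X \<in> carrier T"
  by (simp add: smult_eq lift_closed tensor_abelian_group pure_closed)

lemma tensor_module: "module K T"
proof (rule moduleI)
  fix a b X assume ab: "a \<in> carrier K" "b \<in> carrier K" and X: "X \<in> carrier T"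
  show "(a \<oplus>\<^bsub>K\<^esub> b) \<odot>\<^bsub>T\<^esub> X = a \<odot>\<^bsub>T\<^esub> X \<oplus>\<^bsub>T\<^esub> b \<odot>\<^bsub>T\<^esub> X"
    using X
  proof (induction rule: tensor_induct)
    case (pure m n)
    then show ?case using ab by (simp add: smult_pure M.smult_l_distr pure_add_left)
  next
    case (add X Y)
    then show ?case using ab by (simp add: smult_add smult_T_closed T.a_ac)
  qed
  show "(a \<otimes>\<^bsub>K\<^esub> b) \<odot>\<^bsub>T\<^esub> X = a \<odot>\<^bsub>T\<^esub> (b \<odot>\<^bsub>T\<^esub> X)"
    using X
    by (induction rule: tensor_induct)
      (use ab in \<open>simp_all add: smult_pure M.smult_assoc1 smult_add smult_T_closed\<close>)
next
  fix X assume "X \<in> carrier T"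
  then show "\<one>\<^bsub>K\<^esub> \<odot>\<^bsub>T\<^esub> X = X"
    by (induction rule: tensor_induct) (simp_all add: smult_pure smult_add)
qed (simp_all add: M.R.is_cring tensor_abelian_group smult_T_closed smult_add)

lemma pure_bilinear: "t \<in> bilinear_maps K M N T"
  by (intro bilinear_mapsI linear_mapsI)
    (simp_all add: pure_closed pure_add_left pure_add_right smult_pure pure_balanced)

lemma linear_lift:
  assumes "module K P" "module K Q" "g \<in> linear_maps K P Q" "X \<in> carrier T"
    and "\<And>m n. \<lbrakk>m \<in> carrier M; n \<in> carrier N\<rbrakk> \<Longrightarrow> f m n \<in> carrier P"
  shows "g (tensor_lift P f X) = tensor_lift Q (\<lambda>m n. g (f m n)) X"
  by (rule lift_image)
    (simp_all add: assms module_group[OF assms(1)] module_group[OF assms(2)] linear_mapsD[OF assms(3)])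

lemma lift_linear:
  assumes P: "module K P" and f: "f \<in> bilinear_maps K M N P"
  shows "tensor_lift P f \<in> linear_maps K T P"
proof (rule linear_mapsI)
  interpret P: module K P by fact
  interpret f: balanced_map K M N P f by (rule bilinear_balanced[OF M N P f])
  fix X assume X: "X \<in> carrier T"
  show "tensor_lift P f X \<in> carrier P"
    using X by (intro lift_closed) (auto simp: f.closed P.abelian_group_axioms)
  fix c assume c: "c \<in> carrier K"
  show "tensor_lift P f (c \<odot>\<^bsub>T\<^esub> X) = c \<odot>\<^bsub>P\<^esub> tensor_lift P f X"
    using X
  proof (induction rule: tensor_induct)
    case (pure m n)
    then show ?case using c linear_mapsD(3)[OF bilinear_mapsD(2)[OF f]]
      by (simp add: smult_pure f.tensor_lift_pure)
  next
    case (add X Y)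
    moreover have "tensor_lift P f Z \<in> carrier P" if "Z \<in> carrier T" for Z
      using that by (intro lift_closed) (auto simp: f.closed P.abelian_group_axioms)
    ultimately show ?case using c
      by (simp add: smult_add f.tensor_lift_add smult_T_closed P.smult_r_distr)
  qed
qed (rule lift_add[OF P f])

lemma lift_param_linear:
  assumes Q: "module K Q" and P: "module K P" and X: "X \<in> carrier T"
    and f: "\<And>m n. \<lbrakk>m \<in> carrier M; n \<in> carrier N\<rbrakk> \<Longrightarrow> (\<lambda>x. f x m n) \<in> linear_maps K Q P"
  shows "(\<lambda>x. tensor_lift P (f x) X) \<in> linear_maps K Q P"
proof (rule linear_mapsI)
  fix x assume x: "x \<in> carrier Q"
  show "tensor_lift P (f x) X \<in> carrier P"
    using x by (intro lift_closed module_group[OF P] X linear_mapsD(1)[OF f])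
  show "tensor_lift P (f (x \<oplus>\<^bsub>Q\<^esub> y)) X = tensor_lift P (f x) X \<oplus>\<^bsub>P\<^esub> tensor_lift P (f y) X"
    if y: "y \<in> carrier Q" for y
    using x y
    by (subst lift_add_fun[symmetric])
      (auto simp: module_group[OF P] X linear_mapsD[OF f] intro!: lift_cong)
  show "tensor_lift P (f (c \<odot>\<^bsub>Q\<^esub> x)) X = c \<odot>\<^bsub>P\<^esub> tensor_lift P (f x) X" if c: "c \<in> carrier K" for c
    using x c
    by (subst linear_lift[OF P P smult_linear[OF P c] X])
      (auto simp: X linear_mapsD[OF f] intro!: lift_cong)
qed

text \<open>Evaluation of a lift on a sum of tensors.\<close>

lemma lift_lift:
  assumes P: "module K P" and f: "f \<in> bilinear_maps K M N P"
    and X: "tensor_factors R M' N'" "X \<in> carrier (tensor R M' N')"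
    and F: "\<And>x y. \<lbrakk>x \<in> carrier M'; y \<in> carrier N'\<rbrakk> \<Longrightarrow> F x y \<in> carrier T"
  shows "tensor_lift P f (tensor_lift T F X) = tensor_lift P (\<lambda>x y. tensor_lift P f (F x y)) X"
proof -
  interpret X: tensor_factors R M' N' by fact
  show ?thesis
    by (rule X.lift_image)
      (simp_all add: X F tensor_abelian_group module_group[OF P] linear_mapsD[OF lift_linear[OF P f]])
qed

end

section \<open>Sweedler calculus\<close>

context hopf_algebra
begin

abbreviation "S \<equiv> antipode H"
abbreviation "\<Delta> \<equiv> comult H"
abbreviation "\<epsilon> \<equiv> counit H"

sublocale H: ring H
  by (rule unital_algebra.ring[OF unital_algebra])

sublocale HH: module_pair K H H
  by (rule module_pair.intro) (rule unital_algebra.module[OF unital_algebra])+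

lemma module_H: "module K H"
  by (rule unital_algebra.module[OF unital_algebra])

lemma tensor_algebra_fields [simp]:
  "carrier (tensor_algebra K A B) = carrier (tensor K A B)"
  "add (tensor_algebra K A B) = add (tensor K A B)"
  "smult (tensor_algebra K A B) = smult (tensor K A B)"
  by (simp_all add: tensor_algebra_def)

lemma comult_linear: "\<Delta> \<in> linear_maps K H (tensor K H H)"
  using comult_hom by (auto simp: algebra_homs_def linear_maps_def)

lemma counit_closed [simp]: "h \<in> carrier H \<Longrightarrow> \<epsilon> h \<in> carrier K"
  using counit_hom by (auto simp: ring_hom_def)

lemma antipode_closed [simp]: "h \<in> carrier H \<Longrightarrow> S h \<in> carrier H"
  by (rule linear_mapsD[OF antipode_linear])

lemma antipode_lin: "g \<in> linear_maps K Q H \<Longrightarrow> (\<lambda>x. S (g x)) \<in> linear_maps K Q H"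
  by (rule linear_comp[OF antipode_linear])

lemmas mult_lin =
  bilinear_left[OF unital_algebra.mult_bilinear[OF unital_algebra]]
  bilinear_right[OF unital_algebra.mult_bilinear[OF unital_algebra]]

lemma counit_lin_left:
  assumes "module K P" "g \<in> linear_maps K Q H" "y \<in> carrier P"
  shows "(\<lambda>x. \<epsilon> (g x) \<odot>\<^bsub>P\<^esub> y) \<in> linear_maps K Q P"
proof -
  interpret P: module K P by fact
  note g = linear_mapsD[OF assms(2)]
  show ?thesis
    using assms(3) by (intro linear_mapsI)
      (auto simp: g ring_hom_add[OF counit_hom] counit_smult P.smult_l_distr P.smult_assoc1)
qed

lemma counit_lin_right:
  "\<lbrakk>module K P; h \<in> carrier H; g \<in> linear_maps K Q P\<rbrakk>
    \<Longrightarrow> (\<lambda>x. \<epsilon> h \<odot>\<^bsub>P\<^esub> g x) \<in> linear_maps K Q P"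
  by (rule linear_comp[OF smult_linear]) simp_all

end

context right_comodule
begin

sublocale hopf_algebra K H
  by (rule hopf_algebra)

sublocale MH: module_pair K M H
  by (rule module_pair.intro[OF module module_H])

lemma rho_closed [simp]: "m \<in> carrier M \<Longrightarrow> \<rho> m \<in> carrier (tensor K M H)"
  by (rule linear_mapsD[OF coaction_linear])

lemma sw_closed:
  "\<lbrakk>module K P; m \<in> carrier M; \<And>x h. \<lbrakk>x \<in> carrier M; h \<in> carrier H\<rbrakk> \<Longrightarrow> f x h \<in> carrier P\<rbrakk>
    \<Longrightarrow> tensor_lift P f (\<rho> m) \<in> carrier P"
  by (rule MH.lift_closed) (simp_all add: module_group)

lemma sw_cong:
  "\<lbrakk>m \<in> carrier M; \<And>x h. \<lbrakk>x \<in> carrier M; h \<in> carrier H\<rbrakk> \<Longrightarrow> f x h = g x h\<rbrakk>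
    \<Longrightarrow> tensor_lift P f (\<rho> m) = tensor_lift P g (\<rho> m)"
  by (rule MH.lift_cong) simp_all

lemma sw_lin:
  "\<lbrakk>module K P; f \<in> bilinear_maps K M H P; g \<in> linear_maps K Q M\<rbrakk>
    \<Longrightarrow> (\<lambda>x. tensor_lift P f (\<rho> (g x))) \<in> linear_maps K Q P"
  by (rule linear_comp[OF MH.lift_linear linear_comp[OF coaction_linear]])

lemma sw_param_lin:
  "\<lbrakk>module K Q; module K P; m \<in> carrier M;
    \<And>x h. \<lbrakk>x \<in> carrier M; h \<in> carrier H\<rbrakk> \<Longrightarrow> (\<lambda>q. f q x h) \<in> linear_maps K Q P\<rbrakk>
    \<Longrightarrow> (\<lambda>q. tensor_lift P (f q) (\<rho> m)) \<in> linear_maps K Q P"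
  by (rule MH.lift_param_linear) simp_all

lemma sw_image:
  "\<lbrakk>g \<in> linear_maps K P Q; module K P; module K Q; m \<in> carrier M;
    \<And>x h. \<lbrakk>x \<in> carrier M; h \<in> carrier H\<rbrakk> \<Longrightarrow> f x h \<in> carrier P\<rbrakk>
    \<Longrightarrow> g (tensor_lift P f (\<rho> m)) = tensor_lift Q (\<lambda>x h. g (f x h)) (\<rho> m)"
  by (rule MH.linear_lift) simp_all

lemma sw_counit:
  assumes P: "module K P" and g: "g \<in> linear_maps K M P" and m: "m \<in> carrier M"
  shows "tensor_lift P (\<lambda>x h. \<epsilon> h \<odot>\<^bsub>P\<^esub> g x) (\<rho> m) = g m"
proof -
  have "g m = g (tensor_lift M (\<lambda>x h. \<epsilon> h \<odot>\<^bsub>M\<^esub> x) (\<rho> m))"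
    by (simp add: coaction_counit m)
  also have "\<dots> = tensor_lift P (\<lambda>x h. g (\<epsilon> h \<odot>\<^bsub>M\<^esub> x)) (\<rho> m)"
    by (rule sw_image[OF g module P m]) simp
  also have "\<dots> = tensor_lift P (\<lambda>x h. \<epsilon> h \<odot>\<^bsub>P\<^esub> g x) (\<rho> m)"
    by (rule sw_cong[OF m]) (simp add: linear_mapsD[OF g])
  finally show ?thesis by simp
qed

text \<open>Coassociativity, tested against trilinear maps \<open>f\<close>: each side is the value of the linear map
  \<open>M \<otimes> (H \<otimes> H) \<rightarrow> P\<close> induced by \<open>f\<close> on one side of the coassociativity axiom.\<close>

lemma sw_coassoc:
  assumes P: "module K P" and m: "m \<in> carrier M"
    and f1: "\<And>y z. \<lbrakk>y \<in> carrier H; z \<in> carrier H\<rbrakk> \<Longrightarrow> (\<lambda>x. f x y z) \<in> linear_maps K M P"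
    and f2: "\<And>x z. \<lbrakk>x \<in> carrier M; z \<in> carrier H\<rbrakk> \<Longrightarrow> (\<lambda>y. f x y z) \<in> linear_maps K H P"
    and f3: "\<And>x y. \<lbrakk>x \<in> carrier M; y \<in> carrier H\<rbrakk> \<Longrightarrow> (\<lambda>z. f x y z) \<in> linear_maps K H P"
  shows "tensor_lift P (\<lambda>x h. tensor_lift P (\<lambda>h' h''. f x h' h'') (\<Delta> h)) (\<rho> m) =
    tensor_lift P (\<lambda>x h. tensor_lift P (\<lambda>x' h'. f x' h' h) (\<rho> x)) (\<rho> m)"
proof -
  interpret MHH: module_pair K M "tensor K H H"
    by (rule module_pair.intro[OF module HH.tensor_module])
  have fb: "f x \<in> bilinear_maps K H H P" if "x \<in> carrier M" for x
    using that by (intro bilinear_mapsI f2 f3)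
  have gb: "(\<lambda>x Y. tensor_lift P (f x) Y) \<in> bilinear_maps K M (tensor K H H) P"
    by (intro bilinear_mapsI HH.lift_linear HH.lift_param_linear P fb module f1)
  define g where "g = tensor_lift P (\<lambda>x Y. tensor_lift P (f x) Y)"
  have comult_closed: "\<Delta> h \<in> carrier (tensor K H H)" if "h \<in> carrier H" for h
    using that by (rule linear_mapsD[OF comult_linear])
  note lift = MHH.lift_lift[OF P gb module_factors[OF module module_H], folded g_def]
  have g_pure: "g (MHH.t x Y) = tensor_lift P (f x) Y"
    if "x \<in> carrier M" "Y \<in> carrier (tensor K H H)" for x Y
    using that unfolding g_def by (rule MHH.lift_pure[OF P gb])
  have "tensor_lift P (\<lambda>x h. tensor_lift P (\<lambda>h' h''. f x h' h'') (\<Delta> h)) (\<rho> m) =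
      tensor_lift P (\<lambda>x h. g (MHH.t x (\<Delta> h))) (\<rho> m)"
    by (rule sw_cong[OF m]) (simp add: g_pure comult_closed)
  also have "\<dots> = g (tensor_lift MHH.T (\<lambda>x h. MHH.t x (\<Delta> h)) (\<rho> m))"
    by (rule lift[symmetric]) (simp_all add: m comult_closed MHH.pure_closed)
  also have "\<dots> = g (tensor_lift MHH.T (\<lambda>x h. tensor_lift MHH.T (\<lambda>x' h'. MHH.t x' (HH.t h' h)) (\<rho> x)) (\<rho> m))"
    by (simp add: coaction_coassoc[OF m])
  also have "\<dots> = tensor_lift P (\<lambda>x h. g (tensor_lift MHH.T (\<lambda>x' h'. MHH.t x' (HH.t h' h)) (\<rho> x))) (\<rho> m)"
    by (rule lift) (simp_all add: m sw_closed MHH.tensor_module MHH.pure_closed HH.pure_closed)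
  also have "\<dots> = tensor_lift P (\<lambda>x h. tensor_lift P (\<lambda>x' h'. f x' h' h) (\<rho> x)) (\<rho> m)"
  proof (rule sw_cong[OF m])
    fix x h assume x: "x \<in> carrier M" and h: "h \<in> carrier H"
    have "g (tensor_lift MHH.T (\<lambda>x' h'. MHH.t x' (HH.t h' h)) (\<rho> x)) =
        tensor_lift P (\<lambda>x' h'. g (MHH.t x' (HH.t h' h))) (\<rho> x)"
      by (rule lift) (simp_all add: x h MHH.pure_closed HH.pure_closed)
    also have "\<dots> = tensor_lift P (\<lambda>x' h'. f x' h' h) (\<rho> x)"
      by (rule sw_cong[OF x]) (simp add: g_pure HH.pure_closed h HH.lift_pure[OF P fb])
    finally show "g (tensor_lift MHH.T (\<lambda>x' h'. MHH.t x' (HH.t h' h)) (\<rho> x)) =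
        tensor_lift P (\<lambda>x' h'. f x' h' h) (\<rho> x)" .
  qed
  finally show ?thesis .
qed

end

context hopf_algebra
begin

lemma regular_comodule: "right_comodule K H H \<Delta>"
  by (rule right_comodule.intro)
    (simp_all add: hopf_algebra_axioms module_H comult_linear coassoc counit_right)

sublocale HC: right_comodule K H H \<Delta>
  by (rule regular_comodule)

lemma sw_counit_left:
  assumes P: "module K P" and g: "g \<in> linear_maps K H P" and h: "h \<in> carrier H"
  shows "tensor_lift P (\<lambda>x y. \<epsilon> x \<odot>\<^bsub>P\<^esub> g y) (\<Delta> h) = g h"
proof -
  have "g h = g (tensor_lift H (\<lambda>x y. \<epsilon> x \<odot>\<^bsub>H\<^esub> y) (\<Delta> h))"
    by (simp add: counit_left h)
  also have "\<dots> = tensor_lift P (\<lambda>x y. g (\<epsilon> x \<odot>\<^bsub>H\<^esub> y)) (\<Delta> h)"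
    by (rule HC.sw_image[OF g module_H P h]) simp
  also have "\<dots> = tensor_lift P (\<lambda>x y. \<epsilon> x \<odot>\<^bsub>P\<^esub> g y) (\<Delta> h)"
    by (rule HC.sw_cong[OF h]) (simp add: linear_mapsD[OF g])
  finally show ?thesis by simp
qed

lemma counit_mult: "\<lbrakk>x \<in> carrier H; y \<in> carrier H\<rbrakk> \<Longrightarrow> \<epsilon> (x \<otimes>\<^bsub>H\<^esub> y) = \<epsilon> x \<otimes>\<^bsub>K\<^esub> \<epsilon> y"
  by (rule ring_hom_mult[OF counit_hom])

lemma smult_mult_right:
  "\<lbrakk>c \<in> carrier K; x \<in> carrier H; y \<in> carrier H\<rbrakk> \<Longrightarrow> x \<otimes>\<^bsub>H\<^esub> (c \<odot>\<^bsub>H\<^esub> y) = c \<odot>\<^bsub>H\<^esub> (x \<otimes>\<^bsub>H\<^esub> y)"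
  using linear_mapsD(3)[OF mult_lin(2)[OF _ linear_id]] by simp

lemma sw_comult_mult:
  assumes P: "module K P" and f: "f \<in> bilinear_maps K H H P"
    and x: "x \<in> carrier H" and y: "y \<in> carrier H"
  shows "tensor_lift P f (\<Delta> (x \<otimes>\<^bsub>H\<^esub> y)) =
    tensor_lift P (\<lambda>a b. tensor_lift P (\<lambda>a' b'. f (a \<otimes>\<^bsub>H\<^esub> a') (b \<otimes>\<^bsub>H\<^esub> b')) (\<Delta> y)) (\<Delta> x)"
proof -
  have "\<Delta> \<in> ring_hom H (tensor_algebra K H H)"
    using comult_hom by (simp add: algebra_homs_def)
  then have "\<Delta> (x \<otimes>\<^bsub>H\<^esub> y) = tensor_lift HH.T (\<lambda>a b.
      tensor_lift HH.T (\<lambda>a' b'. HH.t (a \<otimes>\<^bsub>H\<^esub> a') (b \<otimes>\<^bsub>H\<^esub> b')) (\<Delta> y)) (\<Delta> x)"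
    using x y by (simp add: ring_hom_mult tensor_algebra_def)
  also have "tensor_lift P f \<dots> = tensor_lift P (\<lambda>a b. tensor_lift P f
      (tensor_lift HH.T (\<lambda>a' b'. HH.t (a \<otimes>\<^bsub>H\<^esub> a') (b \<otimes>\<^bsub>H\<^esub> b')) (\<Delta> y))) (\<Delta> x)"
    by (rule HH.lift_lift[OF P f HH.tensor_factors_axioms])
      (simp_all add: x y HC.sw_closed HH.tensor_module HH.pure_closed)
  also have "\<dots> = tensor_lift P (\<lambda>a b.
      tensor_lift P (\<lambda>a' b'. f (a \<otimes>\<^bsub>H\<^esub> a') (b \<otimes>\<^bsub>H\<^esub> b')) (\<Delta> y)) (\<Delta> x)"
  proof (rule HC.sw_cong[OF x])
    fix a b assume a: "a \<in> carrier H" and b: "b \<in> carrier H"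
    have "tensor_lift P f (tensor_lift HH.T (\<lambda>a' b'. HH.t (a \<otimes>\<^bsub>H\<^esub> a') (b \<otimes>\<^bsub>H\<^esub> b')) (\<Delta> y)) =
       tensor_lift P (\<lambda>a' b'. tensor_lift P f (HH.t (a \<otimes>\<^bsub>H\<^esub> a') (b \<otimes>\<^bsub>H\<^esub> b'))) (\<Delta> y)"
      by (rule HH.lift_lift[OF P f HH.tensor_factors_axioms]) (simp_all add: y a b HH.pure_closed)
    also have "\<dots> = tensor_lift P (\<lambda>a' b'. f (a \<otimes>\<^bsub>H\<^esub> a') (b \<otimes>\<^bsub>H\<^esub> b')) (\<Delta> y)"
      by (rule HC.sw_cong[OF y]) (simp add: a b HH.lift_pure[OF P f])
    finally show "tensor_lift P f (tensor_lift HH.T (\<lambda>a' b'. HH.t (a \<otimes>\<^bsub>H\<^esub> a') (b \<otimes>\<^bsub>H\<^esub> b')) (\<Delta> y)) =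
      tensor_lift P (\<lambda>a' b'. f (a \<otimes>\<^bsub>H\<^esub> a') (b \<otimes>\<^bsub>H\<^esub> b')) (\<Delta> y)" .
  qed
  finally show ?thesis .
qed

end

section \<open>The antipode\<close>

context hopf_algebra
begin

text \<open>
  Introduction rules that prove a Sweedler expression linear in one variable by descending to that
  variable.
\<close>

lemmas hopf_lin = bilinear_mapsI linear_id antipode_lin mult_lin counit_lin_left counit_lin_right
  HC.sw_lin HC.sw_param_lin

lemma sw_antipode_left:
  assumes P: "module K P" and g: "g \<in> linear_maps K H P" and h: "h \<in> carrier H"
  shows "tensor_lift P (\<lambda>x y. g (S x \<otimes>\<^bsub>H\<^esub> y)) (\<Delta> h) = \<epsilon> h \<odot>\<^bsub>P\<^esub> g \<one>\<^bsub>H\<^esub>"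
  using HC.sw_image[OF g module_H P h, of "\<lambda>x y. S x \<otimes>\<^bsub>H\<^esub> y"] antipode_left[OF h]
  by (simp add: h linear_mapsD[OF g])

lemma sw_antipode_right:
  assumes P: "module K P" and g: "g \<in> linear_maps K H P" and h: "h \<in> carrier H"
  shows "tensor_lift P (\<lambda>x y. g (x \<otimes>\<^bsub>H\<^esub> S y)) (\<Delta> h) = \<epsilon> h \<odot>\<^bsub>P\<^esub> g \<one>\<^bsub>H\<^esub>"
  using HC.sw_image[OF g module_H P h, of "\<lambda>x y. x \<otimes>\<^bsub>H\<^esub> S y"] antipode_right[OF h]
  by (simp add: h linear_mapsD[OF g])

text \<open>
  Both sides are convolution inverse to the multiplication \<open>H \<otimes> H \<rightarrow> H\<close>: the sum
  \<open>\<Sum> S(x\<^sub>1y\<^sub>1)(x\<^sub>2y\<^sub>2)(S(y\<^sub>3)S(x\<^sub>3))\<close> collapses to \<open>S(xy)\<close> when the last two factors are summed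
  first, and to \<open>S(y)S(x)\<close> when the first two are.
\<close>

lemma antipode_mult:
  assumes x: "x \<in> carrier H" and y: "y \<in> carrier H"
  shows "S (x \<otimes>\<^bsub>H\<^esub> y) = S y \<otimes>\<^bsub>H\<^esub> S x"
proof -
  define D where "D f h = tensor_lift H f (\<Delta> h)" for f h
  define F where "F a b b' c d d' = S (a \<otimes>\<^bsub>H\<^esub> c) \<otimes>\<^bsub>H\<^esub> ((b \<otimes>\<^bsub>H\<^esub> d) \<otimes>\<^bsub>H\<^esub> (S d' \<otimes>\<^bsub>H\<^esub> S b'))"
    for a b b' c d d'
  have Dc: "D f h \<in> carrier H"
    if "h \<in> carrier H" "\<And>x y. \<lbrakk>x \<in> carrier H; y \<in> carrier H\<rbrakk> \<Longrightarrow> f x y \<in> carrier H" for f h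
    unfolding D_def using that by (intro HC.sw_closed module_H)
  have D_cong: "D f h = D g h"
    if "h \<in> carrier H" "\<And>x y. \<lbrakk>x \<in> carrier H; y \<in> carrier H\<rbrakk> \<Longrightarrow> f x y = g x y" for f g h
    unfolding D_def using that by (intro HC.sw_cong)
  have D_mult: "a \<otimes>\<^bsub>H\<^esub> D f h = D (\<lambda>u v. a \<otimes>\<^bsub>H\<^esub> f u v) h"
    "D f h \<otimes>\<^bsub>H\<^esub> a = D (\<lambda>u v. f u v \<otimes>\<^bsub>H\<^esub> a) h"
    if "h \<in> carrier H" "a \<in> carrier H"
      "\<And>x y. \<lbrakk>x \<in> carrier H; y \<in> carrier H\<rbrakk> \<Longrightarrow> f x y \<in> carrier H" for a f h
    unfolding D_def using that
    by (intro HC.sw_image[where g = "\<lambda>z. a \<otimes>\<^bsub>H\<^esub> z"] HC.sw_image[where g = "\<lambda>z. z \<otimes>\<^bsub>H\<^esub> a"]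
        hopf_lin module_H; simp)+
  have swap: "D (\<lambda>a b. D (\<lambda>c d. f a b c d) k) h = D (\<lambda>c d. D (\<lambda>a b. f a b c d) h) k"
    if "h \<in> carrier H" "k \<in> carrier H"
      "\<And>a b c d. \<lbrakk>a \<in> carrier H; b \<in> carrier H; c \<in> carrier H; d \<in> carrier H\<rbrakk> \<Longrightarrow> f a b c d \<in> carrier H"
    for f h k
    unfolding D_def
    by (rule lift_swap[OF HH.tensor_factors_axioms HH.tensor_factors_axioms])
      (use that in \<open>auto simp: H.abelian_group_axioms\<close>)
  have Fc: "F a b b' c d d' \<in> carrier H"
    if "a \<in> carrier H" "b \<in> carrier H" "b' \<in> carrier H" "c \<in> carrier H" "d \<in> carrier H" "d' \<in> carrier H"
    for a b b' c d d'
    using that by (simp add: F_def)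
  note side = Dc Fc
  \<comment> \<open>\<open>x\<^sub>1y\<^sub>1S(y\<^sub>2)S(x\<^sub>2) = \<epsilon>(x)\<epsilon>(y)\<close>\<close>
  have inner: "D (\<lambda>b b'. D (\<lambda>d d'. (b \<otimes>\<^bsub>H\<^esub> d) \<otimes>\<^bsub>H\<^esub> (S d' \<otimes>\<^bsub>H\<^esub> S b')) q) p =
      \<epsilon> p \<odot>\<^bsub>H\<^esub> (\<epsilon> q \<odot>\<^bsub>H\<^esub> \<one>\<^bsub>H\<^esub>)" if p: "p \<in> carrier H" and q: "q \<in> carrier H" for p q
  proof -
    have "D (\<lambda>d d'. (b \<otimes>\<^bsub>H\<^esub> d) \<otimes>\<^bsub>H\<^esub> (S d' \<otimes>\<^bsub>H\<^esub> S b')) q = \<epsilon> q \<odot>\<^bsub>H\<^esub> (b \<otimes>\<^bsub>H\<^esub> S b')"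
      if b: "b \<in> carrier H" "b' \<in> carrier H" for b b'
    proof -
      have "D (\<lambda>d d'. (b \<otimes>\<^bsub>H\<^esub> d) \<otimes>\<^bsub>H\<^esub> (S d' \<otimes>\<^bsub>H\<^esub> S b')) q =
          tensor_lift H (\<lambda>d d'. b \<otimes>\<^bsub>H\<^esub> (d \<otimes>\<^bsub>H\<^esub> S d') \<otimes>\<^bsub>H\<^esub> S b') (\<Delta> q)"
        unfolding D_def using b by (intro HC.sw_cong q) (simp add: H.m_assoc)
      also have "\<dots> = \<epsilon> q \<odot>\<^bsub>H\<^esub> (b \<otimes>\<^bsub>H\<^esub> \<one>\<^bsub>H\<^esub> \<otimes>\<^bsub>H\<^esub> S b')"
        by (rule sw_antipode_right[OF module_H _ q]) (intro hopf_lin; simp add: b)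
      finally show ?thesis using b by simp
    qed
    then have "D (\<lambda>b b'. D (\<lambda>d d'. (b \<otimes>\<^bsub>H\<^esub> d) \<otimes>\<^bsub>H\<^esub> (S d' \<otimes>\<^bsub>H\<^esub> S b')) q) p =
        D (\<lambda>b b'. \<epsilon> q \<odot>\<^bsub>H\<^esub> (b \<otimes>\<^bsub>H\<^esub> S b')) p"
      by (intro D_cong p)
    also have "\<dots> = \<epsilon> p \<odot>\<^bsub>H\<^esub> (\<epsilon> q \<odot>\<^bsub>H\<^esub> \<one>\<^bsub>H\<^esub>)"
      unfolding D_def by (rule sw_antipode_right[OF module_H _ p]) (rule smult_linear[OF module_H counit_closed[OF q]])
    finally show ?thesis .
  qed
  \<comment> \<open>\<open>S(x\<^sub>1y\<^sub>1)(x\<^sub>2y\<^sub>2) = \<epsilon>(xy)\<close>\<close>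
  have outer: "D (\<lambda>a b. D (\<lambda>c d. F a b b' c d d') s) r = \<epsilon> r \<odot>\<^bsub>H\<^esub> (\<epsilon> s \<odot>\<^bsub>H\<^esub> (S d' \<otimes>\<^bsub>H\<^esub> S b'))"
    if "r \<in> carrier H" "s \<in> carrier H" "b' \<in> carrier H" "d' \<in> carrier H" for r s b' d'
  proof -
    have "D (\<lambda>a b. D (\<lambda>c d. F a b b' c d d') s) r =
        tensor_lift H (\<lambda>a b. (S a \<otimes>\<^bsub>H\<^esub> b) \<otimes>\<^bsub>H\<^esub> (S d' \<otimes>\<^bsub>H\<^esub> S b')) (\<Delta> (r \<otimes>\<^bsub>H\<^esub> s))"
      unfolding D_def
      by (subst sw_comult_mult[OF module_H])
        (use that in \<open>auto simp: F_def H.m_assoc intro!: hopf_lin module_H HC.sw_cong\<close>)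
    also have "\<dots> = \<epsilon> (r \<otimes>\<^bsub>H\<^esub> s) \<odot>\<^bsub>H\<^esub> (\<one>\<^bsub>H\<^esub> \<otimes>\<^bsub>H\<^esub> (S d' \<otimes>\<^bsub>H\<^esub> S b'))"
      by (rule sw_antipode_left[OF module_H]) (use that in \<open>auto intro!: hopf_lin module_H\<close>)
    finally show ?thesis
      using that by (simp add: counit_mult HH.M.smult_assoc1)
  qed
  have "S (x \<otimes>\<^bsub>H\<^esub> y) = D (\<lambda>a p. \<epsilon> p \<odot>\<^bsub>H\<^esub> S (a \<otimes>\<^bsub>H\<^esub> y)) x"
    unfolding D_def using x y by (intro HC.sw_counit[symmetric]) (auto intro!: hopf_lin module_H)
  also have "\<dots> = D (\<lambda>a p. D (\<lambda>c q. \<epsilon> q \<odot>\<^bsub>H\<^esub> (\<epsilon> p \<odot>\<^bsub>H\<^esub> S (a \<otimes>\<^bsub>H\<^esub> c))) y) x"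
    unfolding D_def using x y
    by (intro HC.sw_cong HC.sw_counit[symmetric]) (auto intro!: hopf_lin module_H)
  also have "\<dots> = D (\<lambda>a p. D (\<lambda>c q. D (\<lambda>b b'. D (\<lambda>d d'. F a b b' c d d') q) p) y) x"
  proof (intro D_cong x y)
    fix a p c q assume *: "a \<in> carrier H" "p \<in> carrier H" "c \<in> carrier H" "q \<in> carrier H"
    have "D (\<lambda>b b'. D (\<lambda>d d'. F a b b' c d d') q) p =
      S (a \<otimes>\<^bsub>H\<^esub> c) \<otimes>\<^bsub>H\<^esub> D (\<lambda>b b'. D (\<lambda>d d'. (b \<otimes>\<^bsub>H\<^esub> d) \<otimes>\<^bsub>H\<^esub> (S d' \<otimes>\<^bsub>H\<^esub> S b')) q) p"
      using * by (simp add: D_mult F_def Dc cong: D_cong)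
    also have "\<dots> = \<epsilon> q \<odot>\<^bsub>H\<^esub> (\<epsilon> p \<odot>\<^bsub>H\<^esub> S (a \<otimes>\<^bsub>H\<^esub> c))"
      using * by (simp add: inner smult_mult_right HH.M.smult_assoc1[symmetric] HH.M.R.m_comm)
    finally show "\<epsilon> q \<odot>\<^bsub>H\<^esub> (\<epsilon> p \<odot>\<^bsub>H\<^esub> S (a \<otimes>\<^bsub>H\<^esub> c)) = D (\<lambda>b b'. D (\<lambda>d d'. F a b b' c d d') q) p" by simp
  qed
  also have "\<dots> = D (\<lambda>a p. D (\<lambda>b b'. D (\<lambda>c q. D (\<lambda>d d'. F a b b' c d d') q) y) p) x"
    using x y by (intro D_cong swap side)
  also have "\<dots> = D (\<lambda>a p. D (\<lambda>b b'. D (\<lambda>s d'. D (\<lambda>c d. F a b b' c d d') s) y) p) x"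
  proof (rule D_cong[OF x], rule D_cong, assumption)
    fix a p b b' assume *: "a \<in> carrier H" "p \<in> carrier H" "b \<in> carrier H" "b' \<in> carrier H"
    show "D (\<lambda>c q. D (\<lambda>d d'. F a b b' c d d') q) y = D (\<lambda>s d'. D (\<lambda>c d. F a b b' c d d') s) y"
      unfolding D_def F_def
      by (rule HC.sw_coassoc[OF module_H y]) (use * in \<open>auto intro!: hopf_lin module_H\<close>)
  qed
  also have "\<dots> = D (\<lambda>r b'. D (\<lambda>a b. D (\<lambda>s d'. D (\<lambda>c d. F a b b' c d d') s) y) r) x"
    unfolding D_def F_def
    by (rule HC.sw_coassoc[OF module_H x]) (use y in \<open>auto intro!: hopf_lin HC.sw_closed module_H\<close>)
  also have "\<dots> = D (\<lambda>r b'. D (\<lambda>s d'. D (\<lambda>a b. D (\<lambda>c d. F a b b' c d d') s) r) y) x"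
    using x y by (intro D_cong swap side)
  also have "\<dots> = D (\<lambda>r b'. D (\<lambda>s d'. \<epsilon> r \<odot>\<^bsub>H\<^esub> (\<epsilon> s \<odot>\<^bsub>H\<^esub> (S d' \<otimes>\<^bsub>H\<^esub> S b'))) y) x"
    using x y by (intro D_cong outer)
  \<comment> \<open>the counit of the inner variable has to stand outermost to be absorbed\<close>
  also have "\<dots> = D (\<lambda>r b'. D (\<lambda>s d'. \<epsilon> s \<odot>\<^bsub>H\<^esub> (\<epsilon> r \<odot>\<^bsub>H\<^esub> (S d' \<otimes>\<^bsub>H\<^esub> S b'))) y) x"
    using x y by (intro D_cong) (simp_all add: HH.M.smult_assoc1[symmetric] HH.M.R.m_comm)
  also have "\<dots> = D (\<lambda>r b'. \<epsilon> r \<odot>\<^bsub>H\<^esub> (S y \<otimes>\<^bsub>H\<^esub> S b')) x"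
    unfolding D_def using x y
    by (intro HC.sw_cong sw_counit_left) (auto intro!: hopf_lin module_H)
  also have "\<dots> = S y \<otimes>\<^bsub>H\<^esub> S x"
    unfolding D_def using x y by (intro sw_counit_left) (auto intro!: hopf_lin module_H)
  finally show ?thesis .
qed

end

text \<open>A Hopf algebra with bijective antipode; \<open>T\<close> is the inverse of the antipode.\<close>

locale hopf_algebra_bij = hopf_algebra +
  assumes bij: "bijective_antipode H"
begin

abbreviation "T \<equiv> inv_antipode H"

lemma antipode_inv [simp]: "h \<in> carrier H \<Longrightarrow> S (T h) = h"
  using bij by (simp add: bijective_antipode_def inv_antipode_def bij_betw_def f_inv_into_f)

lemma inv_antipode [simp]: "h \<in> carrier H \<Longrightarrow> T (S h) = h"
  using bij by (simp add: bijective_antipode_def inv_antipode_def bij_betw_def)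

lemma inv_closed [simp]: "h \<in> carrier H \<Longrightarrow> T h \<in> carrier H"
  using bij by (metis bijective_antipode_def inv_antipode_def bij_betw_def inv_into_into)

lemma inv_antipode_linear: "T \<in> linear_maps K H H"
proof (rule linear_mapsI)
  fix x y assume *: "x \<in> carrier H" "y \<in> carrier H"
  have "T (x \<oplus>\<^bsub>H\<^esub> y) = T (S (T x \<oplus>\<^bsub>H\<^esub> T y))"
    using * by (simp add: linear_mapsD[OF antipode_linear])
  then show "T (x \<oplus>\<^bsub>H\<^esub> y) = T x \<oplus>\<^bsub>H\<^esub> T y" using * by simp
next
  fix c x assume *: "c \<in> carrier K" "x \<in> carrier H"
  have "T (c \<odot>\<^bsub>H\<^esub> x) = T (S (c \<odot>\<^bsub>H\<^esub> T x))"
    using * by (simp add: linear_mapsD[OF antipode_linear])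
  then show "T (c \<odot>\<^bsub>H\<^esub> x) = c \<odot>\<^bsub>H\<^esub> T x" using * by simp
qed simp_all

lemma inv_antipode_mult:
  "\<lbrakk>x \<in> carrier H; y \<in> carrier H\<rbrakk> \<Longrightarrow> T (x \<otimes>\<^bsub>H\<^esub> y) = T y \<otimes>\<^bsub>H\<^esub> T x"
  using inv_antipode[of "T y \<otimes>\<^bsub>H\<^esub> T x"] by (simp add: antipode_mult)

lemma inv_antipode_one: "T \<one>\<^bsub>H\<^esub> = \<one>\<^bsub>H\<^esub>"
proof -
  have "T \<one>\<^bsub>H\<^esub> = T (S (T \<one>\<^bsub>H\<^esub>) \<otimes>\<^bsub>H\<^esub> \<one>\<^bsub>H\<^esub>) \<otimes>\<^bsub>H\<^esub> \<one>\<^bsub>H\<^esub>" by simp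
  also have "\<dots> = T \<one>\<^bsub>H\<^esub> \<otimes>\<^bsub>H\<^esub> T \<one>\<^bsub>H\<^esub>"
    by (metis H.m_closed H.one_closed H.r_one antipode_inv inv_antipode_mult inv_closed)
  finally have *: "T \<one>\<^bsub>H\<^esub> = T \<one>\<^bsub>H\<^esub> \<otimes>\<^bsub>H\<^esub> T \<one>\<^bsub>H\<^esub>" .
  have "S (T \<one>\<^bsub>H\<^esub> \<otimes>\<^bsub>H\<^esub> S \<one>\<^bsub>H\<^esub>) = S (S \<one>\<^bsub>H\<^esub>)"
    by (simp add: antipode_mult)
  then show ?thesis
    by (metis H.m_closed H.one_closed H.r_one H.l_one antipode_closed antipode_inv antipode_mult inv_closed inv_antipode)
qed

lemma inv_antipode_lin: "g \<in> linear_maps K Q H \<Longrightarrow> (\<lambda>x. T (g x)) \<in> linear_maps K Q H"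
  by (rule linear_comp[OF inv_antipode_linear])

text \<open>The map \<open>T\<close> is an antipode for the opposite comultiplication: apply it to the antipode axioms.\<close>

lemma sw_inv_antipode_left:
  assumes P: "module K P" and g: "g \<in> linear_maps K H P" and h: "h \<in> carrier H"
  shows "tensor_lift P (\<lambda>x y. g (T y \<otimes>\<^bsub>H\<^esub> x)) (\<Delta> h) = \<epsilon> h \<odot>\<^bsub>P\<^esub> g \<one>\<^bsub>H\<^esub>"
proof -
  have "tensor_lift P (\<lambda>x y. g (T y \<otimes>\<^bsub>H\<^esub> x)) (\<Delta> h) =
      tensor_lift P (\<lambda>x y. g (T (S x \<otimes>\<^bsub>H\<^esub> y))) (\<Delta> h)"
    by (rule HC.sw_cong[OF h]) (simp add: inv_antipode_mult)
  also have "\<dots> = \<epsilon> h \<odot>\<^bsub>P\<^esub> g (T \<one>\<^bsub>H\<^esub>)"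
    by (rule sw_antipode_left[OF P linear_comp[OF g inv_antipode_linear] h])
  finally show ?thesis by (simp add: inv_antipode_one)
qed

lemma sw_inv_antipode_right:
  assumes P: "module K P" and g: "g \<in> linear_maps K H P" and h: "h \<in> carrier H"
  shows "tensor_lift P (\<lambda>x y. g (y \<otimes>\<^bsub>H\<^esub> T x)) (\<Delta> h) = \<epsilon> h \<odot>\<^bsub>P\<^esub> g \<one>\<^bsub>H\<^esub>"
proof -
  have "tensor_lift P (\<lambda>x y. g (y \<otimes>\<^bsub>H\<^esub> T x)) (\<Delta> h) =
      tensor_lift P (\<lambda>x y. g (T (x \<otimes>\<^bsub>H\<^esub> S y))) (\<Delta> h)"
    by (rule HC.sw_cong[OF h]) (simp add: inv_antipode_mult)
  also have "\<dots> = \<epsilon> h \<odot>\<^bsub>P\<^esub> g (T \<one>\<^bsub>H\<^esub>)"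
    by (rule sw_antipode_right[OF P linear_comp[OF g inv_antipode_linear] h])
  finally show ?thesis by (simp add: inv_antipode_one)
qed

end

section \<open>Relative Hopf modules\<close>

text \<open>
  A module \<open>M\<close> over a commutative algebra \<open>A\<close>, both with coactions that the action respects.  The
  action is a parameter, so that \<open>A\<close> acting on itself is an instance; there, the compatibility says
  that the coaction of \<open>A\<close> is multiplicative.
\<close>

locale relative_hopf_module =
  hopf_algebra K H + A: right_comodule K H A \<sigma> + M: right_comodule K H M \<rho>
  for K :: "('k, 'x) ring_scheme" and H :: "('k, 'h, 'y) hopf_algebra_scheme"
    and A :: "('k, 'a, 'z) module_scheme" and \<sigma> :: "'a \<Rightarrow> ('a \<times> 'h) list set"
    and M :: "('k, 'm, 'w) module_scheme" and \<rho> :: "'m \<Rightarrow> ('m \<times> 'h) list set"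
    and dot :: "'a \<Rightarrow> 'm \<Rightarrow> 'm" (infixr "\<bullet>" 75) +
  assumes A_algebra: "algebra K A"
    and dot_bilinear: "dot \<in> bilinear_maps K A M M"
    and dot_assoc: "\<lbrakk>a \<in> carrier A; b \<in> carrier A; m \<in> carrier M\<rbrakk> \<Longrightarrow> (a \<otimes>\<^bsub>A\<^esub> b) \<bullet> m = a \<bullet> b \<bullet> m"
    and dot_one: "m \<in> carrier M \<Longrightarrow> \<one>\<^bsub>A\<^esub> \<bullet> m = m"
    and rho_dot: "\<lbrakk>a \<in> carrier A; m \<in> carrier M\<rbrakk> \<Longrightarrow> \<rho> (a \<bullet> m) =
        tensor_lift (tensor K M H) (\<lambda>x h.
          tensor_lift (tensor K M H) (\<lambda>y h'.
            pure_tensor K M H (x \<bullet> y) (h \<otimes>\<^bsub>H\<^esub> h')) (\<rho> m)) (\<sigma> a)"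
begin

abbreviation "MH \<equiv> tensor K M H"
abbreviation "tt \<equiv> pure_tensor K M H"

sublocale A: algebra K A by (rule A_algebra)

lemma dot_closed [simp]: "\<lbrakk>a \<in> carrier A; m \<in> carrier M\<rbrakk> \<Longrightarrow> a \<bullet> m \<in> carrier M"
  by (rule bilinear_closed[OF dot_bilinear])

lemmas dot_lin = bilinear_left[OF dot_bilinear] bilinear_right[OF dot_bilinear]

lemma A_module: "module K A" by (rule A.module)
lemma module_M: "module K M" by (rule M.module)
lemma module_MH: "module K MH" by (rule M.MH.tensor_module)

lemmas pure_lin = bilinear_left[OF M.MH.pure_bilinear] bilinear_right[OF M.MH.pure_bilinear]

lemmas rel_lin = hopf_lin dot_lin pure_lin M.sw_lin M.sw_param_lin

text \<open>The action of \<open>a \<otimes> h \<in> A \<otimes> H\<close> on \<open>M \<otimes> H\<close>.\<close>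

definition L :: "'a \<Rightarrow> 'h \<Rightarrow> ('m \<times> 'h) list set \<Rightarrow> ('m \<times> 'h) list set" where
  "L a h Z = tensor_lift MH (\<lambda>y k. tt (a \<bullet> y) (h \<otimes>\<^bsub>H\<^esub> k)) Z"

lemma L_bilinear: "\<lbrakk>a \<in> carrier A; h \<in> carrier H\<rbrakk>
    \<Longrightarrow> (\<lambda>y k. tt (a \<bullet> y) (h \<otimes>\<^bsub>H\<^esub> k)) \<in> bilinear_maps K M H MH"
  by (auto intro!: rel_lin)

lemma L_linear: "\<lbrakk>a \<in> carrier A; h \<in> carrier H\<rbrakk> \<Longrightarrow> L a h \<in> linear_maps K MH MH"
  unfolding L_def by (rule M.MH.lift_linear[OF module_MH L_bilinear])

lemma L_pure: "\<lbrakk>a \<in> carrier A; h \<in> carrier H; y \<in> carrier M; k \<in> carrier H\<rbrakk>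
    \<Longrightarrow> L a h (tt y k) = tt (a \<bullet> y) (h \<otimes>\<^bsub>H\<^esub> k)"
  unfolding L_def by (rule M.MH.lift_pure[OF module_MH L_bilinear])

lemma L_closed [simp]:
  "\<lbrakk>a \<in> carrier A; h \<in> carrier H; Z \<in> carrier MH\<rbrakk> \<Longrightarrow> L a h Z \<in> carrier MH"
  by (rule linear_mapsD[OF L_linear])

lemma L_linear_left:
  assumes "module K Q" "g \<in> linear_maps K Q A" "h \<in> carrier H" "Z \<in> carrier MH"
  shows "(\<lambda>x. L (g x) h Z) \<in> linear_maps K Q MH"
  unfolding L_def using assms(3) by (intro M.MH.lift_param_linear assms module_MH) (auto intro!: rel_lin assms)

lemma L_linear_right:
  assumes "module K Q" "g \<in> linear_maps K Q H" "a \<in> carrier A" "Z \<in> carrier MH"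
  shows "(\<lambda>x. L a (g x) Z) \<in> linear_maps K Q MH"
  unfolding L_def using assms(3) by (intro M.MH.lift_param_linear assms module_MH) (auto intro!: rel_lin assms)

lemmas L_lin = linear_comp[OF L_linear] L_linear_left L_linear_right

lemma L_L:
  assumes "a \<in> carrier A" "h \<in> carrier H" "b \<in> carrier A" "k \<in> carrier H" and Z: "Z \<in> carrier MH"
  shows "L a h (L b k Z) = L (a \<otimes>\<^bsub>A\<^esub> b) (h \<otimes>\<^bsub>H\<^esub> k) Z"
  using Z
  by (induction rule: M.MH.tensor_induct)
    (use assms in \<open>simp_all add: L_pure dot_assoc H.m_assoc linear_mapsD[OF L_linear]\<close>)

lemma L_one: "Z \<in> carrier MH \<Longrightarrow> L \<one>\<^bsub>A\<^esub> \<one>\<^bsub>H\<^esub> Z = Z"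
  by (induction rule: M.MH.tensor_induct) (simp_all add: L_pure dot_one linear_mapsD[OF L_linear])

lemma rho_dot_L: "\<lbrakk>a \<in> carrier A; m \<in> carrier M\<rbrakk> \<Longrightarrow> \<rho> (a \<bullet> m) = tensor_lift MH (\<lambda>x h. L x h (\<rho> m)) (\<sigma> a)"
  unfolding L_def by (rule rho_dot)

lemma rho_dot_coinvariant:
  assumes a: "a \<in> carrier A" and n: "n \<in> carrier M" "\<rho> n = tt n \<one>\<^bsub>H\<^esub>"
  shows "\<rho> (a \<bullet> n) = tensor_lift MH (\<lambda>x h. tt (x \<bullet> n) h) (\<sigma> a)"
  unfolding rho_dot_L[OF a n(1)] n(2) using n(1) by (intro A.sw_cong a) (simp add: L_pure)

end

section \<open>The projection onto the coinvariants\<close>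

text \<open>
  A relative Hopf module together with a colinear algebra map \<open>\<phi> : H \<rightarrow> A\<close>.  Such a map is
  invertible under convolution, so that \<open>A\<close> is cleft.
\<close>

locale cleft_hopf_module = relative_hopf_module K H A \<sigma> M \<rho> dot + hopf_algebra_bij K H
  for K :: "('k, 'x) ring_scheme" and H :: "('k, 'h, 'y) hopf_algebra_scheme"
    and A :: "('k, 'a, 'z) module_scheme" and \<sigma> :: "'a \<Rightarrow> ('a \<times> 'h) list set"
    and M :: "('k, 'm, 'w) module_scheme" and \<rho> :: "'m \<Rightarrow> ('m \<times> 'h) list set"
    and dot :: "'a \<Rightarrow> 'm \<Rightarrow> 'm" (infixr "\<bullet>" 75) +
  fixes \<phi> :: "'h \<Rightarrow> 'a"
  assumes phi_mult: "\<lbrakk>h \<in> carrier H; k \<in> carrier H\<rbrakk> \<Longrightarrow> \<phi> (h \<otimes>\<^bsub>H\<^esub> k) = \<phi> h \<otimes>\<^bsub>A\<^esub> \<phi> k"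
    and phi_one: "\<phi> \<one>\<^bsub>H\<^esub> = \<one>\<^bsub>A\<^esub>"
    and phi_colinear: "\<phi> \<in> colinear_maps K H H \<Delta> A \<sigma>"
begin

lemma phi_linear: "\<phi> \<in> linear_maps K H A"
  using phi_colinear by (simp add: colinear_maps_def)

lemma phi_closed [simp]: "h \<in> carrier H \<Longrightarrow> \<phi> h \<in> carrier A"
  by (rule linear_mapsD[OF phi_linear])

lemmas phi_lin = linear_comp[OF phi_linear]

lemmas all_lin = rel_lin inv_antipode_lin phi_lin

text \<open>The map \<open>m \<mapsto> \<phi>(T(m\<^sub>1)) \<bullet> m\<^sub>0\<close>.\<close>

definition p :: "'m \<Rightarrow> 'm" where
  "p m = tensor_lift M (\<lambda>x h. \<phi> (T h) \<bullet> x) (\<rho> m)"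

lemma p_linear: "p \<in> linear_maps K M M"
  unfolding p_def by (intro all_lin module_M module_H; simp)

lemma p_closed [simp]: "m \<in> carrier M \<Longrightarrow> p m \<in> carrier M"
  by (rule linear_mapsD[OF p_linear])

text \<open>Every \<open>m\<close> is recovered from its projections, since \<open>\<phi>(m\<^sub>2T(m\<^sub>1)) \<bullet> m\<^sub>0 = m\<close>.\<close>

lemma sw_phi_p:
  assumes m: "m \<in> carrier M"
  shows "tensor_lift M (\<lambda>x h. \<phi> h \<bullet> p x) (\<rho> m) = m"
proof -
  have "tensor_lift M (\<lambda>x h. \<phi> h \<bullet> p x) (\<rho> m) =
      tensor_lift M (\<lambda>x h. tensor_lift M (\<lambda>x' h'. \<phi> h \<bullet> \<phi> (T h') \<bullet> x') (\<rho> x)) (\<rho> m)"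
    unfolding p_def
    by (intro M.sw_cong m M.sw_image module_M) (auto intro!: all_lin)
  also have "\<dots> = tensor_lift M (\<lambda>x h. tensor_lift M (\<lambda>h' h''. \<phi> h'' \<bullet> \<phi> (T h') \<bullet> x) (\<Delta> h)) (\<rho> m)"
    by (rule M.sw_coassoc[symmetric, OF module_M m]) (auto intro!: all_lin)
  also have "\<dots> = tensor_lift M (\<lambda>x h. \<epsilon> h \<odot>\<^bsub>M\<^esub> x) (\<rho> m)"
  proof (rule M.sw_cong[OF m])
    fix x h assume x: "x \<in> carrier M" and h: "h \<in> carrier H"
    have "tensor_lift M (\<lambda>h' h''. \<phi> h'' \<bullet> \<phi> (T h') \<bullet> x) (\<Delta> h) =
        tensor_lift M (\<lambda>h' h''. \<phi> (h'' \<otimes>\<^bsub>H\<^esub> T h') \<bullet> x) (\<Delta> h)"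
      by (rule HC.sw_cong[OF h]) (simp add: x phi_mult dot_assoc)
    also have "\<dots> = \<epsilon> h \<odot>\<^bsub>M\<^esub> (\<phi> \<one>\<^bsub>H\<^esub> \<bullet> x)"
      by (rule sw_inv_antipode_right[OF module_M _ h]) (auto intro!: all_lin x)
    finally show "tensor_lift M (\<lambda>h' h''. \<phi> h'' \<bullet> \<phi> (T h') \<bullet> x) (\<Delta> h) = \<epsilon> h \<odot>\<^bsub>M\<^esub> x"
      by (simp add: phi_one dot_one x)
  qed
  also have "\<dots> = m"
    by (rule M.sw_counit[OF module_M linear_id m])
  finally show ?thesis .
qed


text \<open>The operators \<open>V\<^sub>h = \<phi>(h\<^sub>1) \<otimes> h\<^sub>2\<close> and \<open>W\<^sub>h = \<phi>(T(h\<^sub>2)) \<otimes> T(h\<^sub>1)\<close> on \<open>M \<otimes> H\<close>.\<close>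

definition V :: "'h \<Rightarrow> ('m \<times> 'h) list set \<Rightarrow> ('m \<times> 'h) list set" where
  "V h Z = tensor_lift MH (\<lambda>x y. L (\<phi> x) y Z) (\<Delta> h)"

definition W :: "'h \<Rightarrow> ('m \<times> 'h) list set \<Rightarrow> ('m \<times> 'h) list set" where
  "W h Z = tensor_lift MH (\<lambda>x y. L (\<phi> (T y)) (T x) Z) (\<Delta> h)"

lemma V_closed [simp]: "\<lbrakk>h \<in> carrier H; Z \<in> carrier MH\<rbrakk> \<Longrightarrow> V h Z \<in> carrier MH"
  unfolding V_def by (rule HC.sw_closed[OF module_MH]) simp_all

lemma W_closed [simp]: "\<lbrakk>h \<in> carrier H; Z \<in> carrier MH\<rbrakk> \<Longrightarrow> W h Z \<in> carrier MH"
  unfolding W_def by (rule HC.sw_closed[OF module_MH]) simp_all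

lemma V_lin:
  "\<lbrakk>module K Q; h \<in> carrier H; g \<in> linear_maps K Q MH\<rbrakk> \<Longrightarrow> (\<lambda>x. V h (g x)) \<in> linear_maps K Q MH"
  "\<lbrakk>module K Q; Z \<in> carrier MH; f \<in> linear_maps K Q H\<rbrakk> \<Longrightarrow> (\<lambda>x. V (f x) Z) \<in> linear_maps K Q MH"
  unfolding V_def by (auto intro!: all_lin L_lin module_MH module_H)

lemma W_lin:
  "\<lbrakk>module K Q; h \<in> carrier H; g \<in> linear_maps K Q MH\<rbrakk> \<Longrightarrow> (\<lambda>x. W h (g x)) \<in> linear_maps K Q MH"
  "\<lbrakk>module K Q; Z \<in> carrier MH; f \<in> linear_maps K Q H\<rbrakk> \<Longrightarrow> (\<lambda>x. W (f x) Z) \<in> linear_maps K Q MH"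
  unfolding W_def by (auto intro!: all_lin L_lin module_MH module_H)

lemma rho_phi_dot:
  assumes h: "h \<in> carrier H" and m: "m \<in> carrier M"
  shows "\<rho> (\<phi> h \<bullet> m) = V h (\<rho> m)"
proof -
  have b: "(\<lambda>x h. L x h (\<rho> m)) \<in> bilinear_maps K A H MH"
    using m by (auto intro!: all_lin L_lin module_H A_module)
  have "\<rho> (\<phi> h \<bullet> m) = tensor_lift MH (\<lambda>x h. L x h (\<rho> m)) (\<sigma> (\<phi> h))"
    using h m by (simp add: rho_dot_L)
  also have "\<sigma> (\<phi> h) = tensor_lift (tensor K A H) (\<lambda>x h. pure_tensor K A H (\<phi> x) h) (\<Delta> h)"
    using phi_colinear h by (simp add: colinear_maps_def)
  also have "tensor_lift MH (\<lambda>x h. L x h (\<rho> m)) \<dots> =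
      tensor_lift MH (\<lambda>x y. tensor_lift MH (\<lambda>x h. L x h (\<rho> m)) (pure_tensor K A H (\<phi> x) y)) (\<Delta> h)"
    by (rule A.MH.lift_lift[OF module_MH b HH.tensor_factors_axioms])
      (simp_all add: h A.MH.pure_closed)
  also have "\<dots> = V h (\<rho> m)"
    unfolding V_def by (rule HC.sw_cong[OF h]) (simp add: A.MH.lift_pure[OF module_MH b])
  finally show ?thesis .
qed

text \<open>\<open>\<phi>(T(h\<^sub>4)h\<^sub>1) \<otimes> T(h\<^sub>3)h\<^sub>2 = \<epsilon>(h)\<close>: the inner pair cancels first, then the outer pair.\<close>

lemma W_V:
  assumes h: "h \<in> carrier H" and Z: "Z \<in> carrier MH"
  shows "tensor_lift MH (\<lambda>x y. W y (V x Z)) (\<Delta> h) = \<epsilon> h \<odot>\<^bsub>MH\<^esub> Z"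
proof -
  define F where "F a b c d = L (\<phi> (T d \<otimes>\<^bsub>H\<^esub> a)) (T c \<otimes>\<^bsub>H\<^esub> b) Z" for a b c d
  have Fc: "F a b c d \<in> carrier MH"
    if "a \<in> carrier H" "b \<in> carrier H" "c \<in> carrier H" "d \<in> carrier H" for a b c d
    unfolding F_def using that Z by simp
  note lin = all_lin L_lin module_MH module_H A_module
  have "tensor_lift MH (\<lambda>x y. W y (V x Z)) (\<Delta> h) =
    tensor_lift MH (\<lambda>x y. tensor_lift MH (\<lambda>a b. tensor_lift MH (\<lambda>c d. F a b c d) (\<Delta> y)) (\<Delta> x)) (\<Delta> h)"
  proof (rule HC.sw_cong[OF h])
    fix x y assume x: "x \<in> carrier H" and y: "y \<in> carrier H"
    have "W y (V x Z) = tensor_lift MH (\<lambda>c d. tensor_lift MH (\<lambda>a b. F a b c d) (\<Delta> x)) (\<Delta> y)"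
      unfolding W_def
    proof (rule HC.sw_cong[OF y])
      fix c d assume cd: "c \<in> carrier H" "d \<in> carrier H"
      have "L (\<phi> (T d)) (T c) (V x Z) = tensor_lift MH (\<lambda>a b. L (\<phi> (T d)) (T c) (L (\<phi> a) b Z)) (\<Delta> x)"
        unfolding V_def by (rule HC.sw_image[OF L_linear module_MH module_MH x]) (simp_all add: cd Z)
      also have "\<dots> = tensor_lift MH (\<lambda>a b. F a b c d) (\<Delta> x)"
        by (rule HC.sw_cong[OF x]) (simp add: F_def L_L phi_mult cd Z)
      finally show "L (\<phi> (T d)) (T c) (V x Z) = tensor_lift MH (\<lambda>a b. F a b c d) (\<Delta> x)" .
    qed
    also have "\<dots> = tensor_lift MH (\<lambda>a b. tensor_lift MH (\<lambda>c d. F a b c d) (\<Delta> y)) (\<Delta> x)"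
      by (rule lift_swap[OF HH.tensor_factors_axioms HH.tensor_factors_axioms])
        (simp_all add: x y Fc M.MH.tensor_abelian_group)
    finally show "W y (V x Z) = \<dots>" .
  qed
  also have "\<dots> = tensor_lift MH (\<lambda>a r. tensor_lift MH (\<lambda>b y. tensor_lift MH (\<lambda>c d. F a b c d) (\<Delta> y)) (\<Delta> r)) (\<Delta> h)"
    by (rule HC.sw_coassoc[symmetric, OF module_MH h]) (use Z in \<open>auto simp: F_def intro!: lin\<close>)
  also have "\<dots> = tensor_lift MH (\<lambda>a r. L (\<phi> (T r \<otimes>\<^bsub>H\<^esub> a)) \<one>\<^bsub>H\<^esub> Z) (\<Delta> h)"
  proof (rule HC.sw_cong[OF h])
    fix a r assume a: "a \<in> carrier H" and r: "r \<in> carrier H"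
    have "tensor_lift MH (\<lambda>b y. tensor_lift MH (\<lambda>c d. F a b c d) (\<Delta> y)) (\<Delta> r) =
      tensor_lift MH (\<lambda>s d. tensor_lift MH (\<lambda>b c. F a b c d) (\<Delta> s)) (\<Delta> r)"
      by (rule HC.sw_coassoc[OF module_MH r]) (use a Z in \<open>auto simp: F_def intro!: lin\<close>)
    also have "\<dots> = tensor_lift MH (\<lambda>s d. \<epsilon> s \<odot>\<^bsub>MH\<^esub> L (\<phi> (T d \<otimes>\<^bsub>H\<^esub> a)) \<one>\<^bsub>H\<^esub> Z) (\<Delta> r)"
      unfolding F_def
      by (intro HC.sw_cong[OF r] sw_inv_antipode_left module_MH) (use a Z in \<open>auto intro!: lin\<close>)
    also have "\<dots> = L (\<phi> (T r \<otimes>\<^bsub>H\<^esub> a)) \<one>\<^bsub>H\<^esub> Z"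
      by (rule sw_counit_left[OF module_MH _ r]) (use a Z in \<open>auto intro!: lin\<close>)
    finally show "tensor_lift MH (\<lambda>b y. tensor_lift MH (\<lambda>c d. F a b c d) (\<Delta> y)) (\<Delta> r) =
      L (\<phi> (T r \<otimes>\<^bsub>H\<^esub> a)) \<one>\<^bsub>H\<^esub> Z" .
  qed
  also have "\<dots> = \<epsilon> h \<odot>\<^bsub>MH\<^esub> L (\<phi> \<one>\<^bsub>H\<^esub>) \<one>\<^bsub>H\<^esub> Z"
    by (rule sw_inv_antipode_left[OF module_MH _ h]) (use Z in \<open>auto intro!: lin\<close>)
  finally show ?thesis using Z by (simp add: phi_one L_one)
qed

text \<open>\<open>\<phi>(T(m\<^sub>3)) \<bullet> m\<^sub>0 \<otimes> T(m\<^sub>2)m\<^sub>1 = p(m) \<otimes> 1\<close>.\<close>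

lemma W_rho:
  assumes m: "m \<in> carrier M"
  shows "tensor_lift MH (\<lambda>x h. W h (\<rho> x)) (\<rho> m) = tt (p m) \<one>\<^bsub>H\<^esub>"
proof -
  define G where "G y k h\<^sub>1 h\<^sub>2 = tt (\<phi> (T h\<^sub>2) \<bullet> y) (T h\<^sub>1 \<otimes>\<^bsub>H\<^esub> k)" for y k h\<^sub>1 h\<^sub>2
  note lin = all_lin L_lin module_MH module_H A_module module_M
  have "tensor_lift MH (\<lambda>x h. W h (\<rho> x)) (\<rho> m) =
      tensor_lift MH (\<lambda>x h. tensor_lift MH (\<lambda>y k. tensor_lift MH (\<lambda>a b. G y k a b) (\<Delta> h)) (\<rho> x)) (\<rho> m)"
    unfolding W_def L_def G_def
    by (intro M.sw_cong m lift_swap[OF HH.tensor_factors_axioms M.MH.tensor_factors_axioms])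
      (simp_all add: M.MH.tensor_abelian_group M.MH.pure_closed)
  also have "\<dots> = tensor_lift MH (\<lambda>y r. tensor_lift MH (\<lambda>k h. tensor_lift MH (\<lambda>a b. G y k a b) (\<Delta> h)) (\<Delta> r)) (\<rho> m)"
    by (rule M.sw_coassoc[symmetric, OF module_MH m]) (auto simp: G_def intro!: lin)
  also have "\<dots> = tensor_lift MH (\<lambda>y r. tt (\<phi> (T r) \<bullet> y) \<one>\<^bsub>H\<^esub>) (\<rho> m)"
  proof (rule M.sw_cong[OF m])
    fix y r assume y: "y \<in> carrier M" and r: "r \<in> carrier H"
    have "tensor_lift MH (\<lambda>k h. tensor_lift MH (\<lambda>a b. G y k a b) (\<Delta> h)) (\<Delta> r) =
      tensor_lift MH (\<lambda>s b. tensor_lift MH (\<lambda>k a. G y k a b) (\<Delta> s)) (\<Delta> r)"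
      by (rule HC.sw_coassoc[OF module_MH r]) (use y in \<open>auto simp: G_def intro!: lin\<close>)
    also have "\<dots> = tensor_lift MH (\<lambda>s b. \<epsilon> s \<odot>\<^bsub>MH\<^esub> tt (\<phi> (T b) \<bullet> y) \<one>\<^bsub>H\<^esub>) (\<Delta> r)"
      unfolding G_def
      by (intro HC.sw_cong[OF r] sw_inv_antipode_left module_MH) (use y in \<open>auto intro!: lin\<close>)
    also have "\<dots> = tt (\<phi> (T r) \<bullet> y) \<one>\<^bsub>H\<^esub>"
      by (rule sw_counit_left[OF module_MH _ r]) (use y in \<open>auto intro!: lin\<close>)
    finally show "tensor_lift MH (\<lambda>k h. tensor_lift MH (\<lambda>a b. G y k a b) (\<Delta> h)) (\<Delta> r) = \<dots>" .
  qed
  also have "\<dots> = tt (p m) \<one>\<^bsub>H\<^esub>"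
    unfolding p_def
    by (rule M.sw_image[symmetric, OF _ module_M module_MH m]) (auto intro!: lin)
  finally show ?thesis .
qed

text \<open>\<open>\<rho>(p(m)) = W\<^sub>m\<^sub>2V\<^sub>m\<^sub>1\<rho>(p(m\<^sub>0)) = W\<^sub>m\<^sub>2\<rho>(\<phi>(m\<^sub>1) \<bullet> p(m\<^sub>0)) = W\<^sub>m\<^sub>1\<rho>(m\<^sub>0) = p(m) \<otimes> 1\<close>.\<close>

lemma p_coinvariant:
  assumes m: "m \<in> carrier M"
  shows "\<rho> (p m) = tt (p m) \<one>\<^bsub>H\<^esub>"
proof -
  note lin = all_lin L_lin W_lin V_lin module_MH module_H A_module module_M
    linear_comp[OF p_linear] linear_comp[OF M.coaction_linear]
  have "\<rho> (p m) = tensor_lift MH (\<lambda>x h. \<epsilon> h \<odot>\<^bsub>MH\<^esub> \<rho> (p x)) (\<rho> m)"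
    by (rule M.sw_counit[symmetric, OF module_MH _ m]) (auto intro!: lin)
  also have "\<dots> = tensor_lift MH (\<lambda>x h. tensor_lift MH (\<lambda>h' h''. W h'' (V h' (\<rho> (p x)))) (\<Delta> h)) (\<rho> m)"
    by (rule M.sw_cong[OF m]) (simp add: W_V)
  also have "\<dots> = tensor_lift MH (\<lambda>x h. tensor_lift MH (\<lambda>x' h'. W h (V h' (\<rho> (p x')))) (\<rho> x)) (\<rho> m)"
    by (rule M.sw_coassoc[OF module_MH m]) (auto intro!: lin)
  also have "\<dots> = tensor_lift MH (\<lambda>x h. W h (\<rho> x)) (\<rho> m)"
  proof (rule M.sw_cong[OF m])
    fix x h assume x: "x \<in> carrier M" and h: "h \<in> carrier H"
    have "tensor_lift MH (\<lambda>x' h'. W h (V h' (\<rho> (p x')))) (\<rho> x) =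
        tensor_lift MH (\<lambda>x' h'. W h (\<rho> (\<phi> h' \<bullet> p x'))) (\<rho> x)"
      by (rule M.sw_cong[OF x]) (simp add: rho_phi_dot)
    also have "\<dots> = W h (\<rho> (tensor_lift M (\<lambda>x' h'. \<phi> h' \<bullet> p x') (\<rho> x)))"
      by (rule M.sw_image[where g = "\<lambda>z. W h (\<rho> z)", symmetric, OF _ module_M module_MH x])
        (use h in \<open>auto intro!: lin\<close>)
    finally show "tensor_lift MH (\<lambda>x' h'. W h (V h' (\<rho> (p x')))) (\<rho> x) = W h (\<rho> x)"
      by (simp add: sw_phi_p x)
  qed
  also have "\<dots> = tt (p m) \<one>\<^bsub>H\<^esub>"
    by (rule W_rho[OF m])
  finally show ?thesis .
qed

lemma p_dot_coinvariant:
  assumes a: "a \<in> carrier A" and n: "n \<in> carrier M" "\<rho> n = tt n \<one>\<^bsub>H\<^esub>"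
  shows "p (a \<bullet> n) = tensor_lift A (\<lambda>x h. \<phi> (T h) \<otimes>\<^bsub>A\<^esub> x) (\<sigma> a) \<bullet> n"
proof -
  have b: "(\<lambda>x h. \<phi> (T h) \<bullet> x) \<in> bilinear_maps K M H M"
    by (auto intro!: all_lin)
  have "p (a \<bullet> n) = tensor_lift M (\<lambda>x h. \<phi> (T h) \<bullet> x) (tensor_lift MH (\<lambda>x h. tt (x \<bullet> n) h) (\<sigma> a))"
    by (simp add: p_def rho_dot_coinvariant assms)
  also have "\<dots> = tensor_lift M (\<lambda>y k. tensor_lift M (\<lambda>x h. \<phi> (T h) \<bullet> x) (tt (y \<bullet> n) k)) (\<sigma> a)"
    by (rule M.MH.lift_lift[OF module_M b A.MH.tensor_factors_axioms])
      (simp_all add: a n M.MH.pure_closed)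
  also have "\<dots> = tensor_lift M (\<lambda>y k. (\<phi> (T k) \<otimes>\<^bsub>A\<^esub> y) \<bullet> n) (\<sigma> a)"
    by (rule A.sw_cong[OF a]) (simp add: n M.MH.lift_pure[OF module_M b] dot_assoc)
  also have "\<dots> = tensor_lift A (\<lambda>x h. \<phi> (T h) \<otimes>\<^bsub>A\<^esub> x) (\<sigma> a) \<bullet> n"
    by (rule A.sw_image[where g = "\<lambda>z. z \<bullet> n", symmetric, OF _ A_module module_M a])
      (use n in \<open>auto intro!: all_lin\<close>)
  finally show ?thesis .
qed

end

section \<open>Transposed Poisson algebras and their modules\<close>

context tp_algebra
begin

sublocale A: algebra K A
  by (rule algebra)

lemma bracket_closed [simp]:
  "\<lbrakk>a \<in> carrier A; b \<in> carrier A\<rbrakk> \<Longrightarrow> bracket A a b \<in> carrier A"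
  by (rule bilinear_closed[OF bracket_bilinear])

lemmas bracket_add_right = linear_mapsD(2)[OF bilinear_mapsD(1)[OF bracket_bilinear]]
lemmas bracket_add_left = linear_mapsD(2)[OF bilinear_mapsD(2)[OF bracket_bilinear]]

lemma bracket_antisym:
  assumes a: "a \<in> carrier A" and b: "b \<in> carrier A"
  shows "bracket A a b = \<ominus>\<^bsub>A\<^esub> bracket A b a"
proof -
  have "bracket A a b \<oplus>\<^bsub>A\<^esub> bracket A b a = bracket A (a \<oplus>\<^bsub>A\<^esub> b) (a \<oplus>\<^bsub>A\<^esub> b)"
    using a b bracket_alternating[OF a] bracket_alternating[OF b]
    by (simp add: bracket_add_right bracket_add_left A.a_comm)
  also have "\<dots> = \<zero>\<^bsub>A\<^esub>" using a b by (simp add: bracket_alternating)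
  finally have "bracket A a b \<oplus>\<^bsub>A\<^esub> bracket A b a = \<zero>\<^bsub>A\<^esub>" .
  from A.minus_equality[OF this] show ?thesis using a b by simp
qed

lemma bracket_minus_right:
  assumes a: "a \<in> carrier A" and b: "b \<in> carrier A"
  shows "bracket A a (\<ominus>\<^bsub>A\<^esub> b) = \<ominus>\<^bsub>A\<^esub> bracket A a b"
  using linear_mapsD(3)[OF bilinear_mapsD(1)[OF bracket_bilinear a], of "\<ominus>\<^bsub>K\<^esub> \<one>\<^bsub>K\<^esub>" b] a b
  by (simp add: A.smult_l_minus)

text \<open>The Jacobi identity, as the statement that \<open>a \<mapsto> {a, \<cdot>}\<close> is a representation.\<close>

lemma bracket_bracket:
  assumes a: "a \<in> carrier A" and b: "b \<in> carrier A" and x: "x \<in> carrier A"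
  shows "bracket A (bracket A a b) x = bracket A a (bracket A b x) \<ominus>\<^bsub>A\<^esub> bracket A b (bracket A a x)"
proof -
  have 1: "bracket A b (bracket A x a) = \<ominus>\<^bsub>A\<^esub> bracket A b (bracket A a x)"
    using a b x bracket_antisym[of x a] by (simp add: bracket_minus_right)
  have 2: "bracket A x (bracket A a b) = \<ominus>\<^bsub>A\<^esub> bracket A (bracket A a b) x"
    using a b x by (intro bracket_antisym) simp_all
  have "(bracket A a (bracket A b x) \<ominus>\<^bsub>A\<^esub> bracket A b (bracket A a x)) \<ominus>\<^bsub>A\<^esub>
      bracket A (bracket A a b) x = \<zero>\<^bsub>A\<^esub>"
    using jacobi[OF a b x] by (simp only: 1 2 A.minus_eq)
  then show ?thesis
    using a b x A.minus_equality[of _ "\<ominus>\<^bsub>A\<^esub> bracket A (bracket A a b) x"]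
    by (simp add: A.minus_eq)
qed

lemma center_closed: "b \<in> tp_center A \<Longrightarrow> b \<in> carrier A"
  by (simp add: tp_center_def)

lemma center_left:
  "\<lbrakk>b \<in> tp_center A; a \<in> carrier A; a' \<in> carrier A\<rbrakk>
    \<Longrightarrow> bracket A (b \<otimes>\<^bsub>A\<^esub> a) a' = b \<otimes>\<^bsub>A\<^esub> bracket A a a'"
  by (simp add: tp_center_def)

lemma center_right:
  assumes "b \<in> tp_center A" "a \<in> carrier A" "a' \<in> carrier A"
  shows "bracket A a (b \<otimes>\<^bsub>A\<^esub> a') = b \<otimes>\<^bsub>A\<^esub> bracket A a a'"
  using assms center_left[OF assms(1) assms(3,2)] center_closed[OF assms(1)]
    bracket_antisym[of a "b \<otimes>\<^bsub>A\<^esub> a'"] bracket_antisym[of a a']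
  by (simp add: A.r_minus)

text \<open>
  Membership in the transposed Poisson center need only be tested against brackets with the unit,
  because the transposed Leibniz rule expresses \<open>{y, x}\<close> as \<open>2x{y, 1} + {1, xy}\<close>.
\<close>

lemma centerI:
  assumes b: "b \<in> carrier A"
    and one: "\<And>a. a \<in> carrier A \<Longrightarrow> bracket A \<one>\<^bsub>A\<^esub> a \<otimes>\<^bsub>A\<^esub> b = bracket A \<one>\<^bsub>A\<^esub> (a \<otimes>\<^bsub>A\<^esub> b)"
  shows "b \<in> tp_center A"
proof -
  have *: "bracket A y x = [(2::nat)] \<cdot>\<^bsub>A\<^esub> (x \<otimes>\<^bsub>A\<^esub> bracket A y \<one>\<^bsub>A\<^esub>) \<oplus>\<^bsub>A\<^esub> bracket A \<one>\<^bsub>A\<^esub> (x \<otimes>\<^bsub>A\<^esub> y)"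
    if "x \<in> carrier A" "y \<in> carrier A" for x y
  proof -
    let ?z = "bracket A (x \<otimes>\<^bsub>A\<^esub> y) \<one>\<^bsub>A\<^esub>"
    have "bracket A y x = \<ominus>\<^bsub>A\<^esub> ?z \<oplus>\<^bsub>A\<^esub> (?z \<oplus>\<^bsub>A\<^esub> bracket A y x)"
      using that by (intro A.r_neg1[symmetric]) simp_all
    then show ?thesis
      using that transposed_leibniz[of x y "\<one>\<^bsub>A\<^esub>"] bracket_antisym[of "\<one>\<^bsub>A\<^esub>" "x \<otimes>\<^bsub>A\<^esub> y"]
      by (simp add: A.a_comm)
  qed
  have r: "bracket A y (b \<otimes>\<^bsub>A\<^esub> x) = b \<otimes>\<^bsub>A\<^esub> bracket A y x" if "x \<in> carrier A" "y \<in> carrier A" for x y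
  proof -
    have 1: "bracket A \<one>\<^bsub>A\<^esub> (b \<otimes>\<^bsub>A\<^esub> x \<otimes>\<^bsub>A\<^esub> y) = b \<otimes>\<^bsub>A\<^esub> bracket A \<one>\<^bsub>A\<^esub> (x \<otimes>\<^bsub>A\<^esub> y)"
      using one[of "x \<otimes>\<^bsub>A\<^esub> y"] that b by (simp add: A.m_ac)
    have "bracket A y (b \<otimes>\<^bsub>A\<^esub> x) = [(2::nat)] \<cdot>\<^bsub>A\<^esub> (b \<otimes>\<^bsub>A\<^esub> x \<otimes>\<^bsub>A\<^esub> bracket A y \<one>\<^bsub>A\<^esub>) \<oplus>\<^bsub>A\<^esub>
        b \<otimes>\<^bsub>A\<^esub> bracket A \<one>\<^bsub>A\<^esub> (x \<otimes>\<^bsub>A\<^esub> y)"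
      using *[of "b \<otimes>\<^bsub>A\<^esub> x" y] that b unfolding 1 by simp
    also have "\<dots> = b \<otimes>\<^bsub>A\<^esub> ([(2::nat)] \<cdot>\<^bsub>A\<^esub> (x \<otimes>\<^bsub>A\<^esub> bracket A y \<one>\<^bsub>A\<^esub>) \<oplus>\<^bsub>A\<^esub> bracket A \<one>\<^bsub>A\<^esub> (x \<otimes>\<^bsub>A\<^esub> y))"
      using that b by (simp add: A.add_pow_two A.r_distr A.m_assoc)
    finally show ?thesis
      using *[of x y] that by simp
  qed
  have "b \<otimes>\<^bsub>A\<^esub> bracket A a a' = bracket A (b \<otimes>\<^bsub>A\<^esub> a) a'" if "a \<in> carrier A" "a' \<in> carrier A" for a a'
    using that b r[of a a'] bracket_antisym[of a a'] bracket_antisym[of "b \<otimes>\<^bsub>A\<^esub> a" a']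
    by (simp add: A.r_minus)
  then show ?thesis using b by (simp add: tp_center_def)
qed

end

context tp_module
begin

sublocale tp_algebra K A
  by (rule tp_algebra)

sublocale M: module K M
  by (rule vector_space)

lemma act_closed [simp]: "\<lbrakk>a \<in> carrier A; m \<in> carrier M\<rbrakk> \<Longrightarrow> act M a m \<in> carrier M"
  by (rule bilinear_closed[OF act_bilinear])

lemma lie_act_closed [simp]: "\<lbrakk>a \<in> carrier A; m \<in> carrier M\<rbrakk> \<Longrightarrow> lie_act M a m \<in> carrier M"
  by (rule bilinear_closed[OF lie_act_bilinear])

lemma act_assoc: "\<lbrakk>a \<in> carrier A; b \<in> carrier A; m \<in> carrier M\<rbrakk>
    \<Longrightarrow> act M (a \<otimes>\<^bsub>A\<^esub> b) m = act M a (act M b m)"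
  using module.smult_assoc1[OF act_module] by (simp add: module_via_def)

lemma act_one: "m \<in> carrier M \<Longrightarrow> act M \<one>\<^bsub>A\<^esub> m = m"
  using module.smult_one[OF act_module] by (simp add: module_via_def)

lemmas act_add_right = linear_mapsD(2)[OF bilinear_mapsD(1)[OF act_bilinear]]
lemmas act_add_left = linear_mapsD(2)[OF bilinear_mapsD(2)[OF act_bilinear]]

text \<open>
  Membership in \<open>M\<^sup>A\<close> need only be tested against brackets with the unit: with \<open>b = 1\<close> the axiom
  relating the bracket to the two actions gives \<open>a \<diamondop> (a' \<cdot> n) = 2{a, 1}a' \<cdot> n + 1 \<diamondop> (aa' \<cdot> n)\<close>,
  and \<open>2a'{a, 1} = {aa', 1} + {a, a'}\<close>.
\<close>

lemma tp_invariantsI: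
  assumes n: "n \<in> carrier M"
    and one: "\<And>a. a \<in> carrier A \<Longrightarrow> act M (bracket A \<one>\<^bsub>A\<^esub> a) n = lie_act M \<one>\<^bsub>A\<^esub> (act M a n)"
  shows "n \<in> tp_invariants A M"
proof -
  have "act M (bracket A a a') n = lie_act M a (act M a' n)"
    if a: "a \<in> carrier A" and a': "a' \<in> carrier A" for a a'
  proof -
    let ?z = "a' \<otimes>\<^bsub>A\<^esub> bracket A a \<one>\<^bsub>A\<^esub>"
    have "lie_act M a (act M a' n) \<ominus>\<^bsub>M\<^esub> lie_act M \<one>\<^bsub>A\<^esub> (act M (a \<otimes>\<^bsub>A\<^esub> a') n) = act M ?z n \<oplus>\<^bsub>M\<^esub> act M ?z n"
      using a a' n bracket_act[of a "\<one>\<^bsub>A\<^esub>" "act M a' n"]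
      by (simp add: act_one act_assoc[symmetric] M.add_pow_two A.m_comm)
    also have "\<dots> = act M (?z \<oplus>\<^bsub>A\<^esub> ?z) n"
      using a a' n by (simp add: act_add_left)
    \<comment> \<open>the transposed Leibniz rule for \<open>2a'{a, 1}\<close>\<close>
    also have "?z \<oplus>\<^bsub>A\<^esub> ?z = bracket A (a \<otimes>\<^bsub>A\<^esub> a') \<one>\<^bsub>A\<^esub> \<oplus>\<^bsub>A\<^esub> bracket A a a'"
      using a a' transposed_leibniz[of a' a "\<one>\<^bsub>A\<^esub>"] by (simp add: A.add_pow_two A.m_comm)
    also have "act M \<dots> n = act M (bracket A (a \<otimes>\<^bsub>A\<^esub> a') \<one>\<^bsub>A\<^esub>) n \<oplus>\<^bsub>M\<^esub> act M (bracket A a a') n"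
      using a a' n by (simp add: act_add_left)
    finally have "lie_act M a (act M a' n) =
        (act M (bracket A (a \<otimes>\<^bsub>A\<^esub> a') \<one>\<^bsub>A\<^esub>) n \<oplus>\<^bsub>M\<^esub> act M (bracket A a a') n) \<oplus>\<^bsub>M\<^esub>
          lie_act M \<one>\<^bsub>A\<^esub> (act M (a \<otimes>\<^bsub>A\<^esub> a') n)"
      using a a' n by (metis (no_types, lifting) A.m_closed A.one_closed M.add.inv_solve_right M.add.m_closed
        M.minus_eq act_closed bracket_closed lie_act_closed)
    also have "lie_act M \<one>\<^bsub>A\<^esub> (act M (a \<otimes>\<^bsub>A\<^esub> a') n) = act M (bracket A \<one>\<^bsub>A\<^esub> (a \<otimes>\<^bsub>A\<^esub> a')) n"
      using a a' by (simp add: one)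
    also have "(act M (bracket A (a \<otimes>\<^bsub>A\<^esub> a') \<one>\<^bsub>A\<^esub>) n \<oplus>\<^bsub>M\<^esub> act M (bracket A a a') n) \<oplus>\<^bsub>M\<^esub> \<dots> =
        act M (bracket A (a \<otimes>\<^bsub>A\<^esub> a') \<one>\<^bsub>A\<^esub> \<oplus>\<^bsub>A\<^esub> bracket A \<one>\<^bsub>A\<^esub> (a \<otimes>\<^bsub>A\<^esub> a')) n \<oplus>\<^bsub>M\<^esub> act M (bracket A a a') n"
      using a a' n by (simp add: act_add_left M.a_ac)
    also have "bracket A (a \<otimes>\<^bsub>A\<^esub> a') \<one>\<^bsub>A\<^esub> \<oplus>\<^bsub>A\<^esub> bracket A \<one>\<^bsub>A\<^esub> (a \<otimes>\<^bsub>A\<^esub> a') = \<zero>\<^bsub>A\<^esub>"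
      using a a' bracket_antisym[of "a \<otimes>\<^bsub>A\<^esub> a'" "\<one>\<^bsub>A\<^esub>"] by (simp add: A.l_neg)
    also have "act M \<zero>\<^bsub>A\<^esub> n = \<zero>\<^bsub>M\<^esub>"
      using n linear_mapsD(2)[OF bilinear_mapsD(2)[OF act_bilinear n], of "\<zero>\<^bsub>A\<^esub>" "\<zero>\<^bsub>A\<^esub>"] by (simp add: M.add.r_cancel_one')
    finally show ?thesis using a a' n by simp
  qed
  then show ?thesis using n by (simp add: tp_invariants_def)
qed

end

section \<open>The induced Hopf module\<close>

context tp_hopf_module
begin

sublocale tp_module K A M
  by (rule tp_module)

lemma coalgebra: "right_comodule K H A (coact A)"
  by (rule comodule_tp_algebra.comodule[OF comodule_tp_algebra])

sublocale MM: relative_hopf_module K H A "coact A" M "mcoact M" "act M"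
  by (intro relative_hopf_module.intro relative_hopf_module_axioms.intro coalgebra comodule
      right_comodule.hopf_algebra[OF comodule] algebra act_bilinear act_assoc act_one mcoact_act)

lemma mult_bilinear: "mult A \<in> bilinear_maps K A A A"
proof (intro bilinear_mapsI linear_mapsI)
  fix a c b assume "a \<in> carrier A" "c \<in> carrier K" "b \<in> carrier A"
  then show "a \<otimes>\<^bsub>A\<^esub> (c \<odot>\<^bsub>A\<^esub> b) = c \<odot>\<^bsub>A\<^esub> (a \<otimes>\<^bsub>A\<^esub> b)"
    using A.smult_assoc2[of c b a] by (simp add: A.m_comm)
qed (simp_all add: A.l_distr A.r_distr A.smult_assoc2)

lemma coact_mult:
  assumes "a \<in> carrier A" "a' \<in> carrier A"
  shows "coact A (a \<otimes>\<^bsub>A\<^esub> a') =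
    tensor_lift (tensor K A H) (\<lambda>x h.
      tensor_lift (tensor K A H) (\<lambda>x' h'.
        pure_tensor K A H (x \<otimes>\<^bsub>A\<^esub> x') (h \<otimes>\<^bsub>H\<^esub> h')) (coact A a')) (coact A a)"
proof -
  have "coact A \<in> ring_hom A (tensor_algebra K A H)"
    using comodule_tp_algebra.coact_hom[OF comodule_tp_algebra] by (simp add: algebra_homs_def)
  then show ?thesis using assms by (simp add: ring_hom_mult tensor_algebra_def)
qed

lemma coact_one: "coact A \<one>\<^bsub>A\<^esub> = pure_tensor K A H \<one>\<^bsub>A\<^esub> \<one>\<^bsub>H\<^esub>"
proof -
  have "coact A \<in> ring_hom A (tensor_algebra K A H)"
    using comodule_tp_algebra.coact_hom[OF comodule_tp_algebra] by (simp add: algebra_homs_def)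
  then show ?thesis using ring_hom_one by (fastforce simp: tensor_algebra_def)
qed

sublocale AA: relative_hopf_module K H A "coact A" A "coact A" "mult A"
  by (intro relative_hopf_module.intro relative_hopf_module_axioms.intro coalgebra
      right_comodule.hopf_algebra[OF comodule] algebra mult_bilinear coact_mult)
    (simp_all add: A.m_assoc)

text \<open>
  The factors of the induced module: \<open>A\<^sub>B\<close> is \<open>A\<close> with its multiplication by elements of \<open>B\<close>, and
  \<open>N\<close> is \<open>M\<^sup>A\<^sup>c\<^sup>o\<^sup>H\<close>.
\<close>

abbreviation "B \<equiv> coinv_center K H A"
abbreviation "A\<^sub>B \<equiv> regular_module A"
abbreviation "N \<equiv> coinv_invariants K H A M"

lemma B_carrier: "carrier B = tp_center A \<inter> coinvariants K H A (coact A)"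
  by (simp add: coinv_center_def)

lemma A\<^sub>B_fields [simp]: "carrier A\<^sub>B = carrier A" "zero A\<^sub>B = zero A" "add A\<^sub>B = add A" "smult A\<^sub>B = mult A"
  by (simp_all add: regular_module_def module_via_def)

lemma N_fields [simp]: "carrier N = tp_invariants A M \<inter> coinvariants K H M (mcoact M)"
  "zero N = zero M" "add N = add M" "smult N = act M"
  by (simp_all add: coinv_invariants_def module_via_def)

lemma B_center: "b \<in> carrier B \<Longrightarrow> b \<in> tp_center A"
  by (simp add: B_carrier)

lemma B_closed: "b \<in> carrier B \<Longrightarrow> b \<in> carrier A"
  by (simp add: B_carrier center_closed)

lemma B_coact: "b \<in> carrier B \<Longrightarrow> coact A b = pure_tensor K A H b \<one>\<^bsub>H\<^esub>"
  by (simp add: B_carrier coinvariants_def)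

lemma N_closed: "n \<in> carrier N \<Longrightarrow> n \<in> carrier M"
  by (simp add: tp_invariants_def)

lemma N_coact: "n \<in> carrier N \<Longrightarrow> mcoact M n = pure_tensor K M H n \<one>\<^bsub>H\<^esub>"
  by (simp add: coinvariants_def)

lemma N_lie: "\<lbrakk>n \<in> carrier N; a \<in> carrier A; a' \<in> carrier A\<rbrakk>
    \<Longrightarrow> act M (bracket A a a') n = lie_act M a (act M a' n)"
  by (simp add: tp_invariants_def)

lemma NI:
  assumes "n \<in> carrier M" "mcoact M n = pure_tensor K M H n \<one>\<^bsub>H\<^esub>"
    and "\<And>a a'. \<lbrakk>a \<in> carrier A; a' \<in> carrier A\<rbrakk>
      \<Longrightarrow> act M (bracket A a a') n = lie_act M a (act M a' n)"
  shows "n \<in> carrier N"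
  using assms by (simp add: tp_invariants_def coinvariants_def)

lemma N_add: 
  assumes "m \<in> carrier N" "n \<in> carrier N"
  shows "m \<oplus>\<^bsub>M\<^esub> n \<in> carrier N"
proof (rule NI)
  note mn = N_closed[OF assms(1)] N_closed[OF assms(2)]
  show "m \<oplus>\<^bsub>M\<^esub> n \<in> carrier M" using mn by simp
  show "mcoact M (m \<oplus>\<^bsub>M\<^esub> n) = pure_tensor K M H (m \<oplus>\<^bsub>M\<^esub> n) \<one>\<^bsub>H\<^esub>"
    using mn by (simp add: linear_mapsD(2)[OF MM.M.coaction_linear] N_coact[OF assms(1)] N_coact[OF assms(2)] MM.M.MH.pure_add_left)
  fix a a' assume *: "a \<in> carrier A" "a' \<in> carrier A"
  then show "act M (bracket A a a') (m \<oplus>\<^bsub>M\<^esub> n) = lie_act M a (act M a' (m \<oplus>\<^bsub>M\<^esub> n))"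
    using mn * by (simp add: act_add_right N_lie[OF assms(1)] N_lie[OF assms(2)]
        linear_mapsD(2)[OF bilinear_mapsD(1)[OF lie_act_bilinear]])
qed

lemma N_smult:
  assumes "c \<in> carrier K" "n \<in> carrier N"
  shows "c \<odot>\<^bsub>M\<^esub> n \<in> carrier N"
proof (rule NI)
  note n = N_closed[OF assms(2)]
  show "c \<odot>\<^bsub>M\<^esub> n \<in> carrier M" using n assms by simp
  show "mcoact M (c \<odot>\<^bsub>M\<^esub> n) = pure_tensor K M H (c \<odot>\<^bsub>M\<^esub> n) \<one>\<^bsub>H\<^esub>"
    using n assms(1) by (simp add: linear_mapsD(3)[OF MM.M.coaction_linear] N_coact[OF assms(2)] MM.M.MH.smult_pure)
  fix a a' assume *: "a \<in> carrier A" "a' \<in> carrier A"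
  then show "act M (bracket A a a') (c \<odot>\<^bsub>M\<^esub> n) = lie_act M a (act M a' (c \<odot>\<^bsub>M\<^esub> n))"
    using n assms(1) by (simp add: linear_mapsD(3)[OF bilinear_mapsD(1)[OF act_bilinear]] N_lie[OF assms(2)]
        linear_mapsD(3)[OF bilinear_mapsD(1)[OF lie_act_bilinear]])
qed

lemma N_act:
  assumes "b \<in> carrier B" "n \<in> carrier N"
  shows "act M b n \<in> carrier N"
proof (rule NI)
  note n = N_closed[OF assms(2)]
  have b: "b \<in> carrier A" using assms(1) by (rule B_closed)
  show "act M b n \<in> carrier M" using n b by simp
  have "(\<lambda>x h. pure_tensor K M H (act M x n) h) \<in> bilinear_maps K A H (tensor K M H)"
    using n by (auto intro!: MM.rel_lin)
  then show "mcoact M (act M b n) = pure_tensor K M H (act M b n) \<one>\<^bsub>H\<^esub>"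
    using n b MM.rho_dot_coinvariant[OF b n N_coact[OF assms(2)]]
    by (simp add: B_coact[OF assms(1)] MM.A.MH.lift_pure[OF MM.module_MH])
  fix a a' assume *: "a \<in> carrier A" "a' \<in> carrier A"
  then have "act M (bracket A a a') (act M b n) = act M (bracket A a (b \<otimes>\<^bsub>A\<^esub> a')) n"
    using n b center_right[OF B_center[OF assms(1)], of a a']
    by (simp add: act_assoc[symmetric] A.m_comm[of "bracket A a a'" b])
  also have "\<dots> = lie_act M a (act M a' (act M b n))"
    using n b * by (simp add: N_lie assms(2) act_assoc[symmetric] A.m_comm del: N_fields)
  finally show "act M (bracket A a a') (act M b n) = lie_act M a (act M a' (act M b n))" .
qed

lemma N_group: "abelian_group N"
proof (rule abelian_groupI)
  have z: "\<zero>\<^bsub>M\<^esub> \<in> carrier N"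
  proof (rule NI)
    show "mcoact M \<zero>\<^bsub>M\<^esub> = pure_tensor K M H \<zero>\<^bsub>M\<^esub> \<one>\<^bsub>H\<^esub>"
      using linear_mapsD(3)[OF MM.M.coaction_linear, of "\<zero>\<^bsub>K\<^esub>" "\<zero>\<^bsub>M\<^esub>"]
        module.smult_l_null[OF MM.module_MH] by (simp add: MM.M.MH.pure_zero_left)
    fix a a' assume *: "a \<in> carrier A" "a' \<in> carrier A"
    have "act M x \<zero>\<^bsub>M\<^esub> = \<zero>\<^bsub>M\<^esub>" "lie_act M x \<zero>\<^bsub>M\<^esub> = \<zero>\<^bsub>M\<^esub>" if "x \<in> carrier A" for x
      using that linear_mapsD(3)[OF bilinear_mapsD(1)[OF act_bilinear that], of "\<zero>\<^bsub>K\<^esub>" "\<zero>\<^bsub>M\<^esub>"]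
        linear_mapsD(3)[OF bilinear_mapsD(1)[OF lie_act_bilinear that], of "\<zero>\<^bsub>K\<^esub>" "\<zero>\<^bsub>M\<^esub>"] by simp_all
    then show "act M (bracket A a a') \<zero>\<^bsub>M\<^esub> = lie_act M a (act M a' \<zero>\<^bsub>M\<^esub>)" using * by simp
  qed simp
  then show "\<zero>\<^bsub>N\<^esub> \<in> carrier N" by (simp only: N_fields)
  fix x assume x: "x \<in> carrier N"
  then show "\<zero>\<^bsub>N\<^esub> \<oplus>\<^bsub>N\<^esub> x = x" using N_closed by simp
  have "(\<ominus>\<^bsub>K\<^esub> \<one>\<^bsub>K\<^esub>) \<odot>\<^bsub>M\<^esub> x \<in> carrier N" using x by (intro N_smult) simp_all
  moreover have "(\<ominus>\<^bsub>K\<^esub> \<one>\<^bsub>K\<^esub>) \<odot>\<^bsub>M\<^esub> x \<oplus>\<^bsub>M\<^esub> x = \<zero>\<^bsub>M\<^esub>"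
    using N_closed[OF x] by (simp add: M.smult_l_minus M.l_neg)
  ultimately show "\<exists>y\<in>carrier N. y \<oplus>\<^bsub>N\<^esub> x = \<zero>\<^bsub>N\<^esub>" unfolding N_fields(2,3) by blast
next
  fix x y z assume *: "x \<in> carrier N" "y \<in> carrier N" "z \<in> carrier N"
  then show "x \<oplus>\<^bsub>N\<^esub> y \<oplus>\<^bsub>N\<^esub> z = x \<oplus>\<^bsub>N\<^esub> (y \<oplus>\<^bsub>N\<^esub> z)"
    using N_closed by (simp add: M.a_assoc del: N_fields(1))
next
  fix x y assume *: "x \<in> carrier N" "y \<in> carrier N"
  then show "x \<oplus>\<^bsub>N\<^esub> y = y \<oplus>\<^bsub>N\<^esub> x"
    using N_closed by (simp add: M.a_comm del: N_fields(1))
  show "x \<oplus>\<^bsub>N\<^esub> y \<in> carrier N" using N_add[OF *] by simp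
qed

sublocale I: tensor_factors B A\<^sub>B N
proof (rule tensor_factors.intro)
  show "abelian_group A\<^sub>B" by (rule abelian_group_cong[OF A.abelian_group_axioms]) simp_all
  show "abelian_group N" by (rule N_group)
  fix r m assume "r \<in> carrier B" "m \<in> carrier A\<^sub>B"
  then show "r \<odot>\<^bsub>A\<^sub>B\<^esub> m \<in> carrier A\<^sub>B" by (simp add: B_closed)
next
  fix r m assume "r \<in> carrier B" "m \<in> carrier N"
  then show "r \<odot>\<^bsub>N\<^esub> m \<in> carrier N" using N_act by simp
qed

sublocale I: abelian_group I.T by (rule I.tensor_abelian_group)

end

context tp_hopf_module
begin

abbreviation "Ind \<equiv> induced_hopf_module K H A M"
abbreviation "IH \<equiv> tensor K Ind H"
abbreviation "th \<equiv> pure_tensor K Ind H"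

text \<open>The endomorphism \<open>g \<otimes>\<^sub>B id\<close> of \<open>A \<otimes>\<^sub>B N\<close>, for a \<open>B\<close>-linear map \<open>g\<close>.\<close>

definition E :: "('a \<Rightarrow> 'a) \<Rightarrow> ('a \<times> 'm) list set \<Rightarrow> ('a \<times> 'm) list set" where
  "E g = tensor_lift I.T (\<lambda>a m. I.t (g a) m)"

text \<open>Maps \<open>A \<rightarrow> A\<close> that are linear over the base ring and over \<open>B\<close>.\<close>

definition B_linear :: "('a \<Rightarrow> 'a) \<Rightarrow> bool" where
  "B_linear g \<longleftrightarrow> g \<in> linear_maps K A A \<and>
    (\<forall>b\<in>carrier B. \<forall>a\<in>carrier A. g (b \<otimes>\<^bsub>A\<^esub> a) = b \<otimes>\<^bsub>A\<^esub> g a)"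

lemma Ind_fields [simp]:
  "carrier Ind = carrier I.T" "zero Ind = zero I.T" "add Ind = add I.T"
  "smult Ind = (\<lambda>c. E (\<lambda>a. c \<odot>\<^bsub>A\<^esub> a))"
  "act Ind = (\<lambda>a. E (\<lambda>x. a \<otimes>\<^bsub>A\<^esub> x))" "lie_act Ind = (\<lambda>a. E (bracket A a))"
proof -
  have *: "tensor_lift \<lparr>carrier = c, mult = u, one = v, zero = zero I.T, add = add I.T, smult = s\<rparr> f =
      tensor_lift I.T f" for c u v s and f :: "'a \<Rightarrow> 'm \<Rightarrow> ('a \<times> 'm) list set"
    by (simp add: fun_eq_iff tensor_lift_def tensor_sum_def)
  show "carrier Ind = carrier I.T" "zero Ind = zero I.T" "add Ind = add I.T"
    "smult Ind = (\<lambda>c. E (\<lambda>a. c \<odot>\<^bsub>A\<^esub> a))"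
    "act Ind = (\<lambda>a. E (\<lambda>x. a \<otimes>\<^bsub>A\<^esub> x))" "lie_act Ind = (\<lambda>a. E (bracket A a))"
    by (simp_all add: induced_hopf_module_def Let_def induced_space_def module_via_def
        induced_tensor_def induced_pure_def E_def *)
qed

lemma mcoact_Ind: "mcoact Ind =
    tensor_lift IH (\<lambda>a m. tensor_lift IH (\<lambda>x h. th (I.t x m) h) (coact A a))"
proof -
  have *: "tensor K (induced_space K H A M) H = IH"
    "pure_tensor K (induced_space K H A M) H = th"
    by (rule tensor_cong; simp add: induced_hopf_module_def Let_def)+
  have "mcoact Ind = tensor_lift (tensor K (induced_space K H A M) H) (\<lambda>a m.
      tensor_lift (tensor K (induced_space K H A M) H) (\<lambda>x h.
        pure_tensor K (induced_space K H A M) H (I.t x m) h) (coact A a))"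
    by (simp add: induced_hopf_module_def Let_def induced_pure_def)
  then show ?thesis by (simp only: *)
qed

lemma E_balanced:
  assumes g: "B_linear g"
  shows "balanced_map B A\<^sub>B N I.T (\<lambda>a m. I.t (g a) m)"
proof -
  have lin: "g \<in> linear_maps K A A" and B: "\<And>b a. \<lbrakk>b \<in> carrier B; a \<in> carrier A\<rbrakk> \<Longrightarrow> g (b \<otimes>\<^bsub>A\<^esub> a) = b \<otimes>\<^bsub>A\<^esub> g a"
    using g by (auto simp: B_linear_def)
  note gl = linear_mapsD[OF lin]
  show ?thesis
  proof (rule balanced_map.intro)
    fix r m n assume *: "r \<in> carrier B" "m \<in> carrier A\<^sub>B" "n \<in> carrier N"
    then show "I.t (g (r \<odot>\<^bsub>A\<^sub>B\<^esub> m)) n = I.t (g m) (r \<odot>\<^bsub>N\<^esub> n)"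
      using I.pure_balanced[of r "g m" n] by (simp add: B gl)
  next
    fix m m' n assume "m \<in> carrier A\<^sub>B" "m' \<in> carrier A\<^sub>B" "n \<in> carrier N"
    then show "I.t (g (m \<oplus>\<^bsub>A\<^sub>B\<^esub> m')) n = I.t (g m) n \<oplus>\<^bsub>I.T\<^esub> I.t (g m') n"
      using I.pure_add_left[of "g m" "g m'" n] by (simp add: gl)
  next
    fix m n n' assume "m \<in> carrier A\<^sub>B" "n \<in> carrier N" "n' \<in> carrier N"
    then show "I.t (g m) (n \<oplus>\<^bsub>N\<^esub> n') = I.t (g m) n \<oplus>\<^bsub>I.T\<^esub> I.t (g m) n'"
      using gl by (intro I.pure_add_right) simp_all
  next
    fix m n assume "m \<in> carrier A\<^sub>B" "n \<in> carrier N"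
    then show "I.t (g m) n \<in> carrier I.T"
      using gl by (intro I.pure_closed) simp_all
  qed (rule I.abelian_group_axioms I.M_group I.N_group I.smult_M I.smult_N; assumption)+
qed

lemma E_pure: "\<lbrakk>B_linear g; a \<in> carrier A; n \<in> carrier N\<rbrakk> \<Longrightarrow> E g (I.t a n) = I.t (g a) n"
  unfolding E_def by (rule balanced_map.tensor_lift_pure[OF E_balanced]) simp_all

lemma E_add: "\<lbrakk>B_linear g; X \<in> carrier I.T; Y \<in> carrier I.T\<rbrakk>
    \<Longrightarrow> E g (X \<oplus>\<^bsub>I.T\<^esub> Y) = E g X \<oplus>\<^bsub>I.T\<^esub> E g Y"
  unfolding E_def by (rule balanced_map.tensor_lift_add[OF E_balanced])

lemma E_closed: "\<lbrakk>B_linear g; X \<in> carrier I.T\<rbrakk> \<Longrightarrow> E g X \<in> carrier I.T"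
  unfolding E_def
  by (rule I.lift_closed[OF I.abelian_group_axioms], assumption)
    (rule balanced_map.closed[OF E_balanced])

lemma Ind_induct [consumes 1, case_names pure add]:
  assumes "X \<in> carrier I.T"
    and "\<And>a n. \<lbrakk>a \<in> carrier A; n \<in> carrier N\<rbrakk> \<Longrightarrow> P (I.t a n)"
    and "\<And>X Y. \<lbrakk>X \<in> carrier I.T; Y \<in> carrier I.T; P X; P Y\<rbrakk> \<Longrightarrow> P (X \<oplus>\<^bsub>I.T\<^esub> Y)"
  shows "P X"
  using assms(1) by (rule I.tensor_induct) (use assms(2,3) in simp_all)

lemma t_closed: "\<lbrakk>a \<in> carrier A; n \<in> carrier N\<rbrakk> \<Longrightarrow> I.t a n \<in> carrier I.T"
  by (rule I.pure_closed) simp_all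

lemma t_add_left: "\<lbrakk>a \<in> carrier A; a' \<in> carrier A; n \<in> carrier N\<rbrakk>
    \<Longrightarrow> I.t (a \<oplus>\<^bsub>A\<^esub> a') n = I.t a n \<oplus>\<^bsub>I.T\<^esub> I.t a' n"
  using I.pure_add_left[of a a' n] by simp

lemma t_minus: 
  assumes "a \<in> carrier A" "a' \<in> carrier A" "n \<in> carrier N"
  shows "I.t (a \<ominus>\<^bsub>A\<^esub> a') n = I.t a n \<ominus>\<^bsub>I.T\<^esub> I.t a' n"
proof -
  have "I.t (a \<ominus>\<^bsub>A\<^esub> a') n \<oplus>\<^bsub>I.T\<^esub> I.t a' n = I.t a n"
    using assms by (subst t_add_left[symmetric]) (simp_all add: A.minus_eq A.a_assoc A.l_neg del: N_fields)
  then show ?thesis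
    using assms t_closed by (metis A.minus_closed I.add.inv_solve_right I.minus_eq)
qed

lemma smult_B_linear: "c \<in> carrier K \<Longrightarrow> B_linear (\<lambda>a. c \<odot>\<^bsub>A\<^esub> a)"
  unfolding B_linear_def
  by (simp add: smult_linear A.module B_closed linear_mapsD(3)[OF bilinear_mapsD(1)[OF mult_bilinear]])

lemma mult_B_linear: "a \<in> carrier A \<Longrightarrow> B_linear (\<lambda>x. a \<otimes>\<^bsub>A\<^esub> x)"
  unfolding B_linear_def by (simp add: bilinear_mapsD[OF mult_bilinear] B_closed A.m_lcomm)

lemma bracket_B_linear: "a \<in> carrier A \<Longrightarrow> B_linear (bracket A a)"
  using bilinear_mapsD(1)[OF bracket_bilinear]
  unfolding B_linear_def by (simp add: B_center center_right)

lemmas E_intros = smult_B_linear mult_B_linear bracket_B_linear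

lemma Ind_module: "module K Ind"
proof (rule moduleI)
  show "cring K" by (rule A.R_cring)
  show "abelian_group Ind" by (rule abelian_group_cong[OF I.abelian_group_axioms]) simp_all
  fix c X assume c: "c \<in> carrier K" and X: "X \<in> carrier Ind"
  show "c \<odot>\<^bsub>Ind\<^esub> X \<in> carrier Ind" using c X by (simp add: E_closed E_intros)
  fix d assume d: "d \<in> carrier K"
  have X': "X \<in> carrier I.T" using X by simp
  have cd: "c \<oplus>\<^bsub>K\<^esub> d \<in> carrier K" "c \<otimes>\<^bsub>K\<^esub> d \<in> carrier K" using c d by simp_all
  note E = E_pure E_add E_closed E_intros c d cd
  show "(c \<oplus>\<^bsub>K\<^esub> d) \<odot>\<^bsub>Ind\<^esub> X = c \<odot>\<^bsub>Ind\<^esub> X \<oplus>\<^bsub>Ind\<^esub> d \<odot>\<^bsub>Ind\<^esub> X"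
    using X' unfolding Ind_fields
    by (induction rule: Ind_induct) (simp_all add: E A.smult_l_distr t_add_left I.a_ac del: N_fields)
  show "(c \<otimes>\<^bsub>K\<^esub> d) \<odot>\<^bsub>Ind\<^esub> X = c \<odot>\<^bsub>Ind\<^esub> (d \<odot>\<^bsub>Ind\<^esub> X)"
    using X' unfolding Ind_fields
    by (induction rule: Ind_induct) (simp_all add: E A.smult_assoc1 del: N_fields)
next
  fix X assume "X \<in> carrier Ind"
  then have "X \<in> carrier I.T" by simp
  then show "\<one>\<^bsub>K\<^esub> \<odot>\<^bsub>Ind\<^esub> X = X" unfolding Ind_fields
    by (induction rule: Ind_induct) (simp_all add: E_pure E_add E_closed E_intros del: N_fields)
next
  fix c X Y assume "c \<in> carrier K" "X \<in> carrier Ind" "Y \<in> carrier Ind"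
  then show "c \<odot>\<^bsub>Ind\<^esub> (X \<oplus>\<^bsub>Ind\<^esub> Y) = c \<odot>\<^bsub>Ind\<^esub> X \<oplus>\<^bsub>Ind\<^esub> c \<odot>\<^bsub>Ind\<^esub> Y"
    by (simp add: E_add E_intros)
qed

lemma E_linear:
  assumes g: "B_linear g"
  shows "E g \<in> linear_maps K Ind Ind"
proof (rule linear_mapsI)
  fix c X assume c: "c \<in> carrier K" and "X \<in> carrier Ind"
  then have "X \<in> carrier I.T" by simp
  have gl: "g \<in> linear_maps K A A" using g by (simp add: B_linear_def)
  show "E g (c \<odot>\<^bsub>Ind\<^esub> X) = c \<odot>\<^bsub>Ind\<^esub> E g X"
    unfolding Ind_fields using \<open>X \<in> carrier I.T\<close>
    by (induction rule: Ind_induct)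
      (simp_all add: g c linear_mapsD[OF gl] E_pure E_add E_closed E_intros del: N_fields)
qed (simp_all add: E_add E_closed g)

text \<open>An operation \<open>A \<times> A \<rightarrow> A\<close>, \<open>B\<close>-linear on the right, acts on \<open>A \<otimes>\<^sub>B N\<close> bilinearly.\<close>

lemma E_bilinear:
  assumes f: "f \<in> bilinear_maps K A A A" and B: "\<And>a. a \<in> carrier A \<Longrightarrow> B_linear (f a)"
  shows "(\<lambda>a. E (f a)) \<in> bilinear_maps K A Ind Ind"
proof (rule bilinear_mapsI)
  show "E (f a) \<in> linear_maps K Ind Ind" if "a \<in> carrier A" for a
    by (rule E_linear[OF B[OF that]])
  fix X assume "X \<in> carrier Ind"
  then have X: "X \<in> carrier I.T" by simp
  note fl = linear_mapsD[OF bilinear_mapsD(2)[OF f]] bilinear_closed[OF f]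
  show "(\<lambda>a. E (f a) X) \<in> linear_maps K A Ind"
  proof (rule linear_mapsI)
    fix a a' assume a: "a \<in> carrier A" "a' \<in> carrier A"
    show "E (f (a \<oplus>\<^bsub>A\<^esub> a')) X = E (f a) X \<oplus>\<^bsub>Ind\<^esub> E (f a') X"
      unfolding Ind_fields using X
      by (induction rule: Ind_induct)
        (use a in \<open>simp_all add: fl E_pure E_add E_closed B t_add_left I.a_ac del: N_fields\<close>)
  next
    fix c a assume a: "c \<in> carrier K" "a \<in> carrier A"
    show "E (f (c \<odot>\<^bsub>A\<^esub> a)) X = c \<odot>\<^bsub>Ind\<^esub> E (f a) X"
      unfolding Ind_fields using X
      by (induction rule: Ind_induct)
        (use a in \<open>simp_all add: fl E_pure E_add E_closed B E_intros del: N_fields\<close>)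
  qed (simp add: E_closed B X)
qed

lemma Ind_tp_module: "tp_module K A Ind"
proof (rule tp_module.intro)
  note E = E_pure E_add E_closed E_intros
  have ab: "abelian_group Ind" by (rule module_group[OF Ind_module])
  have minus: "X \<ominus>\<^bsub>Ind\<^esub> Y = X \<ominus>\<^bsub>I.T\<^esub> Y" for X Y
    by (simp add: a_minus_def a_inv_def m_inv_def)
  have two: "[(2::nat)] \<cdot>\<^bsub>Ind\<^esub> X = X \<oplus>\<^bsub>I.T\<^esub> X" if "X \<in> carrier I.T" for X
    using abelian_monoid.add_pow_two[OF abelian_group.axioms(1)[OF ab], of X] that by simp
  have minus_add: "(X \<oplus>\<^bsub>I.T\<^esub> Y) \<ominus>\<^bsub>I.T\<^esub> (X' \<oplus>\<^bsub>I.T\<^esub> Y') = (X \<ominus>\<^bsub>I.T\<^esub> X') \<oplus>\<^bsub>I.T\<^esub> (Y \<ominus>\<^bsub>I.T\<^esub> Y')"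
    if "X \<in> carrier I.T" "Y \<in> carrier I.T" "X' \<in> carrier I.T" "Y' \<in> carrier I.T" for X Y X' Y'
    using that by (simp add: I.minus_eq I.minus_add I.a_ac)
  show "module A (module_via Ind (carrier Ind) (act Ind))"
  proof (rule moduleI)
    show "abelian_group (module_via Ind (carrier Ind) (act Ind))"
      by (rule abelian_group_cong[OF I.abelian_group_axioms]) (simp_all add: module_via_def)
    fix a b X assume a: "a \<in> carrier A" and b: "b \<in> carrier A"
      and "X \<in> carrier (module_via Ind (carrier Ind) (act Ind))"
    then have X: "X \<in> carrier I.T" by (simp add: module_via_def)
    have ab: "a \<oplus>\<^bsub>A\<^esub> b \<in> carrier A" "a \<otimes>\<^bsub>A\<^esub> b \<in> carrier A" using a b by simp_all
    have "E (\<lambda>x. (a \<oplus>\<^bsub>A\<^esub> b) \<otimes>\<^bsub>A\<^esub> x) X = E (\<lambda>x. a \<otimes>\<^bsub>A\<^esub> x) X \<oplus>\<^bsub>I.T\<^esub> E (\<lambda>x. b \<otimes>\<^bsub>A\<^esub> x) X"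
      using X by (induction rule: Ind_induct)
        (use a b ab in \<open>simp_all add: E A.l_distr t_add_left I.a_ac del: N_fields\<close>)
    then show "(a \<oplus>\<^bsub>A\<^esub> b) \<odot>\<^bsub>module_via Ind (carrier Ind) (act Ind)\<^esub> X =
        a \<odot>\<^bsub>module_via Ind (carrier Ind) (act Ind)\<^esub> X
        \<oplus>\<^bsub>module_via Ind (carrier Ind) (act Ind)\<^esub> b \<odot>\<^bsub>module_via Ind (carrier Ind) (act Ind)\<^esub> X"
      by (simp add: module_via_def)
    have "E (\<lambda>x. (a \<otimes>\<^bsub>A\<^esub> b) \<otimes>\<^bsub>A\<^esub> x) X = E (\<lambda>x. a \<otimes>\<^bsub>A\<^esub> x) (E (\<lambda>x. b \<otimes>\<^bsub>A\<^esub> x) X)"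
      using X by (induction rule: Ind_induct)
        (use a b ab in \<open>simp_all add: E A.m_assoc del: N_fields\<close>)
    then show "(a \<otimes>\<^bsub>A\<^esub> b) \<odot>\<^bsub>module_via Ind (carrier Ind) (act Ind)\<^esub> X =
        a \<odot>\<^bsub>module_via Ind (carrier Ind) (act Ind)\<^esub> (b \<odot>\<^bsub>module_via Ind (carrier Ind) (act Ind)\<^esub> X)"
      by (simp add: module_via_def)
  next
    fix X assume "X \<in> carrier (module_via Ind (carrier Ind) (act Ind))"
    then have X: "X \<in> carrier I.T" by (simp add: module_via_def)
    have "E (\<lambda>x. \<one>\<^bsub>A\<^esub> \<otimes>\<^bsub>A\<^esub> x) X = X"
      using X by (induction rule: Ind_induct) (simp_all add: E del: N_fields A.l_one, simp add: A.l_one)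
    then show "\<one>\<^bsub>A\<^esub> \<odot>\<^bsub>module_via Ind (carrier Ind) (act Ind)\<^esub> X = X"
      by (simp add: module_via_def)
  qed (simp_all add: A.M_cring module_via_def E)
  show "act Ind \<in> bilinear_maps K A Ind Ind"
    using E_bilinear[OF mult_bilinear mult_B_linear] by simp
  show "lie_act Ind \<in> bilinear_maps K A Ind Ind"
    using E_bilinear[OF bracket_bilinear bracket_B_linear] by simp
  fix a b X assume a: "a \<in> carrier A" and b: "b \<in> carrier A" and "X \<in> carrier Ind"
  then have X: "X \<in> carrier I.T" by simp
  note jac = bracket_bracket[OF a b]
  have ab: "bracket A a b \<in> carrier A" "a \<otimes>\<^bsub>A\<^esub> b \<in> carrier A" using a b by simp_all
  have "E (bracket A (bracket A a b)) X = E (bracket A a) (E (bracket A b) X) \<ominus>\<^bsub>I.T\<^esub> E (bracket A b) (E (bracket A a) X)"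
    using X by (induction rule: Ind_induct)
      (use a b ab in \<open>simp_all add: E jac t_minus minus_add del: N_fields\<close>)
  then show "lie_act Ind (bracket A a b) X =
      lie_act Ind a (lie_act Ind b X) \<ominus>\<^bsub>Ind\<^esub> lie_act Ind b (lie_act Ind a X)"
    by (simp add: minus)
  have leib: "(bracket A a b \<otimes>\<^bsub>A\<^esub> x) \<oplus>\<^bsub>A\<^esub> (bracket A a b \<otimes>\<^bsub>A\<^esub> x) =
      bracket A a (b \<otimes>\<^bsub>A\<^esub> x) \<ominus>\<^bsub>A\<^esub> bracket A b (a \<otimes>\<^bsub>A\<^esub> x)" if x: "x \<in> carrier A" for x
    using transposed_leibniz[of x a b] bracket_antisym[of "x \<otimes>\<^bsub>A\<^esub> a" b] a b x
    by (simp add: A.add_pow_two A.minus_eq A.m_comm A.a_comm)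
  have "E (\<lambda>x. bracket A a b \<otimes>\<^bsub>A\<^esub> x) X \<oplus>\<^bsub>I.T\<^esub> E (\<lambda>x. bracket A a b \<otimes>\<^bsub>A\<^esub> x) X =
      E (bracket A a) (E (\<lambda>x. b \<otimes>\<^bsub>A\<^esub> x) X) \<ominus>\<^bsub>I.T\<^esub> E (bracket A b) (E (\<lambda>x. a \<otimes>\<^bsub>A\<^esub> x) X)"
    using X
  proof (induction rule: Ind_induct)
    case (pure x n)
    then show ?case using a b ab
      by (simp add: E t_minus[symmetric] t_add_left[symmetric] leib del: N_fields)
  next
    case (add X Y)
    have "E (\<lambda>x. bracket A a b \<otimes>\<^bsub>A\<^esub> x) (X \<oplus>\<^bsub>I.T\<^esub> Y) \<oplus>\<^bsub>I.T\<^esub> E (\<lambda>x. bracket A a b \<otimes>\<^bsub>A\<^esub> x) (X \<oplus>\<^bsub>I.T\<^esub> Y) =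
      (E (\<lambda>x. bracket A a b \<otimes>\<^bsub>A\<^esub> x) X \<oplus>\<^bsub>I.T\<^esub> E (\<lambda>x. bracket A a b \<otimes>\<^bsub>A\<^esub> x) X) \<oplus>\<^bsub>I.T\<^esub>
      (E (\<lambda>x. bracket A a b \<otimes>\<^bsub>A\<^esub> x) Y \<oplus>\<^bsub>I.T\<^esub> E (\<lambda>x. bracket A a b \<otimes>\<^bsub>A\<^esub> x) Y)"
      using add(1,2) ab by (simp add: E I.a_ac)
    then show ?case using add a b by (simp add: E minus_add)
  qed
  then show "[(2::nat)] \<cdot>\<^bsub>Ind\<^esub> act Ind (bracket A a b) X =
      lie_act Ind a (act Ind b X) \<ominus>\<^bsub>Ind\<^esub> lie_act Ind b (act Ind a X)"
    using X ab by (simp add: two minus E)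
  have leib2: "(a \<otimes>\<^bsub>A\<^esub> bracket A b x) \<oplus>\<^bsub>A\<^esub> (a \<otimes>\<^bsub>A\<^esub> bracket A b x) =
      bracket A (a \<otimes>\<^bsub>A\<^esub> b) x \<oplus>\<^bsub>A\<^esub> bracket A b (a \<otimes>\<^bsub>A\<^esub> x)" if x: "x \<in> carrier A" for x
    using transposed_leibniz[of a b x] a b x by (simp add: A.add_pow_two)
  have "E (\<lambda>x. a \<otimes>\<^bsub>A\<^esub> x) (E (bracket A b) X) \<oplus>\<^bsub>I.T\<^esub> E (\<lambda>x. a \<otimes>\<^bsub>A\<^esub> x) (E (bracket A b) X) =
      E (bracket A (a \<otimes>\<^bsub>A\<^esub> b)) X \<oplus>\<^bsub>I.T\<^esub> E (bracket A b) (E (\<lambda>x. a \<otimes>\<^bsub>A\<^esub> x) X)"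
    using X
  proof (induction rule: Ind_induct)
    case (pure x n)
    then show ?case using a b ab
      by (simp add: E t_add_left[symmetric] leib2 del: N_fields)
  next
    case (add X Y)
    let ?f = "\<lambda>X. E (\<lambda>x. a \<otimes>\<^bsub>A\<^esub> x) (E (bracket A b) X)"
    have "?f (X \<oplus>\<^bsub>I.T\<^esub> Y) \<oplus>\<^bsub>I.T\<^esub> ?f (X \<oplus>\<^bsub>I.T\<^esub> Y) = (?f X \<oplus>\<^bsub>I.T\<^esub> ?f X) \<oplus>\<^bsub>I.T\<^esub> (?f Y \<oplus>\<^bsub>I.T\<^esub> ?f Y)"
      using add(1,2) a b by (simp add: E I.a_ac)
    then show ?case using add a b ab by (simp add: E I.a_ac)
  qed
  then show "[(2::nat)] \<cdot>\<^bsub>Ind\<^esub> act Ind a (lie_act Ind b X) =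
      lie_act Ind (a \<otimes>\<^bsub>A\<^esub> b) X \<oplus>\<^bsub>Ind\<^esub> lie_act Ind b (act Ind a X)"
    using X a b by (simp add: two E)
qed (rule tp_algebra Ind_module)+

end

context tp_hopf_module
begin

sublocale JH: module_pair K Ind H
  by (rule module_pair.intro[OF Ind_module MM.module_H])

lemma t_linear:
  assumes n: "n \<in> carrier N"
  shows "(\<lambda>a. I.t a n) \<in> linear_maps K A Ind"
  by (rule linear_mapsI) (use n in \<open>simp_all add: t_closed t_add_left E_pure E_intros del: N_fields\<close>)

lemma t_lin: "\<lbrakk>g \<in> linear_maps K Q A; n \<in> carrier N\<rbrakk> \<Longrightarrow> (\<lambda>x. I.t (g x) n) \<in> linear_maps K Q Ind"
  by (rule linear_comp[OF t_linear])

lemmas th_lin = bilinear_left[OF JH.pure_bilinear] bilinear_right[OF JH.pure_bilinear]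

lemma t_Ind: "\<lbrakk>a \<in> carrier A; n \<in> carrier N\<rbrakk> \<Longrightarrow> I.t a n \<in> carrier Ind"
  by (simp add: t_closed)

lemma coact_t_bilinear:
  "n \<in> carrier N \<Longrightarrow> (\<lambda>x h. th (I.t x n) h) \<in> bilinear_maps K A H IH"
  by (intro bilinear_mapsI th_lin t_lin linear_id t_Ind)

text \<open>
  The coaction of \<open>A \<otimes>\<^sub>B N\<close> is well defined, as \<open>\<rho>(ba) = ba\<^sub>0 \<otimes> a\<^sub>1\<close> for the coinvariant elements
  \<open>b \<in> B\<close>.
\<close>

lemma coact_balanced:
  "balanced_map B A\<^sub>B N IH (\<lambda>a n. tensor_lift IH (\<lambda>x h. th (I.t x n) h) (coact A a))"
proof (rule balanced_map.intro)
  note IHm = JH.tensor_module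
  note lin = MM.A.sw_lin[OF IHm coact_t_bilinear linear_id]
  fix a n assume a: "a \<in> carrier A\<^sub>B" and n: "n \<in> carrier N"
  then have a': "a \<in> carrier A" by simp
  show "tensor_lift IH (\<lambda>x h. th (I.t x n) h) (coact A a) \<in> carrier IH"
    by (rule linear_mapsD(1)[OF lin[OF n] a'])
  fix b assume b: "b \<in> carrier B"
  note bA = B_closed[OF b]
  have "coact A (b \<otimes>\<^bsub>A\<^esub> a) = coact A (a \<otimes>\<^bsub>A\<^esub> b)" using a' bA by (simp add: A.m_comm)
  also have "\<dots> = tensor_lift MM.A.MH.T (\<lambda>x h. MM.A.MH.t (x \<otimes>\<^bsub>A\<^esub> b) h) (coact A a)"
    by (rule AA.rho_dot_coinvariant[OF a' bA B_coact[OF b]])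
  finally have "tensor_lift IH (\<lambda>x h. th (I.t x n) h) (coact A (b \<odot>\<^bsub>A\<^sub>B\<^esub> a)) =
    tensor_lift IH (\<lambda>x h. th (I.t x n) h) (tensor_lift MM.A.MH.T (\<lambda>x h. MM.A.MH.t (x \<otimes>\<^bsub>A\<^esub> b) h) (coact A a))"
    by simp
  also have "\<dots> = tensor_lift IH (\<lambda>y k. tensor_lift IH (\<lambda>x h. th (I.t x n) h) (MM.A.MH.t (y \<otimes>\<^bsub>A\<^esub> b) k)) (coact A a)"
    by (rule MM.A.MH.lift_lift[OF IHm coact_t_bilinear[OF n] MM.A.MH.tensor_factors_axioms])
      (use a' bA in \<open>simp_all add: MM.A.MH.pure_closed\<close>)
  also have "\<dots> = tensor_lift IH (\<lambda>x h. th (I.t x (b \<odot>\<^bsub>N\<^esub> n)) h) (coact A a)"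
  proof (rule MM.A.sw_cong[OF a'])
    fix y k assume y: "y \<in> carrier A" and k: "k \<in> carrier H"
    have "I.t (b \<otimes>\<^bsub>A\<^esub> y) n = I.t y (b \<odot>\<^bsub>N\<^esub> n)"
      using I.pure_balanced[OF b _ n, of y] y by simp
    then show "tensor_lift IH (\<lambda>x h. th (I.t x n) h) (MM.A.MH.t (y \<otimes>\<^bsub>A\<^esub> b) k) = th (I.t y (b \<odot>\<^bsub>N\<^esub> n)) k"
      using y k bA by (simp add: MM.A.MH.lift_pure[OF IHm coact_t_bilinear[OF n]] A.m_comm)
  qed
  finally show "tensor_lift IH (\<lambda>x h. th (I.t x n) h) (coact A (b \<odot>\<^bsub>A\<^sub>B\<^esub> a)) =
    tensor_lift IH (\<lambda>x h. th (I.t x (b \<odot>\<^bsub>N\<^esub> n)) h) (coact A a)" .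
next
  note lin = MM.A.sw_lin[OF JH.tensor_module coact_t_bilinear linear_id]
  fix a a' n assume "a \<in> carrier A\<^sub>B" "a' \<in> carrier A\<^sub>B" "n \<in> carrier N"
  then show "tensor_lift IH (\<lambda>x h. th (I.t x n) h) (coact A (a \<oplus>\<^bsub>A\<^sub>B\<^esub> a')) =
    tensor_lift IH (\<lambda>x h. th (I.t x n) h) (coact A a) \<oplus>\<^bsub>IH\<^esub> tensor_lift IH (\<lambda>x h. th (I.t x n) h) (coact A a')"
    using linear_mapsD(2)[OF lin, of n a a'] by simp
next
  fix a n n' assume a: "a \<in> carrier A\<^sub>B" and n: "n \<in> carrier N" "n' \<in> carrier N"
  then have a': "a \<in> carrier A" by simp
  have "tensor_lift IH (\<lambda>x h. th (I.t x (n \<oplus>\<^bsub>N\<^esub> n')) h) (coact A a) =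
    tensor_lift IH (\<lambda>x h. th (I.t x n) h \<oplus>\<^bsub>IH\<^esub> th (I.t x n') h) (coact A a)"
  proof (rule MM.A.sw_cong[OF a'])
    fix x h assume "x \<in> carrier A" "h \<in> carrier H"
    then show "th (I.t x (n \<oplus>\<^bsub>N\<^esub> n')) h = th (I.t x n) h \<oplus>\<^bsub>IH\<^esub> th (I.t x n') h"
      using I.pure_add_right[of x n n'] n JH.pure_add_left[of "I.t x n" "I.t x n'" h] t_Ind by simp
  qed
  also have "\<dots> = tensor_lift IH (\<lambda>x h. th (I.t x n) h) (coact A a) \<oplus>\<^bsub>IH\<^esub>
      tensor_lift IH (\<lambda>x h. th (I.t x n') h) (coact A a)"
    by (rule MM.A.MH.lift_add_fun)
      (use a' n t_Ind in \<open>simp_all add: JH.tensor_abelian_group JH.pure_closed del: N_fields Ind_fields\<close>)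
  finally show "tensor_lift IH (\<lambda>x h. th (I.t x (n \<oplus>\<^bsub>N\<^esub> n')) h) (coact A a) = \<dots>" .
qed (rule JH.tensor_abelian_group I.M_group I.N_group I.smult_M I.smult_N; assumption)+

lemma mcoact_t: "\<lbrakk>a \<in> carrier A; n \<in> carrier N\<rbrakk>
    \<Longrightarrow> mcoact Ind (I.t a n) = tensor_lift IH (\<lambda>x h. th (I.t x n) h) (coact A a)"
  unfolding mcoact_Ind by (rule balanced_map.tensor_lift_pure[OF coact_balanced]) simp_all

lemma mcoact_linear: "mcoact Ind \<in> linear_maps K Ind IH"
proof (rule linear_mapsI)
  show localadd: "mcoact Ind (X \<oplus>\<^bsub>Ind\<^esub> Y) = mcoact Ind X \<oplus>\<^bsub>IH\<^esub> mcoact Ind Y"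
    if "X \<in> carrier Ind" "Y \<in> carrier Ind" for X Y
    using that balanced_map.tensor_lift_add[OF coact_balanced, of X Y] unfolding mcoact_Ind by simp
  show closed: "mcoact Ind X \<in> carrier IH" if "X \<in> carrier Ind" for X
  proof -
    have "X \<in> carrier I.T" using that by simp
    then show ?thesis
      unfolding mcoact_Ind
      by (rule I.lift_closed[OF JH.tensor_abelian_group]) (rule balanced_map.closed[OF coact_balanced])
  qed
  fix c X assume c: "c \<in> carrier K" and "X \<in> carrier Ind"
  then have "X \<in> carrier I.T" by simp
  then show "mcoact Ind (c \<odot>\<^bsub>Ind\<^esub> X) = c \<odot>\<^bsub>IH\<^esub> mcoact Ind X"
  proof (induction rule: Ind_induct)
    case (pure a n)
    then show ?case
      using c linear_mapsD(3)[OF MM.A.sw_lin[OF JH.tensor_module coact_t_bilinear[OF pure(2)] linear_id] c pure(1)]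
      by (simp add: E_pure E_intros mcoact_t del: N_fields)
  next
    case (add X Y)
    have XY: "X \<in> carrier Ind" "Y \<in> carrier Ind" using add by simp_all
    have "c \<odot>\<^bsub>Ind\<^esub> (X \<oplus>\<^bsub>I.T\<^esub> Y) = c \<odot>\<^bsub>Ind\<^esub> X \<oplus>\<^bsub>Ind\<^esub> c \<odot>\<^bsub>Ind\<^esub> Y"
      using module.smult_r_distr[OF Ind_module c XY] by simp
    moreover have "c \<odot>\<^bsub>Ind\<^esub> X \<in> carrier Ind" "c \<odot>\<^bsub>Ind\<^esub> Y \<in> carrier Ind"
      using module.smult_closed[OF Ind_module c] XY by blast+
    ultimately have "mcoact Ind (c \<odot>\<^bsub>Ind\<^esub> (X \<oplus>\<^bsub>I.T\<^esub> Y)) = c \<odot>\<^bsub>IH\<^esub> mcoact Ind X \<oplus>\<^bsub>IH\<^esub> c \<odot>\<^bsub>IH\<^esub> mcoact Ind Y"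
      using localadd add(3,4) by simp
    also have "\<dots> = c \<odot>\<^bsub>IH\<^esub> (mcoact Ind X \<oplus>\<^bsub>IH\<^esub> mcoact Ind Y)"
      using c closed XY by (intro JH.smult_add[symmetric])
    also have "\<dots> = c \<odot>\<^bsub>IH\<^esub> mcoact Ind (X \<oplus>\<^bsub>I.T\<^esub> Y)"
      using localadd[OF XY] by simp
    finally show ?case .
  qed
qed

lemma sw_mcoact_t:
  assumes P: "module K P" and f: "f \<in> bilinear_maps K Ind H P"
    and a: "a \<in> carrier A" and n: "n \<in> carrier N"
  shows "tensor_lift P f (mcoact Ind (I.t a n)) = tensor_lift P (\<lambda>x h. f (I.t x n) h) (coact A a)"
proof -
  have "tensor_lift P f (mcoact Ind (I.t a n)) =
      tensor_lift P (\<lambda>x h. tensor_lift P f (th (I.t x n) h)) (coact A a)"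
    unfolding mcoact_t[OF a n]
    by (rule JH.lift_lift[OF P f MM.A.MH.tensor_factors_axioms])
      (use a n t_Ind in \<open>simp_all add: JH.pure_closed del: N_fields Ind_fields\<close>)
  also have "\<dots> = tensor_lift P (\<lambda>x h. f (I.t x n) h) (coact A a)"
    by (rule MM.A.sw_cong[OF a]) (simp add: JH.lift_pure[OF P f] t_Ind n del: N_fields Ind_fields)
  finally show ?thesis .
qed

lemma sw_mcoact_lin: "\<lbrakk>module K P; f \<in> bilinear_maps K Ind H P\<rbrakk>
    \<Longrightarrow> (\<lambda>X. tensor_lift P f (mcoact Ind X)) \<in> linear_maps K Ind P"
  by (rule linear_comp[OF JH.lift_linear mcoact_linear])

lemma Ind_eqI:
  assumes "f \<in> linear_maps K Ind P" "g \<in> linear_maps K Ind P"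
    and "\<And>a n. \<lbrakk>a \<in> carrier A; n \<in> carrier N\<rbrakk> \<Longrightarrow> f (I.t a n) = g (I.t a n)"
    and "X \<in> carrier Ind"
  shows "f X = g X"
proof -
  have "X \<in> carrier I.T" using assms(4) by simp
  then show ?thesis
    by (induction rule: Ind_induct)
      (use assms(3) linear_mapsD(2)[OF assms(1)] linear_mapsD(2)[OF assms(2)] in simp_all)
qed

lemma Ind_comodule: "right_comodule K H Ind (mcoact Ind)"
proof (rule right_comodule.intro)
  interpret JHH: module_pair K Ind "tensor K H H"
    by (rule module_pair.intro[OF Ind_module MM.HH.tensor_module])
  have comult: "comult H h \<in> carrier (tensor K H H)" if "h \<in> carrier H" for h
    using that by (rule linear_mapsD[OF MM.comult_linear])
  have TT: "module K JHH.T" by (rule JHH.tensor_module)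
  note JHH_lin = bilinear_left[OF JHH.pure_bilinear] bilinear_right[OF JHH.pure_bilinear]
  note HH_lin = bilinear_left[OF MM.HH.pure_bilinear] bilinear_right[OF MM.HH.pure_bilinear]
  have b1: "(\<lambda>x h. JHH.t x (comult H h)) \<in> bilinear_maps K Ind H JHH.T"
    by (intro bilinear_mapsI JHH_lin linear_id MM.comult_linear comult)
  have b2: "(\<lambda>x' h'. JHH.t x' (MM.HH.t h' h)) \<in> bilinear_maps K Ind H JHH.T" if "h \<in> carrier H" for h
    using that by (intro bilinear_mapsI JHH_lin HH_lin linear_id MM.HH.pure_closed)
  have b3: "(\<lambda>x h. tensor_lift JHH.T (\<lambda>x' h'. JHH.t x' (MM.HH.t h' h)) (mcoact Ind x)) \<in> bilinear_maps K Ind H JHH.T"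
  proof (rule bilinear_mapsI)
    fix x assume x: "x \<in> carrier Ind"
    show "(\<lambda>h. tensor_lift JHH.T (\<lambda>x' h'. JHH.t x' (MM.HH.t h' h)) (mcoact Ind x)) \<in> linear_maps K H JHH.T"
      by (intro JH.lift_param_linear TT MM.module_H linear_mapsD(1)[OF mcoact_linear x] JHH_lin HH_lin linear_id)
  qed (intro sw_mcoact_lin TT b2)
  fix X assume X: "X \<in> carrier Ind"
  show "tensor_lift JHH.T (\<lambda>x h. JHH.t x (comult H h)) (mcoact Ind X) =
    tensor_lift JHH.T (\<lambda>x h. tensor_lift JHH.T (\<lambda>x' h'. JHH.t x' (MM.HH.t h' h)) (mcoact Ind x)) (mcoact Ind X)"
  proof (rule Ind_eqI[OF sw_mcoact_lin[OF TT b1] sw_mcoact_lin[OF TT b3] _ X])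
    fix a n assume a: "a \<in> carrier A" and n: "n \<in> carrier N"
    have "tensor_lift JHH.T (\<lambda>x h. JHH.t x (comult H h)) (mcoact Ind (I.t a n)) =
        tensor_lift JHH.T (\<lambda>x h. JHH.t (I.t x n) (comult H h)) (coact A a)"
      by (rule sw_mcoact_t[OF TT b1 a n])
    also have "\<dots> = tensor_lift JHH.T (\<lambda>x h. tensor_lift JHH.T (\<lambda>h' h''. JHH.t (I.t x n) (MM.HH.t h' h'')) (comult H h)) (coact A a)"
    proof (rule MM.A.sw_cong[OF a])
      fix x h assume x: "x \<in> carrier A" and h: "h \<in> carrier H"
      have "JHH.t (I.t x n) (comult H h) = JHH.t (I.t x n) (tensor_lift MM.HH.T MM.HH.t (comult H h))"
        by (simp add: MM.HH.lift_pure_self comult h)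
      also have "\<dots> = tensor_lift JHH.T (\<lambda>h' h''. JHH.t (I.t x n) (MM.HH.t h' h'')) (comult H h)"
        by (rule MM.HC.sw_image[OF _ MM.HH.tensor_module TT h])
          (intro JHH_lin linear_id t_Ind x n MM.HH.pure_closed; assumption)+
      finally show "JHH.t (I.t x n) (comult H h) = \<dots>" .
    qed
    also have "\<dots> = tensor_lift JHH.T (\<lambda>x h. tensor_lift JHH.T (\<lambda>x' h'. JHH.t (I.t x' n) (MM.HH.t h' h)) (coact A x)) (coact A a)"
      by (rule MM.A.sw_coassoc[OF TT a]) (intro JHH_lin HH_lin t_lin linear_id t_Ind n MM.HH.pure_closed; assumption)+
    also have "\<dots> = tensor_lift JHH.T (\<lambda>x h. tensor_lift JHH.T (\<lambda>x' h'. JHH.t x' (MM.HH.t h' h)) (mcoact Ind (I.t x n))) (coact A a)"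
      by (intro MM.A.sw_cong[OF a] sw_mcoact_t[symmetric, OF TT b2 _ n])
    also have "\<dots> = tensor_lift JHH.T (\<lambda>x h. tensor_lift JHH.T (\<lambda>x' h'. JHH.t x' (MM.HH.t h' h)) (mcoact Ind x)) (mcoact Ind (I.t a n))"
      by (rule sw_mcoact_t[symmetric, OF TT b3 a n])
    finally show "tensor_lift JHH.T (\<lambda>x h. JHH.t x (comult H h)) (mcoact Ind (I.t a n)) = \<dots>" .
  qed
  have b4: "(\<lambda>x h. counit H h \<odot>\<^bsub>Ind\<^esub> x) \<in> bilinear_maps K Ind H Ind"
    by (intro bilinear_mapsI MM.counit_lin_left MM.counit_lin_right Ind_module linear_id)
  show "tensor_lift Ind (\<lambda>x h. counit H h \<odot>\<^bsub>Ind\<^esub> x) (mcoact Ind X) = X"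
  proof (rule Ind_eqI[OF sw_mcoact_lin[OF Ind_module b4] linear_id _ X])
    fix a n assume a: "a \<in> carrier A" and n: "n \<in> carrier N"
    show "tensor_lift Ind (\<lambda>x h. counit H h \<odot>\<^bsub>Ind\<^esub> x) (mcoact Ind (I.t a n)) = I.t a n"
      unfolding sw_mcoact_t[OF Ind_module b4 a n]
      by (rule MM.A.sw_counit[OF Ind_module t_linear[OF n] a])
  qed
qed (rule MM.hopf_algebra_axioms Ind_module mcoact_linear)+

text \<open>
  A bilinear operation on \<open>A\<close> that is compatible with the coaction induces one on \<open>A \<otimes>\<^sub>B N\<close> with the
  same compatibility.  It is applied to the multiplication and to the bracket.
\<close>

lemma mcoact_E:
  assumes f: "f \<in> bilinear_maps K A A A" and B: "\<And>a. a \<in> carrier A \<Longrightarrow> B_linear (f a)"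
    and coact: "\<And>a a'. \<lbrakk>a \<in> carrier A; a' \<in> carrier A\<rbrakk> \<Longrightarrow> coact A (f a a') =
      tensor_lift (tensor K A H) (\<lambda>x h. tensor_lift (tensor K A H) (\<lambda>x' h'.
        pure_tensor K A H (f x x') (h \<otimes>\<^bsub>H\<^esub> h')) (coact A a')) (coact A a)"
    and a: "a \<in> carrier A" and X: "X \<in> carrier Ind"
  shows "mcoact Ind (E (f a) X) = tensor_lift IH (\<lambda>x h.
    tensor_lift IH (\<lambda>y h'. th (E (f x) y) (h \<otimes>\<^bsub>H\<^esub> h')) (mcoact Ind X)) (coact A a)"
proof -
  note IHm = JH.tensor_module
  note Eb = E_bilinear[OF f B]
  have b: "(\<lambda>y h'. th (E (f x) y) (h \<otimes>\<^bsub>H\<^esub> h')) \<in> bilinear_maps K Ind H IH"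
    if "x \<in> carrier A" "h \<in> carrier H" for x h
    using that by (intro bilinear_mapsI th_lin bilinear_closed[OF Eb] MM.H.m_closed MM.mult_lin linear_id
        bilinear_mapsD(1)[OF Eb])
  have l1: "(\<lambda>X. mcoact Ind (E (f a) X)) \<in> linear_maps K Ind IH"
    by (rule linear_comp[OF mcoact_linear E_linear[OF B[OF a]]])
  have l2: "(\<lambda>X. tensor_lift IH (\<lambda>x h. tensor_lift IH (\<lambda>y h'. th (E (f x) y) (h \<otimes>\<^bsub>H\<^esub> h')) (mcoact Ind X)) (coact A a))
      \<in> linear_maps K Ind IH"
    by (intro MM.A.sw_param_lin Ind_module IHm a sw_mcoact_lin b)
  show ?thesis
  proof (rule Ind_eqI[OF l1 l2 _ X])
    fix a' n assume a': "a' \<in> carrier A" and n: "n \<in> carrier N"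
    note ct = coact_t_bilinear[OF n]
    let ?g = "\<lambda>x h. th (I.t x n) h"
    have "mcoact Ind (E (f a) (I.t a' n)) = tensor_lift IH ?g (coact A (f a a'))"
      using B a a' n f by (simp add: E_pure mcoact_t bilinear_closed[OF f] del: N_fields)
    also have "\<dots> = tensor_lift IH (\<lambda>x h. tensor_lift IH ?g (tensor_lift (tensor K A H) (\<lambda>x' h'.
        pure_tensor K A H (f x x') (h \<otimes>\<^bsub>H\<^esub> h')) (coact A a'))) (coact A a)"
      unfolding coact[OF a a']
      by (rule MM.A.MH.lift_lift[OF IHm ct MM.A.MH.tensor_factors_axioms])
        (use a a' in \<open>simp_all add: MM.A.sw_closed AA.module_MH MM.A.MH.pure_closed bilinear_closed[OF f]\<close>)
    also have "\<dots> = tensor_lift IH (\<lambda>x h.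
      tensor_lift IH (\<lambda>y h'. th (E (f x) y) (h \<otimes>\<^bsub>H\<^esub> h')) (mcoact Ind (I.t a' n))) (coact A a)"
    proof (rule MM.A.sw_cong[OF a])
      fix x h assume x: "x \<in> carrier A" and h: "h \<in> carrier H"
      have "tensor_lift IH ?g (tensor_lift (tensor K A H) (\<lambda>x' h'.
          pure_tensor K A H (f x x') (h \<otimes>\<^bsub>H\<^esub> h')) (coact A a')) =
        tensor_lift IH (\<lambda>x' h'. tensor_lift IH ?g (pure_tensor K A H (f x x') (h \<otimes>\<^bsub>H\<^esub> h'))) (coact A a')"
        by (rule MM.A.MH.lift_lift[OF IHm ct MM.A.MH.tensor_factors_axioms])
          (use x h a' in \<open>simp_all add: MM.A.MH.pure_closed bilinear_closed[OF f]\<close>)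
      also have "\<dots> = tensor_lift IH (\<lambda>y h'. th (E (f x) (I.t y n)) (h \<otimes>\<^bsub>H\<^esub> h')) (coact A a')"
        by (rule MM.A.sw_cong[OF a'])
          (simp add: MM.A.MH.lift_pure[OF IHm ct] bilinear_closed[OF f] x h E_pure B n del: N_fields)
      also have "\<dots> = tensor_lift IH (\<lambda>y h'. th (E (f x) y) (h \<otimes>\<^bsub>H\<^esub> h')) (mcoact Ind (I.t a' n))"
        by (rule sw_mcoact_t[symmetric, OF IHm b[OF x h] a' n])
      finally show "tensor_lift IH ?g (tensor_lift (tensor K A H) (\<lambda>x' h'.
          pure_tensor K A H (f x x') (h \<otimes>\<^bsub>H\<^esub> h')) (coact A a')) = \<dots>" .
    qed
    finally show "mcoact Ind (E (f a) (I.t a' n)) = \<dots>" .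
  qed
qed

theorem induced_is_hopf_module: "tp_hopf_module K H A Ind"
proof (rule tp_hopf_module.intro)
  fix a X assume a: "a \<in> carrier A" and X: "X \<in> carrier Ind"
  show "mcoact Ind (act Ind a X) = tensor_lift IH (\<lambda>x h.
    tensor_lift IH (\<lambda>y h'. th (act Ind x y) (h \<otimes>\<^bsub>H\<^esub> h')) (mcoact Ind X)) (coact A a)"
    using mcoact_E[OF mult_bilinear mult_B_linear coact_mult a X] unfolding Ind_fields .
  show "mcoact Ind (lie_act Ind a X) = tensor_lift IH (\<lambda>x h.
    tensor_lift IH (\<lambda>y h'. th (lie_act Ind x y) (h \<otimes>\<^bsub>H\<^esub> h')) (mcoact Ind X)) (coact A a)"
    using mcoact_E[OF bracket_bilinear bracket_B_linear comodule_tp_algebra.coact_bracket[OF comodule_tp_algebra] a X]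
    unfolding Ind_fields .
qed (rule comodule_tp_algebra Ind_tp_module Ind_comodule)+

end

context tp_hopf_module
begin

section \<open>The map \<open>\<alpha>\<close>\<close>

lemma act_balanced: "balanced_map B A\<^sub>B N M (act M)"
proof (rule balanced_map.intro)
  fix b a n assume "b \<in> carrier B" "a \<in> carrier A\<^sub>B" and n: "n \<in> carrier N"
  then show "act M (b \<odot>\<^bsub>A\<^sub>B\<^esub> a) n = act M a (b \<odot>\<^bsub>N\<^esub> n)"
    using act_assoc[of a b n] B_closed N_closed[OF n] by (simp add: A.m_comm)
next
  fix a a' n assume "a \<in> carrier A\<^sub>B" "a' \<in> carrier A\<^sub>B" "n \<in> carrier N"
  then show "act M (a \<oplus>\<^bsub>A\<^sub>B\<^esub> a') n = act M a n \<oplus>\<^bsub>M\<^esub> act M a' n"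
    using N_closed by (simp add: act_add_left del: N_fields)
next
  fix a n n' assume "a \<in> carrier A\<^sub>B" "n \<in> carrier N" "n' \<in> carrier N"
  then show "act M a (n \<oplus>\<^bsub>N\<^esub> n') = act M a n \<oplus>\<^bsub>M\<^esub> act M a n'"
    using N_closed by (simp add: act_add_right del: N_fields(1))
next
  fix a n assume "a \<in> carrier A\<^sub>B" "n \<in> carrier N"
  then show "act M a n \<in> carrier M"
    using N_closed by (simp del: N_fields)
qed (rule M.abelian_group_axioms I.M_group I.N_group I.smult_M I.smult_N; assumption)+

lemma induced_map_t:
  "\<lbrakk>a \<in> carrier A; n \<in> carrier N\<rbrakk> \<Longrightarrow> induced_map M (I.t a n) = act M a n"
  unfolding induced_map_def by (rule balanced_map.tensor_lift_pure[OF act_balanced]) simp_all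

lemma induced_map_linear: "induced_map M \<in> linear_maps K Ind M"
proof (rule linear_mapsI)
  show closed: "induced_map M X \<in> carrier M" if "X \<in> carrier Ind" for X
  proof -
    have "X \<in> carrier I.T" using that by simp
    then show ?thesis
      unfolding induced_map_def
      by (rule I.lift_closed[OF M.abelian_group_axioms]) (rule balanced_map.closed[OF act_balanced])
  qed
  show sum: "induced_map M (X \<oplus>\<^bsub>Ind\<^esub> Y) = induced_map M X \<oplus>\<^bsub>M\<^esub> induced_map M Y"
    if "X \<in> carrier Ind" "Y \<in> carrier Ind" for X Y
    using that balanced_map.tensor_lift_add[OF act_balanced, of X Y] unfolding induced_map_def by simp
  fix c X assume c: "c \<in> carrier K" and "X \<in> carrier Ind"
  then have "X \<in> carrier I.T" by simp
  then show "induced_map M (c \<odot>\<^bsub>Ind\<^esub> X) = c \<odot>\<^bsub>M\<^esub> induced_map M X"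
  proof (induction rule: Ind_induct)
    case (pure a n)
    then show ?case
      using c linear_mapsD(3)[OF bilinear_mapsD(2)[OF act_bilinear N_closed[OF pure(2)]] c pure(1)]
      by (simp add: E_pure E_intros induced_map_t del: N_fields)
  next
    case (add X Y)
    have XY: "X \<in> carrier Ind" "Y \<in> carrier Ind" using add by simp_all
    have "c \<odot>\<^bsub>Ind\<^esub> X \<in> carrier Ind" "c \<odot>\<^bsub>Ind\<^esub> Y \<in> carrier Ind"
      using module.smult_closed[OF Ind_module c] XY by blast+
    then have "induced_map M (c \<odot>\<^bsub>Ind\<^esub> (X \<oplus>\<^bsub>Ind\<^esub> Y)) = c \<odot>\<^bsub>M\<^esub> induced_map M X \<oplus>\<^bsub>M\<^esub> c \<odot>\<^bsub>M\<^esub> induced_map M Y"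
      using add(3,4) unfolding module.smult_r_distr[OF Ind_module c XY] by (simp only: sum)
    then show ?case
      using sum[OF XY] closed XY c by (simp add: M.smult_r_distr)
  qed
qed

lemma induced_map_hom: "induced_map M \<in> tp_hopf_homs K H A Ind M"
proof -
  note il = induced_map_linear
  have act: "induced_map M (act Ind a X) = act M a (induced_map M X)"
    if a: "a \<in> carrier A" and X: "X \<in> carrier Ind" for a X
    unfolding Ind_fields
    by (rule Ind_eqI[OF linear_comp[OF il E_linear[OF mult_B_linear[OF a]]]
          linear_comp[OF bilinear_mapsD(1)[OF act_bilinear a] il] _ X])
      (use a N_closed in \<open>simp add: E_pure E_intros induced_map_t act_assoc del: N_fields\<close>)
  have lie: "induced_map M (lie_act Ind a X) = lie_act M a (induced_map M X)"
    if a: "a \<in> carrier A" and X: "X \<in> carrier Ind" for a X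
    unfolding Ind_fields
    by (rule Ind_eqI[OF linear_comp[OF il E_linear[OF bracket_B_linear[OF a]]]
          linear_comp[OF bilinear_mapsD(1)[OF lie_act_bilinear a] il] _ X])
      (use a N_closed in \<open>simp add: E_pure E_intros induced_map_t N_lie del: N_fields\<close>)
  have b: "(\<lambda>x h. MM.tt (induced_map M x) h) \<in> bilinear_maps K Ind H MM.MH"
    by (intro bilinear_mapsI MM.pure_lin il linear_id linear_mapsD(1)[OF il])
  have colin: "mcoact M (induced_map M X) = tensor_lift MM.MH (\<lambda>x h. MM.tt (induced_map M x) h) (mcoact Ind X)"
    if X: "X \<in> carrier Ind" for X
  proof (rule Ind_eqI[OF linear_comp[OF MM.M.coaction_linear il] sw_mcoact_lin[OF MM.module_MH b] _ X])
    fix a n assume a: "a \<in> carrier A" and n: "n \<in> carrier N"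
    have "mcoact M (induced_map M (I.t a n)) = tensor_lift MM.MH (\<lambda>x h. MM.tt (act M x n) h) (coact A a)"
      using MM.rho_dot_coinvariant[OF a N_closed[OF n] N_coact[OF n]] by (simp only: induced_map_t a n)
    also have "\<dots> = tensor_lift MM.MH (\<lambda>x h. MM.tt (induced_map M (I.t x n)) h) (coact A a)"
      by (rule MM.A.sw_cong[OF a]) (simp only: induced_map_t n)
    also have "\<dots> = tensor_lift MM.MH (\<lambda>x h. MM.tt (induced_map M x) h) (mcoact Ind (I.t a n))"
      by (rule sw_mcoact_t[OF MM.module_MH b a n, symmetric])
    finally show "mcoact M (induced_map M (I.t a n)) = \<dots>" .
  qed
  show ?thesis
    using il act lie colin by (simp only: tp_hopf_homs_def colinear_maps_def mem_Collect_eq) blast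
qed

text \<open>
  Scalars of the base ring lie in \<open>B\<close>, so they may be moved across \<open>\<otimes>\<^sub>B\<close>; hence \<open>\<beta>\<close> below is linear.
\<close>

lemma scalar_in_B: "c \<in> carrier K \<Longrightarrow> c \<odot>\<^bsub>A\<^esub> \<one>\<^bsub>A\<^esub> \<in> carrier B"
  using linear_mapsD(3)[OF MM.A.coaction_linear, of c "\<one>\<^bsub>A\<^esub>"]
    linear_mapsD(3)[OF bilinear_mapsD(2)[OF bracket_bilinear]]
  by (simp add: B_carrier tp_center_def coinvariants_def A.smult_assoc2 coact_one MM.A.MH.smult_pure)

lemma t_smult_right:
  assumes "c \<in> carrier K" "a \<in> carrier A" "n \<in> carrier N"
  shows "I.t a (c \<odot>\<^bsub>M\<^esub> n) = c \<odot>\<^bsub>Ind\<^esub> I.t a n"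
proof -
  have n: "n \<in> carrier M" by (rule N_closed[OF assms(3)])
  have "act M (c \<odot>\<^bsub>A\<^esub> \<one>\<^bsub>A\<^esub>) n = c \<odot>\<^bsub>M\<^esub> n"
    using assms n linear_mapsD(3)[OF bilinear_mapsD(2)[OF act_bilinear n], of c "\<one>\<^bsub>A\<^esub>"] by (simp add: act_one)
  then show ?thesis
    using I.pure_balanced[OF scalar_in_B[OF assms(1)] _ assms(3), of a] assms
    by (simp add: A.smult_assoc2 E_pure E_intros del: N_fields(1))
qed

end

section \<open>The inverse of \<open>\<alpha>\<close>\<close>

text \<open>The hypotheses on \<open>\<phi>\<close>, gathered in one context.\<close>

locale tp_hopf_section = tp_hopf_module K H A M
  for K :: "('k, 'x) ring_scheme" and H :: "('k, 'h, 'y) hopf_algebra_scheme"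
    and A :: "('k, 'a, 'h, 'z) comodule_tp_algebra_scheme"
    and M :: "('k, 'a, 'm, 'h, 'w) tp_hopf_module_scheme" +
  fixes \<phi> :: "'h \<Rightarrow> 'a"
  assumes bij: "bijective_antipode H"
    and phi_mult: "\<lbrakk>h \<in> carrier H; k \<in> carrier H\<rbrakk> \<Longrightarrow> \<phi> (h \<otimes>\<^bsub>H\<^esub> k) = \<phi> h \<otimes>\<^bsub>A\<^esub> \<phi> k"
    and phi_one: "\<phi> \<one>\<^bsub>H\<^esub> = \<one>\<^bsub>A\<^esub>"
    and phi_colinear: "\<phi> \<in> colinear_maps K H H (comult H) A (coact A)"
    and cond_M: "\<And>a a' m. \<lbrakk>a \<in> carrier A; a' \<in> carrier A; m \<in> carrier M\<rbrakk> \<Longrightarrow>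
      act M (bracket A \<one>\<^bsub>A\<^esub> (a \<otimes>\<^bsub>A\<^esub> a')) (proj_M H \<phi> M m) =
        tensor_lift M (\<lambda>x h. lie_act M (\<phi> h) (act M a (proj_M H \<phi> M (act M x m)))) (coact A a')"
    and cond_A: "\<And>a a' a''. \<lbrakk>a \<in> carrier A; a' \<in> carrier A; a'' \<in> carrier A\<rbrakk> \<Longrightarrow>
      bracket A \<one>\<^bsub>A\<^esub> (a \<otimes>\<^bsub>A\<^esub> a') \<otimes>\<^bsub>A\<^esub> proj_A H \<phi> A a'' =
        tensor_lift A (\<lambda>x h. bracket A (\<phi> h) (a \<otimes>\<^bsub>A\<^esub> proj_A H \<phi> A (x \<otimes>\<^bsub>A\<^esub> a''))) (coact A a')"
begin

sublocale CM: cleft_hopf_module K H A "coact A" M "mcoact M" "act M" \<phi>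
  by (intro cleft_hopf_module.intro cleft_hopf_module_axioms.intro hopf_algebra_bij.intro
      hopf_algebra_bij_axioms.intro MM.relative_hopf_module_axioms MM.hopf_algebra_axioms
      bij phi_mult phi_one phi_colinear)

sublocale CA: cleft_hopf_module K H A "coact A" A "coact A" "mult A" \<phi>
  by (intro cleft_hopf_module.intro cleft_hopf_module_axioms.intro hopf_algebra_bij.intro
      hopf_algebra_bij_axioms.intro AA.relative_hopf_module_axioms MM.hopf_algebra_axioms
      bij phi_mult phi_one phi_colinear)

abbreviation "p\<^sub>M \<equiv> CM.p"
abbreviation "p\<^sub>A \<equiv> CA.p"

lemma proj_M_eq: "proj_M H \<phi> M = p\<^sub>M"
  by (simp add: fun_eq_iff proj_M_def CM.p_def)

lemma proj_A_eq: "proj_A H \<phi> A = p\<^sub>A"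
  by (simp add: fun_eq_iff proj_A_def CA.p_def)

text \<open>The compatibility conditions at \<open>a' = 1\<close>, where \<open>\<rho>(1) = 1 \<otimes> 1\<close> and \<open>\<phi>(1) = 1\<close>.\<close>

lemma p\<^sub>M_lie:
  assumes a: "a \<in> carrier A" and m: "m \<in> carrier M"
  shows "act M (bracket A \<one>\<^bsub>A\<^esub> a) (p\<^sub>M m) = lie_act M \<one>\<^bsub>A\<^esub> (act M a (p\<^sub>M m))"
proof -
  have "(\<lambda>x h. lie_act M (\<phi> h) (act M a (p\<^sub>M (act M x m)))) \<in> bilinear_maps K A H M"
    using a m by (intro bilinear_mapsI bilinear_left[OF lie_act_bilinear] bilinear_right[OF lie_act_bilinear]
        bilinear_right[OF act_bilinear a] bilinear_left[OF act_bilinear] CM.phi_lin linear_comp[OF CM.p_linear]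
        linear_id CM.phi_closed) simp_all
  from MM.A.MH.lift_pure[OF MM.module_M this A.one_closed MM.H.one_closed] show ?thesis
    using cond_M[OF a A.one_closed m] a m by (simp add: proj_M_eq coact_one phi_one act_one)
qed

lemma p\<^sub>A_lie:
  assumes a: "a \<in> carrier A" and x: "x \<in> carrier A"
  shows "bracket A \<one>\<^bsub>A\<^esub> a \<otimes>\<^bsub>A\<^esub> p\<^sub>A x = bracket A \<one>\<^bsub>A\<^esub> (a \<otimes>\<^bsub>A\<^esub> p\<^sub>A x)"
proof -
  have "(\<lambda>y h. bracket A (\<phi> h) (a \<otimes>\<^bsub>A\<^esub> p\<^sub>A (y \<otimes>\<^bsub>A\<^esub> x))) \<in> bilinear_maps K A H A"
    using a x by (intro bilinear_mapsI bilinear_left[OF bracket_bilinear] bilinear_right[OF bracket_bilinear]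
        bilinear_right[OF mult_bilinear a] bilinear_left[OF mult_bilinear] CM.phi_lin linear_comp[OF CA.p_linear]
        linear_id CM.phi_closed) simp_all
  from MM.A.MH.lift_pure[OF MM.A_module this A.one_closed MM.H.one_closed] show ?thesis
    using cond_A[OF a A.one_closed x] a x by (simp add: proj_A_eq coact_one phi_one)
qed

lemma p\<^sub>M_in_N: "m \<in> carrier M \<Longrightarrow> p\<^sub>M m \<in> carrier N"
  using CM.p_coinvariant[of m] tp_invariantsI[of "p\<^sub>M m"] p\<^sub>M_lie[of _ m]
  by (simp add: coinvariants_def)

lemma p\<^sub>A_in_B: "a \<in> carrier A \<Longrightarrow> p\<^sub>A a \<in> carrier B"
  using CA.p_coinvariant[of a] centerI[of "p\<^sub>A a"] p\<^sub>A_lie[of _ a]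
  by (simp add: B_carrier coinvariants_def)

text \<open>The inverse \<open>m \<mapsto> \<phi>(m\<^sub>1) \<otimes>\<^sub>B p\<^sub>M(m\<^sub>0)\<close> of \<open>\<alpha>\<close>.\<close>

definition \<beta> :: "'m \<Rightarrow> ('a \<times> 'm) list set" where
  "\<beta> m = tensor_lift Ind (\<lambda>x h. I.t (\<phi> h) (p\<^sub>M x)) (mcoact M m)"

lemma beta_bilinear: "(\<lambda>x h. I.t (\<phi> h) (p\<^sub>M x)) \<in> bilinear_maps K M H Ind"
proof (rule bilinear_mapsI)
  show "(\<lambda>h. I.t (\<phi> h) (p\<^sub>M x)) \<in> linear_maps K H Ind" if "x \<in> carrier M" for x
    by (intro t_lin CM.phi_lin linear_id p\<^sub>M_in_N that)
  fix h assume h: "h \<in> carrier H"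
  note pl = linear_mapsD[OF CM.p_linear]
  show "(\<lambda>x. I.t (\<phi> h) (p\<^sub>M x)) \<in> linear_maps K M Ind"
  proof (rule linear_mapsI)
    fix x assume x: "x \<in> carrier M"
    show "I.t (\<phi> h) (p\<^sub>M x) \<in> carrier Ind" using h x by (intro t_Ind p\<^sub>M_in_N CM.phi_closed)
    show "I.t (\<phi> h) (p\<^sub>M (x \<oplus>\<^bsub>M\<^esub> y)) = I.t (\<phi> h) (p\<^sub>M x) \<oplus>\<^bsub>Ind\<^esub> I.t (\<phi> h) (p\<^sub>M y)"
      if y: "y \<in> carrier M" for y
      using I.pure_add_right[OF _ p\<^sub>M_in_N[OF x] p\<^sub>M_in_N[OF y], of "\<phi> h"] x y h by (simp add: pl)
    show "I.t (\<phi> h) (p\<^sub>M (c \<odot>\<^bsub>M\<^esub> x)) = c \<odot>\<^bsub>Ind\<^esub> I.t (\<phi> h) (p\<^sub>M x)" if c: "c \<in> carrier K" for c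
      using t_smult_right[OF c _ p\<^sub>M_in_N[OF x], of "\<phi> h"] x h c by (simp only: pl CM.phi_closed)
  qed
qed

lemma beta_linear: "\<beta> \<in> linear_maps K M Ind"
  unfolding \<beta>_def by (rule MM.M.sw_lin[OF Ind_module beta_bilinear linear_id])

lemma induced_map_beta:
  assumes m: "m \<in> carrier M"
  shows "induced_map M (\<beta> m) = m"
proof -
  have "induced_map M (\<beta> m) = tensor_lift M (\<lambda>x h. induced_map M (I.t (\<phi> h) (p\<^sub>M x))) (mcoact M m)"
    unfolding \<beta>_def
    by (rule MM.M.sw_image[OF induced_map_linear Ind_module MM.module_M m])
      (intro t_Ind p\<^sub>M_in_N CM.phi_closed)
  also have "\<dots> = tensor_lift M (\<lambda>x h. act M (\<phi> h) (p\<^sub>M x)) (mcoact M m)"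
    by (rule MM.M.sw_cong[OF m]) (simp only: induced_map_t p\<^sub>M_in_N CM.phi_closed)
  also have "\<dots> = m" by (rule CM.sw_phi_p[OF m])
  finally show ?thesis .
qed

lemma beta_induced_map:
  assumes X: "X \<in> carrier Ind"
  shows "\<beta> (induced_map M X) = X"
proof (rule Ind_eqI[OF linear_comp[OF beta_linear induced_map_linear] linear_id _ X])
  fix a n assume a: "a \<in> carrier A" and n: "n \<in> carrier N"
  note nM = N_closed[OF n] and nco = N_coact[OF n]
  have "\<beta> (induced_map M (I.t a n)) = tensor_lift Ind (\<lambda>x h. I.t (\<phi> h) (p\<^sub>M x))
      (tensor_lift MM.MH (\<lambda>x h. MM.tt (act M x n) h) (coact A a))"
    by (simp only: \<beta>_def induced_map_t a n MM.rho_dot_coinvariant[OF a nM nco])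
  also have "\<dots> = tensor_lift Ind (\<lambda>y k. tensor_lift Ind (\<lambda>x h. I.t (\<phi> h) (p\<^sub>M x)) (MM.tt (act M y n) k)) (coact A a)"
    by (rule MM.M.MH.lift_lift[OF Ind_module beta_bilinear MM.A.MH.tensor_factors_axioms])
      (use a nM in \<open>simp_all add: MM.M.MH.pure_closed\<close>)
  also have "\<dots> = tensor_lift Ind (\<lambda>y k. I.t (\<phi> k \<otimes>\<^bsub>A\<^esub> p\<^sub>A y) n) (coact A a)"
  proof (rule MM.A.sw_cong[OF a])
    fix y k assume y: "y \<in> carrier A" and k: "k \<in> carrier H"
    have "tensor_lift Ind (\<lambda>x h. I.t (\<phi> h) (p\<^sub>M x)) (MM.tt (act M y n) k) = I.t (\<phi> k) (p\<^sub>M (act M y n))"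
      by (rule MM.M.MH.lift_pure[OF Ind_module beta_bilinear act_closed[OF y nM] k])
    also have "p\<^sub>M (act M y n) = act M (p\<^sub>A y) n"
      unfolding CM.p_dot_coinvariant[OF y nM nco] CA.p_def ..
    also have "I.t (\<phi> k) (act M (p\<^sub>A y) n) = I.t (p\<^sub>A y \<otimes>\<^bsub>A\<^esub> \<phi> k) n"
      using I.pure_balanced[OF p\<^sub>A_in_B[OF y] _ n, of "\<phi> k"] k by simp
    finally show "tensor_lift Ind (\<lambda>x h. I.t (\<phi> h) (p\<^sub>M x)) (MM.tt (act M y n) k) = I.t (\<phi> k \<otimes>\<^bsub>A\<^esub> p\<^sub>A y) n"
      using y k by (simp add: A.m_comm)
  qed
  also have "\<dots> = I.t (tensor_lift A (\<lambda>y k. \<phi> k \<otimes>\<^bsub>A\<^esub> p\<^sub>A y) (coact A a)) n"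
    by (rule MM.A.sw_image[OF t_linear[OF n] MM.A_module Ind_module a, symmetric]) simp
  also have "\<dots> = I.t a n" by (simp only: CA.sw_phi_p[OF a])
  finally show "\<beta> (induced_map M (I.t a n)) = I.t a n" .
qed

lemma induced_map_iso: "induced_map M \<in> tp_hopf_isos K H A Ind M"
proof -
  have "bij_betw (induced_map M) (carrier Ind) (carrier M)"
    by (rule bij_betw_byWitness[where f' = \<beta>])
      (auto simp: beta_induced_map induced_map_beta linear_mapsD(1)[OF beta_linear]
        linear_mapsD(1)[OF induced_map_linear] simp del: Ind_fields)
  then show ?thesis using induced_map_hom by (simp add: tp_hopf_isos_def)
qed

end

theorem theorem3p6:
  fixes K :: "('k, 'x) ring_scheme"
    and H :: "('k, 'h, 'y) hopf_algebra_scheme"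
    and A :: "('k, 'a, 'h, 'z) comodule_tp_algebra_scheme"
    and M :: "('k, 'a, 'm, 'h, 'w) tp_hopf_module_scheme"
    and \<phi> :: "'h \<Rightarrow> 'a"
  assumes field: "field K"
    and char_0: "\<And>n::nat. [n] \<cdot>\<^bsub>K\<^esub> \<one>\<^bsub>K\<^esub> = \<zero>\<^bsub>K\<^esub> \<Longrightarrow> n = 0"
    and H: "hopf_algebra K H" "bijective_antipode H"
    and A: "comodule_tp_algebra K H A"
    and M: "tp_hopf_module K H A M"
    and \<phi>_algebra_map: "\<phi> \<in> algebra_homs K H (A\<lparr>carrier := tp_center A\<rparr>)"
    and \<phi>_colinear: "\<phi> \<in> colinear_maps K H H (comult H) A (coact A)"
    and cond_M: "\<And>a a' m. \<lbrakk>a \<in> carrier A; a' \<in> carrier A; m \<in> carrier M\<rbrakk> \<Longrightarrow>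
      act M (bracket A \<one>\<^bsub>A\<^esub> (a \<otimes>\<^bsub>A\<^esub> a')) (proj_M H \<phi> M m) =
        tensor_lift M (\<lambda>x h. lie_act M (\<phi> h) (act M a (proj_M H \<phi> M (act M x m)))) (coact A a')"
    and cond_A: "\<And>a a' a''. \<lbrakk>a \<in> carrier A; a' \<in> carrier A; a'' \<in> carrier A\<rbrakk> \<Longrightarrow>
      bracket A \<one>\<^bsub>A\<^esub> (a \<otimes>\<^bsub>A\<^esub> a') \<otimes>\<^bsub>A\<^esub> proj_A H \<phi> A a'' =
        tensor_lift A (\<lambda>x h. bracket A (\<phi> h) (a \<otimes>\<^bsub>A\<^esub> proj_A H \<phi> A (x \<otimes>\<^bsub>A\<^esub> a''))) (coact A a')"
  shows "tp_hopf_module K H A (induced_hopf_module K H A M) \<and>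
    (\<forall>a\<in>carrier A. \<forall>m\<in>carrier (coinv_invariants K H A M).
      induced_map M (induced_pure K H A M a m) = act M a m) \<and>
    induced_map M \<in> tp_hopf_isos K H A (induced_hopf_module K H A M) M"
proof -
  have hom: "\<phi> \<in> ring_hom H (A\<lparr>carrier := tp_center A\<rparr>)"
    using \<phi>_algebra_map by (simp add: algebra_homs_def)
  interpret tp_hopf_section K H A M \<phi>
  proof (intro tp_hopf_section.intro tp_hopf_section_axioms.intro M H \<phi>_colinear cond_M cond_A)
    show "\<phi> (h \<otimes>\<^bsub>H\<^esub> k) = \<phi> h \<otimes>\<^bsub>A\<^esub> \<phi> k" if "h \<in> carrier H" "k \<in> carrier H" for h k
      using ring_hom_mult[OF hom that] by simp
    show "\<phi> \<one>\<^bsub>H\<^esub> = \<one>\<^bsub>A\<^esub>"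
      using ring_hom_one[OF hom] by simp
  qed
  show ?thesis
    using induced_is_hopf_module induced_map_iso induced_map_t by (simp add: induced_pure_def)
qed

end
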